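(* Let $N=2$, $k>0$, $f(u)=e^u$, and consider the problem $$-\Delta u=\lambda V_k(|x|)f(u)\ \text{ in } B_1,\qquad u>0\ \text{ in } B_1,\qquad u=0\ \text{ on }\partial B_1, \qquad (P)$$ with $\lambda>0$ and $V_k(r)=\dfrac{1}{r^2(-\log(r/e))^{2+k}}$. Then the set of radial solutions $(\lambda,u)$ of $(P)$ is described as $$\{(\lambda(\beta),u(r,\alpha(\beta)));\ \beta\in\mathbb{R}\}\quad\text{with}\quad \alpha(\beta)=\beta-\log\lambda(\beta),$$ where $\alpha(\beta):=\lVert u(\cdot,\alpha(\beta))\rVert_{L^\infty(B_1)}=u(0,\alpha(\beta))$ (so the radial solution with parameter $\beta$ is the one satisfying $u(0)+\log\lambda=\beta$). Every radial solution $u$ belongs to $H^1_0(B_1)$ and satisfies $(P)$ in the weak sense. Moreover, $\mathcal{C}:=\{(\lambda(\beta),\alpha(\beta));\ \beta\in\mathbb{R}\}$ is an unbounded analytic curve emanating from $(0,0)$, and there exists $0<\lambda^*<\infty$ such that $\lambda(\beta)\le\lambda^*$ for all $\beta\in\mathbb{R}$.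
   Context: $B_1\subset\mathbb{R}^2$ is the open unit ball, $r=|x|$. A pair $(\lambda,u)$ with $\lambda>0$ is a radial solution of $(P)$ if $u$ is radial, continuous on $[0,1]$ as a function of $r$, of class $C^2$ on $(0,1]$, and satisfies $(P)$ (the equation holding pointwise for $0<r<1$). "Analytic curve emanating from $(0,0)$" means that $\beta\mapsto(\lambda(\beta),\alpha(\beta))$ is real analytic and $(\lambda(\beta),\alpha(\beta))\to(0,0)$ as $\beta\to-\infty$. *)

theory Defs
  imports "HOL-Analysis.Analysis" "HOL-Probability.Essential_Supremum"
begin

definition partial :: "'a::euclidean_space \<Rightarrow> ('a \<Rightarrow> real) \<Rightarrow> 'a \<Rightarrow> real" where
  "partial b f x = frechet_derivative f (at x) b"

definition gradient :: "('a::euclidean_space \<Rightarrow> real) \<Rightarrow> 'a \<Rightarrow> 'a" where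
  "gradient f x = (\<Sum>b\<in>Basis. partial b f x *\<^sub>R b)"

definition laplacian :: "('a::euclidean_space \<Rightarrow> real) \<Rightarrow> 'a \<Rightarrow> real" where
  "laplacian f x = (\<Sum>b\<in>Basis. partial b (partial b f) x)"

primrec C_k :: "nat \<Rightarrow> ('a::euclidean_space \<Rightarrow> real) \<Rightarrow> bool" where
  "C_k 0 f \<longleftrightarrow> continuous_on UNIV f"
| "C_k (Suc n) f \<longleftrightarrow> (\<forall>x. f differentiable (at x)) \<and> (\<forall>b\<in>Basis. C_k n (partial b f))"

(* Derivatives are taken within S, hence one-sided at an endpoint belonging to S. *)
definition C2_on :: "real set \<Rightarrow> (real \<Rightarrow> real) \<Rightarrow> bool" where
  "C2_on S v \<longleftrightarrow> (\<exists>v' v''. 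
     (\<forall>r\<in>S. (v has_real_derivative v' r) (at r within S)) \<and>
     (\<forall>r\<in>S. (v' has_real_derivative v'' r) (at r within S)) \<and>
     continuous_on S v'')"

definition real_analytic_on :: "real set \<Rightarrow> (real \<Rightarrow> 'b::real_normed_vector) \<Rightarrow> bool" where
  "real_analytic_on S f \<longleftrightarrow> (\<forall>x\<in>S. \<exists>a. \<exists>e>0. \<forall>y. \<bar>y - x\<bar> < e \<longrightarrow> 
     (\<lambda>n. (y - x) ^ n *\<^sub>R a n) sums f y)"

(* The test functions C_c^infinity(S) for open S, extended by zero to the whole space. *)
definition test_function :: "'a::euclidean_space set \<Rightarrow> ('a \<Rightarrow> real) \<Rightarrow> bool" where
  "test_function S \<phi> \<longleftrightarrow> (\<forall>n. C_k n \<phi>) \<and> 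
     compact (closure {x. \<phi> x \<noteq> 0}) \<and> closure {x. \<phi> x \<noteq> 0} \<subseteq> S"

definition L2_on :: "'a::euclidean_space set \<Rightarrow> ('a \<Rightarrow> 'b::euclidean_space) \<Rightarrow> bool" where
  "L2_on S f \<longleftrightarrow> f \<in> borel_measurable (lebesgue_on S) \<and> 
     integrable (lebesgue_on S) (\<lambda>x. (norm (f x))\<^sup>2)"

(* u lies in H^1(S) and G is a representative of its weak gradient. *)
definition H1_grad :: "'a::euclidean_space set \<Rightarrow> ('a \<Rightarrow> real) \<Rightarrow> ('a \<Rightarrow> 'a) \<Rightarrow> bool" where
  "H1_grad S u G \<longleftrightarrow> L2_on S u \<and> L2_on S G \<and> 
     (\<forall>\<phi>. test_function S \<phi> \<longrightarrow> 
        (LINT x|lebesgue_on S. u x *\<^sub>R gradient \<phi> x) = - (LINT x|lebesgue_on S. \<phi> x *\<^sub>R G x))"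

(* H^1_0(S) is the closure of C_c^infinity(S) in the norm of H^1(S). *)
definition H10_grad :: "'a::euclidean_space set \<Rightarrow> ('a \<Rightarrow> real) \<Rightarrow> ('a \<Rightarrow> 'a) \<Rightarrow> bool" where
  "H10_grad S u G \<longleftrightarrow> H1_grad S u G \<and> 
     (\<exists>\<phi>. (\<forall>n::nat. test_function S (\<phi> n)) \<and>
        (\<lambda>n. (LINT x|lebesgue_on S. (u x - \<phi> n x)\<^sup>2) + 
              (LINT x|lebesgue_on S. (norm (G x - gradient (\<phi> n) x))\<^sup>2)) \<longlonglongrightarrow> 0)"

definition H10 :: "'a::euclidean_space set \<Rightarrow> ('a \<Rightarrow> real) set" where
  "H10 S = {u. \<exists>G. H10_grad S u G}"

abbreviation B1 :: "(real ^ 2) set" where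
  "B1 \<equiv> ball 0 1"

definition V :: "real \<Rightarrow> real \<Rightarrow> real" where
  "V k r = 1 / (r\<^sup>2 * (- ln (r / exp 1)) powr (2 + k))"

(* Radial functions on the closed disc are represented by their zero extension to the plane
   (last conjunct), so that functions agreeing on the closed disc are equal. *)
definition radial_solutions :: "real \<Rightarrow> (real \<times> (real ^ 2 \<Rightarrow> real)) set" where
  "radial_solutions k = {(lam, u). lam > 0 \<and>
     (\<exists>v. continuous_on {0..1} v \<and> C2_on {0<..1} v \<and> (\<forall>x\<in>cball 0 1. u x = v (norm x))) \<and>
     (\<forall>x\<in>B1 - {0}. - laplacian u x = lam * V k (norm x) * exp (u x)) \<and>
     (\<forall>x\<in>B1. u x > 0) \<and>
     (\<forall>x\<in>sphere 0 1. u x = 0) \<and>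
     (\<forall>x. x \<notin> cball 0 1 \<longrightarrow> u x = 0)}"

definition weak_solution :: "real \<Rightarrow> real \<Rightarrow> (real ^ 2 \<Rightarrow> real) \<Rightarrow> bool" where
  "weak_solution k lam u \<longleftrightarrow> (\<exists>G. H10_grad B1 u G \<and>
     (\<forall>\<phi> \<Phi>. H10_grad B1 \<phi> \<Phi> \<longrightarrow>
        integrable (lebesgue_on B1) (\<lambda>x. V k (norm x) * exp (u x) * \<phi> x) \<and>
        (LINT x|lebesgue_on B1. G x \<bullet> \<Phi> x) = 
          lam * (LINT x|lebesgue_on B1. V k (norm x) * exp (u x) * \<phi> x)))"

end

theory Submission
  imports Defs
begin

text \<open>
  In the variables \<open>t = 1 - ln r\<close> and \<open>x = \<beta> / k - ln t\<close> the radial equation becomes, for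
  \<open>E = \<lambda> t\<^sup>-\<^sup>k exp v\<close> and \<open>G = - dv/dx\<close>, the autonomous system \<open>E' = E (k - G)\<close>, \<open>G' = E - G\<close>,
  independent of \<open>\<beta> = v(0) + ln \<lambda>\<close>. Writing \<open>E = exp (k x + Y)\<close>, boundedness of \<open>v\<close> at the origin
  means \<open>Y \<rightarrow> 0\<close> and \<open>exp(x) G \<rightarrow> 0\<close> as \<open>x \<rightarrow> -\<infinity>\<close>. Exactly one orbit has this property; it starts as a
  power series in \<open>exp (k x)\<close>, stays in a compact region, and is therefore global and analytic. Hence
  \<open>\<lambda>(\<beta>) = E(\<beta> / k)\<close> and \<open>\<alpha>(\<beta>) = - Y(\<beta> / k)\<close>. The quantity \<open>exp(x) (G - E / (1 + k))\<close> increases from \<open>0\<close>, which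
  gives \<open>exp (- Y) \<ge> 1 + exp (k x) / (k (1 + k))\<close> and with it both the bound on \<open>\<lambda>\<close> and the
  unboundedness of \<open>\<alpha>\<close>.

  For the weak formulation, \<open>A = - r v'\<close> increases from \<open>0\<close>, and smooth truncations of \<open>A\<close> and \<open>v\<close>
  near the origin and the boundary give test fields and test functions for which the
  divergence theorem holds without singular terms. Fatou's lemma then yields successively
  \<open>V exp u \<in> L\<^sup>1\<close> and \<open>\<nabla>u \<in> L\<^sup>2\<close>, and dominated convergence the identities themselves.
\<close>

section \<open>Power series for the autonomous system\<close>

text \<open>Since the system is autonomous, \<open>\<beta>\<close> only shifts \<open>x\<close>: the
  boundary \<open>r = 1\<close> sits at \<open>x = \<beta> / k\<close> and the origin at minus
  infinity, and the boundary condition reads \<open>Y (\<beta> / k) = - v 0\<close>. Up to a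
  constant factor \<open>exp x * G\<close> is \<open>- r v'\<close>; its vanishing at minus infinity
  excludes the logarithmic singularity, and boundedness of \<open>v\<close> is enough to force it.

  No Cauchy data can be prescribed at minus infinity. A series in \<open>exp (k x)\<close> replaces
  them for existence, and a contraction on a left half-line replaces them for uniqueness.

  On the side of the partial differential equation, the right-hand side is singular at the origin
  and no derivative of \<open>u\<close> is given there, so \<open>u\<close> is not directly
  admissible in the divergence theorem. Truncating the values of \<open>A\<close> and
  \<open>v\<close>, instead of cutting off in \<open>r\<close>, keeps the gradients of the truncated
  functions equal to bounded nonnegative multiples of the gradient of \<open>v\<close>. All critical
  integrands therefore have a sign, which is what Fatou's lemma needs.\<close>

lemma geometric_bound_summable:
  fixes a :: "nat \<Rightarrow> real"
  assumes "\<And>n. \<bar>a n\<bar> \<le> M * R ^ n" "R > 0" "\<bar>x\<bar> < 1 / R"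
  shows "summable (\<lambda>n. norm (a n * x ^ n))"
proof (rule summable_comparison_test')
  show "summable (\<lambda>n. M * (R * \<bar>x\<bar>) ^ n)"
    using assms by (intro summable_mult summable_geometric) (auto simp: field_simps)
  show "norm (norm (a n * x ^ n)) \<le> M * (R * \<bar>x\<bar>) ^ n" if "n \<ge> 0" for n
    using mult_right_mono[OF assms(1)[of n], of "\<bar>x\<bar> ^ n"]
    by (simp add: abs_mult power_abs power_mult_distrib)
qed

lemma geometric_bound_DERIV:
  fixes a :: "nat \<Rightarrow> real"
  assumes "\<And>n. \<bar>a n\<bar> \<le> M * R ^ n" "R > 0" "\<bar>x\<bar> < 1 / R"
  shows "((\<lambda>x. \<Sum>n. a n * x ^ n) has_real_derivative (\<Sum>n. diffs a n * x ^ n)) (at x)"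
  by (rule termdiffs_strong'[of "1 / R"])
     (use assms(3) summable_norm_cancel[OF geometric_bound_summable[OF assms(1,2)]] in auto)

lemma geometric_bound_diffs_summable:
  fixes a :: "nat \<Rightarrow> real"
  assumes "\<And>n. \<bar>a n\<bar> \<le> M * R ^ n" "R > 0" "\<bar>x\<bar> < 1 / R"
  shows "summable (\<lambda>n. diffs a n * x ^ n)"
  by (rule termdiff_converges[of _ "1 / R"])
     (use assms(3) summable_norm_cancel[OF geometric_bound_summable[OF assms(1,2)]] in auto)

text \<open>Taylor coefficients for \<open>E' = E * (k - G)\<close> and \<open>G' = E - G\<close>,
  the product \<open>E * G\<close> becoming a Cauchy product; pairs encode the mutual
  recursion.\<close>

fun flow_coeffs :: "real \<Rightarrow> real \<Rightarrow> real \<Rightarrow> nat \<Rightarrow> real \<times> real" where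
  "flow_coeffs k e g 0 = (e, g)"
| "flow_coeffs k e g (Suc n) =
     ((k * fst (flow_coeffs k e g n) -
         (\<Sum>i\<le>n. fst (flow_coeffs k e g i) * snd (flow_coeffs k e g (n - i)))) / (n + 1),
      (fst (flow_coeffs k e g n) - snd (flow_coeffs k e g n)) / (n + 1))"

text \<open>The sum has \<open>n + 1\<close> terms, each at most \<open>M * N * R ^ n\<close>. The
  division by \<open>n + 1\<close> in the recursions removes exactly this factor, so geometric
  bounds reproduce themselves.\<close>

lemma convolution_bound:
  fixes a b :: "nat \<Rightarrow> real"
  assumes "\<And>i. i \<le> n \<Longrightarrow> \<bar>a i\<bar> \<le> M * R ^ i" "\<And>i. i \<le> n \<Longrightarrow> \<bar>b i\<bar> \<le> N * R ^ i"
    "M \<ge> 0" "N \<ge> 0" "R \<ge> 0"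
  shows "\<bar>\<Sum>i\<le>n. a i * b (n - i)\<bar> \<le> (n + 1) * (M * N * R ^ n)"
proof -
  have "\<bar>\<Sum>i\<le>n. a i * b (n - i)\<bar> \<le> (\<Sum>i\<le>n. \<bar>a i\<bar> * \<bar>b (n - i)\<bar>)"
    by (rule order_trans[OF sum_abs]) (simp add: abs_mult)
  also have "\<dots> \<le> (\<Sum>i\<le>n. (M * R ^ i) * (N * R ^ (n - i)))"
    using assms by (intro sum_mono mult_mono) auto
  also have "\<dots> = (\<Sum>i\<le>n. M * N * R ^ n)"
    by (rule sum.cong) (auto simp: algebra_simps simp flip: power_add)
  finally show ?thesis by (simp add: algebra_simps)
qed

text \<open>One step of the recursion multiplies the bound by \<open>k + M\<close> in the first
  component and by \<open>2\<close> in the second; \<open>M \<ge> 1\<close> makes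
  \<open>k + M + 1\<close> dominate both.\<close>

lemma flow_coeffs_bound:
  fixes k e g M :: real
  assumes "k > 0" "M \<ge> 1" "\<bar>e\<bar> \<le> M" "\<bar>g\<bar> \<le> M"
  shows "\<bar>fst (flow_coeffs k e g n)\<bar> \<le> M * (k + M + 1) ^ n \<and>
         \<bar>snd (flow_coeffs k e g n)\<bar> \<le> M * (k + M + 1) ^ n"
proof (induction n rule: less_induct)
  case (less n)
  let ?R = "k + M + 1" and ?c = "flow_coeffs k e g"
  show ?case
  proof (cases n)
    case 0
    then show ?thesis using assms by simp
  next
    case (Suc m)
    have pos: "?R ^ m \<ge> 0" using assms by simp
    have E: "\<bar>fst (?c i)\<bar> \<le> M * ?R ^ i" "\<bar>snd (?c i)\<bar> \<le> M * ?R ^ i" if "i \<le> m" for i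
      using less[of i] that Suc by auto
    have "\<bar>\<Sum>i\<le>m. fst (?c i) * snd (?c (m - i))\<bar> \<le> (m + 1) * (M * M * ?R ^ m)"
      unfolding of_nat_add of_nat_1 by (rule convolution_bound) (use E assms in auto)
    moreover have "\<bar>k * fst (?c m)\<bar> \<le> (m + 1) * (k * (M * ?R ^ m))"
    proof -
      have "\<bar>k * fst (?c m)\<bar> \<le> 1 * (k * (M * ?R ^ m))"
        using E[of m] assms by (simp add: abs_mult)
      also have "\<dots> \<le> (m + 1) * (k * (M * ?R ^ m))"
        using assms pos by (intro mult_right_mono) auto
      finally show ?thesis .
    qed
    ultimately have "\<bar>fst (?c n)\<bar> * (m + 1) \<le> (m + 1) * (M * M * ?R ^ m) + (m + 1) * (k * (M * ?R ^ m))"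
      unfolding Suc by (simp add: abs_divide)
    also have "\<dots> = (m + 1) * ((M + k) * (M * ?R ^ m))" by (simp add: algebra_simps)
    finally have "\<bar>fst (?c n)\<bar> \<le> (M + k) * (M * ?R ^ m)"
      by (subst (asm) mult.commute) (metis mult_le_cancel_left_pos of_nat_0_less_iff zero_less_Suc Suc_eq_plus1)
    also have "\<dots> \<le> ?R * (M * ?R ^ m)"
      using pos assms by (intro mult_right_mono) auto
    finally have 1: "\<bar>fst (?c n)\<bar> \<le> M * ?R ^ n" by (simp add: Suc algebra_simps)
    have "\<bar>snd (?c n)\<bar> \<le> \<bar>fst (?c m) - snd (?c m)\<bar> / 1"
      unfolding Suc by (simp only: flow_coeffs.simps snd_conv abs_divide) (rule divide_left_mono, auto)
    also have "\<dots> \<le> 2 * (M * ?R ^ m)" using E[of m] by auto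
    also have "\<dots> \<le> ?R * (M * ?R ^ m)"
      using pos assms by (intro mult_right_mono) auto
    finally show ?thesis using 1 by (simp add: Suc algebra_simps)
  qed
qed

text \<open>The radius of convergence depends only on a bound for the initial values; this makes the
  continuation step below uniform.\<close>

lemma flow_power_series:
  fixes k e g M :: real
  assumes k: "k > 0" and M: "M \<ge> 1" "\<bar>e\<bar> \<le> M" "\<bar>g\<bar> \<le> M"
  obtains a b :: "nat \<Rightarrow> real" and E G :: "real \<Rightarrow> real"
  where "\<And>n. \<bar>a n\<bar> \<le> M * (k + M + 1) ^ n" "\<And>n. \<bar>b n\<bar> \<le> M * (k + M + 1) ^ n"
    "E 0 = e" "G 0 = g"
    "\<And>x. \<bar>x\<bar> < 1 / (k + M + 1) \<Longrightarrow> (\<lambda>n. a n * x ^ n) sums E x"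
    "\<And>x. \<bar>x\<bar> < 1 / (k + M + 1) \<Longrightarrow> (\<lambda>n. b n * x ^ n) sums G x"
    "\<And>x. \<bar>x\<bar> < 1 / (k + M + 1) \<Longrightarrow> (E has_real_derivative E x * (k - G x)) (at x)"
    "\<And>x. \<bar>x\<bar> < 1 / (k + M + 1) \<Longrightarrow> (G has_real_derivative E x - G x) (at x)"
proof -
  define R where "R = k + M + 1"
  have R: "R > 0" using k M by (simp add: R_def)
  define a where "a n = fst (flow_coeffs k e g n)" for n
  define b where "b n = snd (flow_coeffs k e g n)" for n
  have bd: "\<bar>a n\<bar> \<le> M * R ^ n" "\<bar>b n\<bar> \<le> M * R ^ n" for n
    using flow_coeffs_bound[OF k M] by (auto simp: a_def b_def R_def)
  define E where "E x = (\<Sum>n. a n * x ^ n)" for x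
  define G where "G x = (\<Sum>n. b n * x ^ n)" for x
  have sa: "summable (\<lambda>n. norm (a n * x ^ n))" and sb: "summable (\<lambda>n. norm (b n * x ^ n))"
    if "\<bar>x\<bar> < 1 / R" for x
    using geometric_bound_summable[OF bd(1) R that] geometric_bound_summable[OF bd(2) R that] .
  have da: "diffs a n = k * a n - (\<Sum>i\<le>n. a i * b (n - i))" for n
    by (simp add: diffs_def a_def b_def del: of_nat_Suc)
  have db: "diffs b n = a n - b n" for n
    by (simp add: diffs_def a_def b_def del: of_nat_Suc)
  have suma: "(\<lambda>n. a n * x ^ n) sums E x" and sumb: "(\<lambda>n. b n * x ^ n) sums G x"
    if "\<bar>x\<bar> < 1 / R" for x
    using sa[OF that] sb[OF that] by (simp_all only: E_def G_def summable_sums summable_norm_cancel)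
  have dE: "(E has_real_derivative E x * (k - G x)) (at x)" if x: "\<bar>x\<bar> < 1 / R" for x
  proof -
    have "(\<lambda>n. \<Sum>i\<le>n. (a i * x ^ i) * (b (n - i) * x ^ (n - i))) sums (E x * G x)"
      unfolding E_def G_def by (rule Cauchy_product_sums[OF sa[OF x] sb[OF x]])
    moreover have "(\<Sum>i\<le>n. (a i * x ^ i) * (b (n - i) * x ^ (n - i))) =
        (\<Sum>i\<le>n. a i * b (n - i)) * x ^ n" for n
      unfolding sum_distrib_right by (rule sum.cong) (auto simp: algebra_simps simp flip: power_add)
    ultimately have "(\<lambda>n. k * (a n * x ^ n) - (\<Sum>i\<le>n. a i * b (n - i)) * x ^ n) sums (k * E x - E x * G x)"
      by (intro sums_diff sums_mult suma[OF x]) simp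
    then have "(\<lambda>n. diffs a n * x ^ n) sums (k * E x - E x * G x)"
      by (simp add: da algebra_simps)
    then have "(\<Sum>n. diffs a n * x ^ n) = E x * (k - G x)"
      by (simp add: sums_unique[symmetric] algebra_simps)
    then show ?thesis
      using geometric_bound_DERIV[OF bd(1) R x] unfolding E_def[abs_def] by simp
  qed
  have dG: "(G has_real_derivative E x - G x) (at x)" if x: "\<bar>x\<bar> < 1 / R" for x
  proof -
    have "(\<lambda>n. diffs b n * x ^ n) sums (E x - G x)"
      using sums_diff[OF suma[OF x] sumb[OF x]] by (simp add: db algebra_simps)
    then have "(\<Sum>n. diffs b n * x ^ n) = E x - G x"
      by (simp add: sums_unique[symmetric])
    then show ?thesis
      using geometric_bound_DERIV[OF bd(2) R x] unfolding G_def[abs_def] by simp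
  qed
  have "E 0 = e" "G 0 = g"
    by (simp_all add: E_def G_def a_def b_def powser_zero)
  then show thesis
    using that[of a b E G] bd suma sumb dE dG unfolding R_def by blast
qed

text \<open>The equations are singular at \<open>q = exp (k x) = 0\<close>, where they nevertheless have the power
  series solution \<open>E = q H(q)\<close>, \<open>G = q K(q)\<close>.\<close>

fun germ_coeffs :: "real \<Rightarrow> nat \<Rightarrow> real" where
  "germ_coeffs k 0 = 1"
| "germ_coeffs k (Suc n) =
     - (\<Sum>i\<le>n. germ_coeffs k i * (germ_coeffs k (n - i) / (1 + k * (real (n - i) + 1)))) / (k * (n + 1))"

text \<open>The inner denominators are at least \<open>1\<close>, and the number of terms of the
  convolution cancels against the factor \<open>n + 1\<close> in \<open>k * (n + 1)\<close>, which
  leaves \<open>1 / k\<close> per step.\<close>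

lemma germ_coeffs_bound:
  fixes k :: real
  assumes "k > 0"
  shows "\<bar>germ_coeffs k n\<bar> \<le> 1 * (1 / k) ^ n"
proof (induction n rule: less_induct)
  case (less n)
  show ?case
  proof (cases n)
    case (Suc m)
    have E: "\<bar>germ_coeffs k i\<bar> \<le> 1 * (1 / k) ^ i"
        "\<bar>germ_coeffs k i / (1 + k * (real i + 1))\<bar> \<le> 1 * (1 / k) ^ i" if "i \<le> m" for i
    proof -
      show 1: "\<bar>germ_coeffs k i\<bar> \<le> 1 * (1 / k) ^ i" using less[of i] that Suc by auto
      have "1 + k * (real i + 1) \<ge> 1" using assms by simp
      then have "\<bar>germ_coeffs k i\<bar> / \<bar>1 + k * (real i + 1)\<bar> \<le> \<bar>germ_coeffs k i\<bar> / 1"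
        by (intro divide_left_mono) auto
      then show "\<bar>germ_coeffs k i / (1 + k * (real i + 1))\<bar> \<le> 1 * (1 / k) ^ i" 
        using 1 unfolding abs_divide by linarith
    qed
    have "\<bar>\<Sum>i\<le>m. germ_coeffs k i * (germ_coeffs k (m - i) / (1 + k * (real (m - i) + 1)))\<bar>
        \<le> (m + 1) * (1 * 1 * (1 / k) ^ m)"
      unfolding of_nat_add of_nat_1 by (rule convolution_bound) (use E assms in auto)
    then have "\<bar>germ_coeffs k n\<bar> \<le> (m + 1) * (1 * 1 * (1 / k) ^ m) / (k * (m + 1))"
      using assms unfolding Suc germ_coeffs.simps abs_divide abs_minus_cancel
      by (subst abs_of_nonneg[of "k * _"]) (simp, rule divide_right_mono, simp_all)
    also have "\<dots> = (1 / k) ^ m * (1 / k)"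
      using nonzero_mult_divide_mult_cancel_right[of "real m + 1" "(1 / k) ^ m" k] 
      by (simp add: mult.commute add.commute)
    also have "\<dots> = (1 / k) ^ n" by (simp add: Suc)
    finally show ?thesis by simp
  qed simp
qed

text \<open>For \<open>q = exp (k x)\<close> the derivative in \<open>x\<close> is
  \<open>k q d/dq\<close>, so \<open>E' = E (k - G)\<close> becomes \<open>H' = - H K / k\<close>
  and \<open>G' = E - G\<close> becomes \<open>(q K)' = (H - K) / k\<close>. In coefficients the
  latter reads \<open>(1 + k (n + 1)) b n = h n\<close>, which determines \<open>K\<close> from
  \<open>H\<close>.\<close>

lemma germ_power_series:
  fixes k :: real
  assumes k: "k > 0"
  obtains H K :: "real \<Rightarrow> real"
  where "H 0 = 1"
    "\<And>q. \<bar>q\<bar> < k \<Longrightarrow> (H has_real_derivative - H q * K q / k) (at q)"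
    "\<And>q. \<bar>q\<bar> < k \<Longrightarrow> ((\<lambda>q. q * K q) has_real_derivative (H q - K q) / k) (at q)"
    "isCont K 0"
proof -
  define h where "h = germ_coeffs k"
  define b where "b n = h n / (1 + k * (real n + 1))" for n
  have pos: "1 + k * (real n + 1) > 0" for n
    using k by (intro add_pos_nonneg mult_nonneg_nonneg) auto
  define R where "R = 1 / k"
  have R: "R > 0" "1 / R = k" using k by (simp_all add: R_def)
  have bh: "\<bar>h n\<bar> \<le> 1 * R ^ n" for n
    using germ_coeffs_bound[OF k] by (simp add: h_def R_def)
  have bb: "\<bar>b n\<bar> \<le> 1 * R ^ n" for n
  proof -
    have "\<bar>h n\<bar> / \<bar>1 + k * (real n + 1)\<bar> \<le> \<bar>h n\<bar> / 1"
      using k pos[of n] by (intro divide_left_mono) auto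
    then show ?thesis using bh[of n] unfolding b_def abs_divide by linarith
  qed
  define H where "H x = (\<Sum>n. h n * x ^ n)" for x
  define K where "K x = (\<Sum>n. b n * x ^ n)" for x
  have sh: "summable (\<lambda>n. norm (h n * x ^ n))" and sb: "summable (\<lambda>n. norm (b n * x ^ n))"
    if "\<bar>x\<bar> < k" for x
    using geometric_bound_summable[OF bh R(1)] geometric_bound_summable[OF bb R(1)] that R by auto
  have dh: "diffs h n = - (\<Sum>i\<le>n. h i * b (n - i)) / k" for n
    using k by (simp add: diffs_def h_def b_def del: of_nat_Suc)
  have sumh: "(\<lambda>n. h n * x ^ n) sums H x" and sumb: "(\<lambda>n. b n * x ^ n) sums K x"
    if "\<bar>x\<bar> < k" for x
    using sh[OF that] sb[OF that] by (simp_all only: H_def K_def summable_sums summable_norm_cancel)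
  have dH: "(H has_real_derivative - H x * K x / k) (at x)" if x: "\<bar>x\<bar> < k" for x
  proof -
    have "(\<lambda>n. \<Sum>i\<le>n. (h i * x ^ i) * (b (n - i) * x ^ (n - i))) sums (H x * K x)"
      unfolding H_def K_def by (rule Cauchy_product_sums[OF sh[OF x] sb[OF x]])
    moreover have "(\<Sum>i\<le>n. (h i * x ^ i) * (b (n - i) * x ^ (n - i))) =
        (\<Sum>i\<le>n. h i * b (n - i)) * x ^ n" for n
      unfolding sum_distrib_right by (rule sum.cong) (auto simp: algebra_simps simp flip: power_add)
    ultimately have "(\<lambda>n. (\<Sum>i\<le>n. h i * b (n - i)) * x ^ n) sums (H x * K x)" by simp
    from sums_mult[OF this, of "- 1 / k"]
    have "(\<lambda>n. diffs h n * x ^ n) sums (- H x * K x / k)" by (simp add: dh)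
    then have "(\<Sum>n. diffs h n * x ^ n) = - H x * K x / k"
      by (simp add: sums_unique[symmetric])
    then show ?thesis
      using geometric_bound_DERIV[OF bh R(1), of x] R x unfolding H_def[abs_def] by simp
  qed
  have dK0: "(K has_real_derivative (\<Sum>n. diffs b n * x ^ n)) (at x)" 
    and sdb: "summable (\<lambda>n. diffs b n * x ^ n)" if x: "\<bar>x\<bar> < k" for x
    using geometric_bound_DERIV[OF bb R(1), of x] geometric_bound_diffs_summable[OF bb R(1), of x] R x
    unfolding K_def[abs_def] by simp_all
  have dK: "((\<lambda>q. q * K q) has_real_derivative (H x - K x) / k) (at x)" if x: "\<bar>x\<bar> < k" for x
  proof -
    define D where "D = (\<Sum>n. diffs b n * x ^ n)"
    have "(\<lambda>n. diffs b n * x ^ n) sums D"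
      unfolding D_def using sdb[OF x] by (rule summable_sums)
    from sums_mult2[OF this, of x] 
    have "(\<lambda>n. real (Suc n) * b (Suc n) * x ^ Suc n) sums (D * x)"
      by (simp add: diffs_def mult_ac)
    then have "(\<lambda>n. real n * b n * x ^ n) sums (D * x)"
      by (subst (asm) sums_Suc_iff) simp
    from sums_add[OF sumb[OF x] this]
    have 1: "(\<lambda>n. (real n + 1) * b n * x ^ n) sums (K x + D * x)"
      by (simp add: algebra_simps)
    have "(real n + 1) * b n = (h n - b n) / k" for n
    proof -
      have "h n = b n * (1 + k * (real n + 1))" using pos[of n] by (simp add: b_def)
      then have "h n - b n = k * ((real n + 1) * b n)" by (simp only:) (simp add: algebra_simps)
      then show ?thesis using k by simp
    qed
    with 1 have "(\<lambda>n. (h n - b n) / k * x ^ n) sums (K x + D * x)" by simp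
    moreover have "(\<lambda>n. (h n - b n) / k * x ^ n) sums ((H x - K x) / k)"
      using sums_divide[OF sums_diff[OF sumh[OF x] sumb[OF x]], of k] 
      by (simp add: algebra_simps diff_divide_distrib)
    ultimately have "K x + D * x = (H x - K x) / k" by (rule sums_unique2)
    then show ?thesis
      using DERIV_mult[OF DERIV_ident dK0[OF x]] by (simp add: D_def mult.commute add.commute)
  qed
  have "H 0 = 1" by (simp add: H_def h_def powser_zero)
  moreover have "isCont K 0" using dK0[of 0] k by (auto intro: DERIV_isCont)
  ultimately show thesis using that[of H K] dH dK by blast
qed

section \<open>Flows coming from minus infinity\<close>

definition flow_on :: "real \<Rightarrow> real set \<Rightarrow> (real \<Rightarrow> real) \<Rightarrow> (real \<Rightarrow> real) \<Rightarrow> bool" where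
  "flow_on k S Y G \<longleftrightarrow> (\<forall>x\<in>S. (Y has_real_derivative - G x) (at x) \<and>
     (G has_real_derivative exp (k * x + Y x) - G x) (at x))"

definition ancient_flow :: "real \<Rightarrow> real set \<Rightarrow> (real \<Rightarrow> real) \<Rightarrow> (real \<Rightarrow> real) \<Rightarrow> bool" where
  "ancient_flow k S Y G \<longleftrightarrow> flow_on k S Y G \<and> (Y \<longlongrightarrow> 0) at_bot \<and> ((\<lambda>x. exp x * G x) \<longlongrightarrow> 0) at_bot"

lemma flow_onD:
  assumes "flow_on k S Y G" "x \<in> S"
  shows "(Y has_real_derivative - G x) (at x)" "(G has_real_derivative exp (k * x + Y x) - G x) (at x)"
  using assms by (auto simp: flow_on_def)

lemma flow_on_subset: "flow_on k S Y G \<Longrightarrow> S' \<subseteq> S \<Longrightarrow> flow_on k S' Y G"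
  by (auto simp: flow_on_def)

lemma limit_at_bot_le:
  fixes f :: "real \<Rightarrow> real"
  assumes "\<And>x. x < T \<Longrightarrow> (f has_real_derivative f' x) (at x)" "\<And>x. x < T \<Longrightarrow> f' x \<ge> 0"
    "(f \<longlongrightarrow> l) at_bot" "x < T"
  shows "l \<le> f x"
proof (rule tendsto_upperbound[OF assms(3)])
  have "f y \<le> f x" if "y \<le> x" for y
    by (rule DERIV_nonneg_imp_nondecreasing[OF that]) (meson assms(1,2,4) le_less_trans)
  then show "\<forall>\<^sub>F y in at_bot. f y \<le> f x"
    unfolding eventually_at_bot_linorder by blast
qed simp

lemma limit_at_bot_less:
  fixes f :: "real \<Rightarrow> real"
  assumes "\<And>x. x < T \<Longrightarrow> (f has_real_derivative f' x) (at x)" "\<And>x. x < T \<Longrightarrow> f' x > 0"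
    "(f \<longlongrightarrow> l) at_bot" "x < T"
  shows "l < f x"
proof -
  have "l \<le> f (x - 1)"
    by (rule limit_at_bot_le[OF assms(1) _ assms(3), of T]) (use assms in \<open>auto intro: less_imp_le\<close>)
  also have "f (x - 1) < f x"
    by (rule DERIV_pos_imp_increasing) (simp, meson assms(1,2,4) le_less_trans)
  finally show ?thesis .
qed

lemma exp_linear_at_bot: "(c::real) > 0 \<Longrightarrow> ((\<lambda>x. exp (c * x)) \<longlongrightarrow> 0) at_bot"
  by (rule filterlim_compose[OF exp_at_bot]) 
     (rule filterlim_tendsto_pos_mult_at_bot[OF tendsto_const], auto simp: filterlim_ident)

section \<open>A priori bounds for ancient flows\<close>

context
  fixes k T :: real and Y G :: "real \<Rightarrow> real"
  assumes k: "k > 0" and anc: "ancient_flow k {..<T} Y G"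
begin

lemma ancient_DERIV:
  assumes "x < T"
  shows "(Y has_real_derivative - G x) (at x)" "(G has_real_derivative exp (k * x + Y x) - G x) (at x)"
    "((\<lambda>x. exp (k * x + Y x)) has_real_derivative exp (k * x + Y x) * (k - G x)) (at x)"
proof -
  show Y: "(Y has_real_derivative - G x) (at x)" "(G has_real_derivative exp (k * x + Y x) - G x) (at x)"
    using anc assms by (auto simp: ancient_flow_def intro: flow_onD)
  show "((\<lambda>x. exp (k * x + Y x)) has_real_derivative exp (k * x + Y x) * (k - G x)) (at x)"
    by (auto intro!: derivative_eq_intros Y)
qed

lemma ancient_limits:
  "(Y \<longlongrightarrow> 0) at_bot" "((\<lambda>x. exp x * G x) \<longlongrightarrow> 0) at_bot"
  "((\<lambda>x. exp (k * x + Y x)) \<longlongrightarrow> 0) at_bot"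
proof -
  show Y: "(Y \<longlongrightarrow> 0) at_bot" "((\<lambda>x. exp x * G x) \<longlongrightarrow> 0) at_bot"
    using anc by (auto simp: ancient_flow_def)
  have "((\<lambda>x. exp (k * x) * exp (Y x)) \<longlongrightarrow> 0 * exp 0) at_bot"
    by (intro tendsto_intros exp_linear_at_bot k Y)
  then show "((\<lambda>x. exp (k * x + Y x)) \<longlongrightarrow> 0) at_bot" by (simp add: exp_add)
qed

text \<open>\<open>exp x\<close> is the integrating factor of \<open>G' = E - G\<close>: the product
  has derivative \<open>exp x * E\<close> and starts from \<open>0\<close> at minus
  infinity.\<close>

lemma ancient_G_pos:
  assumes "x < T"
  shows "G x > 0"
proof -
  have "0 < exp x * G x"
  proof (rule limit_at_bot_less[OF _ _ ancient_limits(2) assms])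
    show "((\<lambda>x. exp x * G x) has_real_derivative exp x * exp (k * x + Y x)) (at x)" if "x < T" for x
      using that by (auto intro!: derivative_eq_intros ancient_DERIV simp: algebra_simps)
  qed auto
  then show ?thesis by (simp add: zero_less_mult_iff)
qed

text \<open>The constant \<open>1 + k\<close> is the one for which the linear terms cancel in the
  derivative of \<open>exp x * ((1 + k) * G - E)\<close>; what remains is the positive
  \<open>exp x * E * G\<close>.\<close>

lemma ancient_G_lower:
  assumes "x < T"
  shows "exp (k * x + Y x) \<le> (1 + k) * G x"
proof -
  let ?E = "\<lambda>x. exp (k * x + Y x)"
  have "0 \<le> exp x * ((1 + k) * G x - ?E x)"
  proof (rule limit_at_bot_le[OF _ _ _ assms, where f = "\<lambda>x. exp x * ((1 + k) * G x - ?E x)"])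
    show "((\<lambda>x. exp x * ((1 + k) * G x - ?E x)) has_real_derivative exp x * ?E x * G x) (at x)"
      if "x < T" for x
      using that k by (auto intro!: derivative_eq_intros ancient_DERIV simp: algebra_simps)
    show "0 \<le> exp x * ?E x * G x" if "x < T" for x
      using ancient_G_pos[OF that] k by simp
    have "((\<lambda>x. (1 + k) * (exp x * G x) - exp x * ?E x) \<longlongrightarrow> (1 + k) * 0 - 0 * 0) at_bot"
      using k by (intro tendsto_intros ancient_limits exp_at_bot)
    then show "((\<lambda>x. exp x * ((1 + k) * G x - ?E x)) \<longlongrightarrow> 0) at_bot"
      by (simp add: algebra_simps)
  qed
  then show ?thesis by (simp add: zero_le_mult_iff)
qed

text \<open>The derivative of \<open>exp (- Y)\<close> is \<open>exp (- Y) * G\<close>, and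
  \<open>ancient_G_lower\<close> bounds it from below by \<open>exp (k x) / (1 + k)\<close>.
  Integration starts from the value \<open>1\<close> at minus infinity.\<close>

lemma ancient_exp_minus_Y:
  assumes "x < T"
  shows "k * (1 + k) * exp (- Y x) \<ge> k * (1 + k) + exp (k * x)"
proof -
  have "k * (1 + k) \<le> k * (1 + k) * exp (- Y x) - exp (k * x)"
  proof (rule limit_at_bot_le[OF _ _ _ assms, where f = "\<lambda>x. k * (1 + k) * exp (- Y x) - exp (k * x)"])
    show "((\<lambda>x. k * (1 + k) * exp (- Y x) - exp (k * x)) has_real_derivative
        k * (exp (- Y x) * ((1 + k) * G x) - exp (k * x))) (at x)" if "x < T" for x
      using that k by (auto intro!: derivative_eq_intros ancient_DERIV simp: algebra_simps)
    show "0 \<le> k * (exp (- Y x) * ((1 + k) * G x) - exp (k * x))" if "x < T" for x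
    proof -
      have "exp (k * x) \<le> exp (- Y x) * ((1 + k) * G x)"
        using mult_left_mono[OF ancient_G_lower[OF that], of "exp (- Y x)"] by (simp add: mult_exp_exp)
      then show ?thesis using k by simp
    qed
    have "((\<lambda>x. k * (1 + k) * exp (- Y x) - exp (k * x)) \<longlongrightarrow> k * (1 + k) * exp (- 0) - 0) at_bot"
      using k by (intro tendsto_intros ancient_limits exp_linear_at_bot)
    then show "((\<lambda>x. k * (1 + k) * exp (- Y x) - exp (k * x)) \<longlongrightarrow> k * (1 + k)) at_bot" by simp
  qed
  then show ?thesis by simp
qed

lemma ancient_E_le:
  assumes "x < T"
  shows "exp (k * x + Y x) \<le> k * (1 + k)"
proof -
  have "exp (k * x) \<le> k * (1 + k) * exp (- Y x)" 
    using ancient_exp_minus_Y[OF assms] mult_pos_pos[OF k, of "1 + k"] k by linarith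
  from mult_right_mono[OF this, of "exp (Y x)"] show ?thesis 
    by (simp add: mult_exp_exp mult.assoc)
qed

lemma ancient_Y_neg:
  assumes "x < T"
  shows "Y x < 0"
proof -
  have "k * (1 + k) * 1 < k * (1 + k) * exp (- Y x)" 
    using ancient_exp_minus_Y[OF assms] exp_gt_zero[of "k * x"] by linarith
  then have "1 < exp (- Y x)" using k by (subst (asm) mult_less_cancel_left_pos) auto
  then show ?thesis by simp
qed

text \<open>\<open>G\<close> is an exponentially weighted mean of the past of \<open>E\<close> and
  inherits its bound. Together with \<open>ancient_E_le\<close> and \<open>ancient_G_pos\<close>
  this confines \<open>E\<close> and \<open>G\<close> to a region that depends on \<open>k\<close>
  alone.\<close>

lemma ancient_G_le:
  assumes "x < T"
  shows "G x \<le> k * (1 + k)"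
proof -
  have "0 \<le> exp x * (k * (1 + k) - G x)"
  proof (rule limit_at_bot_le[OF _ _ _ assms, where f = "\<lambda>x. exp x * (k * (1 + k) - G x)"])
    show "((\<lambda>x. exp x * (k * (1 + k) - G x)) has_real_derivative
        exp x * (k * (1 + k) - exp (k * x + Y x))) (at x)" if "x < T" for x
      using that k by (auto intro!: derivative_eq_intros ancient_DERIV simp: algebra_simps)
    show "0 \<le> exp x * (k * (1 + k) - exp (k * x + Y x))" if "x < T" for x
      using ancient_E_le[OF that] by simp
    have "((\<lambda>x. exp x * (k * (1 + k)) - exp x * G x) \<longlongrightarrow> 0 * (k * (1 + k)) - 0) at_bot"
      by (intro tendsto_intros ancient_limits exp_at_bot)
    then show "((\<lambda>x. exp x * (k * (1 + k) - G x)) \<longlongrightarrow> 0) at_bot" by (simp add: algebra_simps)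
  qed
  then show ?thesis by (simp add: zero_le_mult_iff)
qed

end

section \<open>Uniqueness of flows\<close>

lemma abs_exp_diff_le:
  fixes a b c :: real
  assumes "a \<le> c" "b \<le> c"
  shows "\<bar>exp a - exp b\<bar> \<le> exp c * \<bar>a - b\<bar>"
proof -
  have *: "\<bar>exp a - exp b\<bar> \<le> exp c * \<bar>a - b\<bar>" if "b \<le> a" "a \<le> c" for a b
  proof -
    have "exp a * (1 + (b - a)) \<le> exp a * exp (b - a)"
      by (intro mult_left_mono exp_ge_add_one_self) auto
    then have "exp a - exp b \<le> exp a * (a - b)" by (simp add: algebra_simps flip: exp_add)
    also have "\<dots> \<le> exp c * (a - b)" using that by (intro mult_right_mono) auto
    finally show ?thesis using that by simp
  qed
  show ?thesis using *[of b a] *[of a b] assms by (cases "b \<le> a") (auto simp: abs_minus_commute)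
qed

text \<open>If the difference \<open>\<delta>\<close> is bounded by \<open>M\<close> on a left
  half-line, integrating both equations from minus infinity improves this to
  \<open>M * exp (k * x) / (k * (1 + k))\<close>. Far enough to the left the factor is at most
  \<open>1 / 2\<close>, and iteration forces \<open>\<delta> = 0\<close>.\<close>

lemma ancient_flow_unique_near_bot:
  assumes k: "k > 0" and 1: "ancient_flow k {..<T} Y1 G1" and 2: "ancient_flow k {..<T} Y2 G2"
  obtains X where "X < T" "\<And>x. x < X \<Longrightarrow> Y1 x = Y2 x \<and> G1 x = G2 x"
proof -
  define \<delta> where "\<delta> x = Y1 x - Y2 x" for x
  define \<gamma> where "\<gamma> x = G1 x - G2 x" for x
  have \<delta>0: "(\<delta> \<longlongrightarrow> 0) at_bot"
    using tendsto_diff[OF ancient_limits(1)[OF k 1] ancient_limits(1)[OF k 2]] by (simp add: \<delta>_def[abs_def])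
  have \<gamma>0: "((\<lambda>x. exp x * \<gamma> x) \<longlongrightarrow> 0) at_bot"
    using tendsto_diff[OF ancient_limits(2)[OF k 1] ancient_limits(2)[OF k 2]] by (simp add: \<gamma>_def[abs_def] algebra_simps)
  have step: "\<bar>\<gamma> x\<bar> \<le> M * exp (k * x) / (1 + k) \<and> \<bar>\<delta> x\<bar> \<le> M * exp (k * x) / (k * (1 + k))"
    if X: "X \<le> T" and M: "\<And>x. x < X \<Longrightarrow> \<bar>\<delta> x\<bar> \<le> M" and x: "x < X" for X M x
  proof -
    have \<gamma>: "\<bar>\<gamma> x\<bar> \<le> M * exp (k * x) / (1 + k)" if "x < X" for x
    proof -
      have "0 \<le> M * exp ((1 + k) * x) / (1 + k) + \<sigma> * (exp x * \<gamma> x)" if \<sigma>: "\<sigma> = 1 \<or> \<sigma> = -1" for \<sigma>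
      proof (rule limit_at_bot_le[OF _ _ _ \<open>x < X\<close>, where f = "\<lambda>x. M * exp ((1 + k) * x) / (1 + k) + \<sigma> * (exp x * \<gamma> x)"])
        show "((\<lambda>x. M * exp ((1 + k) * x) / (1 + k) + \<sigma> * (exp x * \<gamma> x)) has_real_derivative
          exp ((1 + k) * y) * (M + \<sigma> * (exp (Y1 y) - exp (Y2 y)))) (at y)" if "y < X" for y
          unfolding \<gamma>_def using that k X
          by (auto intro!: derivative_eq_intros ancient_DERIV[OF k 1] ancient_DERIV[OF k 2]) 
             (simp_all add: divide_simps exp_add algebra_simps)
        show "0 \<le> exp ((1 + k) * y) * (M + \<sigma> * (exp (Y1 y) - exp (Y2 y)))" if "y < X" for y
        proof -
          \<comment> \<open>Both \<open>Y1\<close> and \<open>Y2\<close> are negative, and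
            \<open>exp\<close> is 1-Lipschitz there.\<close>
          have "\<bar>exp (Y1 y) - exp (Y2 y)\<bar> \<le> exp 0 * \<bar>Y1 y - Y2 y\<bar>"
            using that X by (intro abs_exp_diff_le less_imp_le ancient_Y_neg[OF k 1] ancient_Y_neg[OF k 2]) auto
          also have "\<dots> \<le> M" using M[OF that] by (simp add: \<delta>_def)
          finally show ?thesis using \<sigma> by auto
        qed
        have "((\<lambda>x. M * exp ((1 + k) * x) / (1 + k) + \<sigma> * (exp x * \<gamma> x)) \<longlongrightarrow> M * 0 / (1 + k) + \<sigma> * 0) at_bot"
          using k by (intro tendsto_intros \<gamma>0 exp_linear_at_bot) auto
        then show "((\<lambda>x. M * exp ((1 + k) * x) / (1 + k) + \<sigma> * (exp x * \<gamma> x)) \<longlongrightarrow> 0) at_bot" by simp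
      qed
      from this[of 1] this[of "-1"] have "\<bar>exp x * \<gamma> x\<bar> \<le> M * exp ((1 + k) * x) / (1 + k)"
        by (simp add: abs_le_iff)
      then have "exp x * \<bar>\<gamma> x\<bar> \<le> exp x * (M * exp (k * x) / (1 + k))" 
        by (simp add: abs_mult algebra_simps exp_add)
      then show ?thesis by (simp only: mult_le_cancel_left_pos exp_gt_zero)
    qed
    have "0 \<le> M * exp (k * x) / (k * (1 + k)) + \<sigma> * \<delta> x" if \<sigma>: "\<sigma> = 1 \<or> \<sigma> = -1" for \<sigma>
    proof (rule limit_at_bot_le[OF _ _ _ \<open>x < X\<close>, where f = "\<lambda>x. M * exp (k * x) / (k * (1 + k)) + \<sigma> * \<delta> x"])
      show "((\<lambda>x. M * exp (k * x) / (k * (1 + k)) + \<sigma> * \<delta> x) has_real_derivative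
        M * exp (k * y) / (1 + k) - \<sigma> * \<gamma> y) (at y)" if "y < X" for y
        unfolding \<gamma>_def \<delta>_def using that k X
        by (auto intro!: derivative_eq_intros ancient_DERIV[OF k 1] ancient_DERIV[OF k 2]) 
           (simp_all add: divide_simps algebra_simps)
      show "0 \<le> M * exp (k * y) / (1 + k) - \<sigma> * \<gamma> y" if "y < X" for y
        using \<gamma>[OF that] \<sigma> by auto
      have "((\<lambda>x. M * exp (k * x) / (k * (1 + k)) + \<sigma> * \<delta> x) \<longlongrightarrow> M * 0 / (k * (1 + k)) + \<sigma> * 0) at_bot"
        using k by (intro tendsto_intros \<delta>0 exp_linear_at_bot) auto
      then show "((\<lambda>x. M * exp (k * x) / (k * (1 + k)) + \<sigma> * \<delta> x) \<longlongrightarrow> 0) at_bot" by simp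
    qed
    from this[of 1] this[of "-1"] have "\<bar>\<delta> x\<bar> \<le> M * exp (k * x) / (k * (1 + k))" by (simp add: abs_le_iff)
    then show ?thesis using \<gamma>[OF x] by simp
  qed
  have "\<forall>\<^sub>F x in at_bot. \<bar>\<delta> x\<bar> < 1 \<and> exp (k * x) < k * (1 + k) / 2"
    using tendstoD[OF \<delta>0, of 1] order_tendstoD(2)[OF exp_linear_at_bot[OF k], of "k * (1 + k) / 2"] k
    by (intro eventually_conj) (simp_all add: dist_real_def)
  then obtain X0 where X0: "\<And>x. x \<le> X0 \<Longrightarrow> \<bar>\<delta> x\<bar> < 1 \<and> exp (k * x) < k * (1 + k) / 2"
    by (auto simp: eventually_at_bot_linorder)
  define X where "X = min X0 (T - 1)"
  have X: "X < T" by (simp add: X_def)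
  have half: "\<bar>\<delta> x\<bar> \<le> (1 / 2) ^ n" if "x < X" for n x
    using that
  proof (induction n arbitrary: x)
    case 0
    then show ?case using X0[of x] by (simp add: X_def)
  next
    case (Suc n)
    have "\<bar>\<delta> x\<bar> \<le> (1 / 2) ^ n * exp (k * x) / (k * (1 + k))"
      using step[OF less_imp_le[OF X] Suc.IH Suc.prems] by simp
    also have "\<dots> \<le> (1 / 2) ^ n * (k * (1 + k) / 2) / (k * (1 + k))"
      using X0[of x] Suc.prems k by (intro divide_right_mono mult_left_mono) (auto simp: X_def)
    also have "\<dots> = (1 / 2) ^ Suc n" using k by simp
    finally show ?case .
  qed
  have "\<bar>\<delta> x\<bar> \<le> 0" if "x < X" for x
  proof (rule tendsto_lowerbound)
    show "(\<lambda>n. (1 / 2 :: real) ^ n) \<longlonglongrightarrow> 0" by (intro LIMSEQ_power_zero) simp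
  qed (use half[OF that] in auto)
  then have \<delta>: "\<bar>\<delta> x\<bar> \<le> 0" if "x < X" for x using that by simp
  have "\<gamma> x = 0" if "x < X" for x
    using step[OF less_imp_le[OF X] \<delta> that] by auto
  then show thesis using that[OF X] \<delta> by (simp add: \<delta>_def \<gamma>_def)
qed

text \<open>Gronwall's inequality from \<open>c\<close> in both directions:
  \<open>exp (- C * x) * N x\<close> is nonincreasing and \<open>exp (C * x) * N x\<close> is
  nondecreasing.\<close>

lemma differential_inequality_zero:
  fixes N N' :: "real \<Rightarrow> real"
  assumes D: "\<And>x. a \<le> x \<Longrightarrow> x \<le> b \<Longrightarrow> (N has_real_derivative N' x) (at x)"
    and L: "\<And>x. a \<le> x \<Longrightarrow> x \<le> b \<Longrightarrow> \<bar>N' x\<bar> \<le> C * N x"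
    and nn: "\<And>x. a \<le> x \<Longrightarrow> x \<le> b \<Longrightarrow> N x \<ge> 0"
    and c: "c \<in> {a..b}" "N c = 0" and x: "x \<in> {a..b}"
  shows "N x = 0"
proof (cases "c \<le> x")
  case True
  have "exp (- C * x) * N x \<le> exp (- C * c) * N c"
  proof (rule DERIV_nonpos_imp_nonincreasing[OF True, where f = "\<lambda>y. exp (- C * y) * N y"])
    fix y assume y: "c \<le> y" "y \<le> x"
    have "((\<lambda>y. exp (- C * y) * N y) has_real_derivative exp (- C * y) * (N' y - C * N y)) (at y)"
      using y c x by (auto intro!: derivative_eq_intros D simp: algebra_simps)
    moreover have "exp (- C * y) * (N' y - C * N y) \<le> 0"
      using L[of y] y c x by (intro mult_nonneg_nonpos) auto
    ultimately show "\<exists>z. ((\<lambda>y. exp (- C * y) * N y) has_real_derivative z) (at y) \<and> z \<le> 0" by blast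
  qed
  then have "N x \<le> 0" using c by (simp add: mult_le_0_iff)
  then show ?thesis using nn[of x] x by auto
next
  case False
  have "exp (C * x) * N x \<le> exp (C * c) * N c"
  proof (rule DERIV_nonneg_imp_nondecreasing[where f = "\<lambda>y. exp (C * y) * N y"])
    show "x \<le> c" using False by simp
    fix y assume y: "x \<le> y" "y \<le> c"
    have "((\<lambda>y. exp (C * y) * N y) has_real_derivative exp (C * y) * (N' y + C * N y)) (at y)"
      using y c x by (auto intro!: derivative_eq_intros D simp: algebra_simps)
    moreover have "exp (C * y) * (N' y + C * N y) \<ge> 0"
      using L[of y] y c x by (intro mult_nonneg_nonneg) auto
    ultimately show "\<exists>z. ((\<lambda>y. exp (C * y) * N y) has_real_derivative z) (at y) \<and> z \<ge> 0" by blast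
  qed
  then have "N x \<le> 0" using c by (simp add: mult_le_0_iff)
  then show ?thesis using nn[of x] x by auto
qed

lemma flow_unique:
  assumes "k > 0" and 1: "flow_on k {a..b} Y1 G1" and 2: "flow_on k {a..b} Y2 G2"
    and c: "c \<in> {a..b}" "Y1 c = Y2 c" "G1 c = G2 c" and x: "x \<in> {a..b}"
  shows "Y1 x = Y2 x \<and> G1 x = G2 x"
proof -
  have "continuous_on {a..b} Y1" "continuous_on {a..b} Y2"
    using 1 2 by (auto intro!: continuous_at_imp_continuous_on DERIV_isCont flow_onD)
  then have "bdd_above (Y1 ` {a..b})" "bdd_above (Y2 ` {a..b})"
    by (auto intro!: bounded_imp_bdd_above compact_imp_bounded compact_continuous_image)
  then obtain B1 B2 where "\<forall>x\<in>{a..b}. Y1 x \<le> B1" "\<forall>x\<in>{a..b}. Y2 x \<le> B2"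
    unfolding bdd_above_def by blast
  then have B: "Y1 x \<le> max B1 B2" "Y2 x \<le> max B1 B2" if "x \<in> {a..b}" for x
    using that by (auto simp: le_max_iff_disj)
  define L where "L = exp (k * b) * exp (max B1 B2)"
  define \<delta> where "\<delta> x = Y1 x - Y2 x" for x
  define \<gamma> where "\<gamma> x = G1 x - G2 x" for x
  define w where "w x = exp (k * x + Y1 x) - exp (k * x + Y2 x)" for x
  have w: "\<bar>w x\<bar> \<le> L * \<bar>\<delta> x\<bar>" if "x \<in> {a..b}" for x
  proof -
    have "\<bar>w x\<bar> = exp (k * x) * \<bar>exp (Y1 x) - exp (Y2 x)\<bar>"
      by (simp add: w_def exp_add abs_mult flip: right_diff_distrib)
    also have "\<dots> \<le> exp (k * b) * (exp (max B1 B2) * \<bar>Y1 x - Y2 x\<bar>)"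
      using that assms(1) by (intro mult_mono abs_exp_diff_le B) auto
    finally show ?thesis by (simp add: L_def \<delta>_def)
  qed
  \<comment> \<open>\<open>L\<close> is a Lipschitz constant of the exponential term. In the
    derivative of this sum of squares the products of \<open>\<gamma>\<close> and
    \<open>\<delta>\<close> account for \<open>L + 1\<close> and the square of
    \<open>\<gamma>\<close> for \<open>2\<close>, hence \<open>L + 3\<close>.\<close>
  have "(\<delta> x)\<^sup>2 + (\<gamma> x)\<^sup>2 = 0"
  proof (rule differential_inequality_zero[where N = "\<lambda>x. (\<delta> x)\<^sup>2 + (\<gamma> x)\<^sup>2"
        and N' = "\<lambda>x. 2 * \<gamma> x * (w x - \<delta> x - \<gamma> x)" and C = "L + 3", OF _ _ _ c(1) _ x])
    show "((\<lambda>x. (\<delta> x)\<^sup>2 + (\<gamma> x)\<^sup>2) has_real_derivative 2 * \<gamma> x * (w x - \<delta> x - \<gamma> x)) (at x)"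
      if "a \<le> x" "x \<le> b" for x
      unfolding \<delta>_def \<gamma>_def w_def using that
      by (auto intro!: derivative_eq_intros flow_onD[OF 1] flow_onD[OF 2] simp: algebra_simps)
    show "\<bar>2 * \<gamma> x * (w x - \<delta> x - \<gamma> x)\<bar> \<le> (L + 3) * ((\<delta> x)\<^sup>2 + (\<gamma> x)\<^sup>2)" if "a \<le> x" "x \<le> b" for x
    proof -
      have L0: "L \<ge> 0" by (simp add: L_def)
      have am: "2 * (\<bar>\<gamma> x\<bar> * \<bar>\<delta> x\<bar>) \<le> (\<delta> x)\<^sup>2 + (\<gamma> x)\<^sup>2"
        using sum_squares_bound[of "\<bar>\<gamma> x\<bar>" "\<bar>\<delta> x\<bar>"] by simp
      have "\<bar>2 * \<gamma> x * (w x - \<delta> x - \<gamma> x)\<bar> = 2 * \<bar>\<gamma> x\<bar> * \<bar>w x - \<delta> x - \<gamma> x\<bar>" by (simp add: abs_mult)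
      also have "\<dots> \<le> 2 * \<bar>\<gamma> x\<bar> * (L * \<bar>\<delta> x\<bar> + \<bar>\<delta> x\<bar> + \<bar>\<gamma> x\<bar>)"
        using w[of x] that by (intro mult_left_mono) auto
      also have "\<dots> = (L + 1) * (2 * (\<bar>\<gamma> x\<bar> * \<bar>\<delta> x\<bar>)) + 2 * (\<gamma> x)\<^sup>2"
        by (simp add: algebra_simps power2_eq_square)
      also have "\<dots> \<le> (L + 1) * ((\<delta> x)\<^sup>2 + (\<gamma> x)\<^sup>2) + 2 * ((\<delta> x)\<^sup>2 + (\<gamma> x)\<^sup>2)"
        using am L0 by (intro add_mono mult_left_mono) auto
      finally show ?thesis by (simp add: algebra_simps)
    qed
  qed (use c in \<open>auto simp: \<delta>_def \<gamma>_def\<close>)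
  then show ?thesis by (simp add: sum_power2_eq_zero_iff \<delta>_def \<gamma>_def)
qed

lemma ancient_flow_unique:
  assumes k: "k > 0" and 1: "ancient_flow k {..<T} Y1 G1" and 2: "ancient_flow k {..<T} Y2 G2" and x: "x < T"
  shows "Y1 x = Y2 x" "G1 x = G2 x"
proof -
  obtain X where X: "X < T" "\<And>x. x < X \<Longrightarrow> Y1 x = Y2 x \<and> G1 x = G2 x"
    using ancient_flow_unique_near_bot[OF k 1 2] by blast
  define c where "c = min (X - 1) x"
  have "flow_on k {c..x} Y1 G1" "flow_on k {c..x} Y2 G2"
    using 1 2 x by (auto simp: ancient_flow_def flow_on_def)
  from flow_unique[OF k this, of c x] X(2)[of c] show "Y1 x = Y2 x" "G1 x = G2 x"
    by (auto simp: c_def)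
qed

text \<open>The series are solved for \<open>E\<close> and \<open>G\<close>, and \<open>Y\<close> is
  obtained by integrating \<open>- G\<close> termwise. Then \<open>E = exp (k x + Y)\<close>,
  because the quotient of the two sides has derivative zero and equals \<open>1\<close> at the
  centre.\<close>

lemma flow_local_solution:
  fixes k x0 Y0 G0 M :: real
  assumes k: "k > 0" and M: "M \<ge> 1" "exp (k * x0 + Y0) \<le> M" "\<bar>G0\<bar> \<le> M"
  defines "h \<equiv> 1 / (k + M + 1)"
  obtains a c :: "nat \<Rightarrow> real" and Y G :: "real \<Rightarrow> real"
  where "flow_on k {x0 - h<..<x0 + h} Y G" "Y x0 = Y0" "G x0 = G0"
    "\<And>x. \<bar>x - x0\<bar> < h \<Longrightarrow> (\<lambda>n. a n * (x - x0) ^ n) sums exp (k * x + Y x)"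
    "\<And>x. \<bar>x - x0\<bar> < h \<Longrightarrow> (\<lambda>n. c n * (x - x0) ^ n) sums Y x"
proof -
  define R where "R = k + M + 1"
  have R: "R \<ge> 1" "R > 0" and h: "h = 1 / R" using k M by (simp_all add: R_def h_def)
  have E0: "\<bar>exp (k * x0 + Y0)\<bar> \<le> M" using M by simp
  obtain a b E G where ab: "\<And>n. \<bar>a n\<bar> \<le> M * R ^ n" "\<And>n. \<bar>b n\<bar> \<le> M * R ^ n"
    and init: "E 0 = exp (k * x0 + Y0)" "G 0 = G0"
    and sumE: "\<And>x. \<bar>x\<bar> < h \<Longrightarrow> (\<lambda>n. a n * x ^ n) sums E x"
    and sumG: "\<And>x. \<bar>x\<bar> < h \<Longrightarrow> (\<lambda>n. b n * x ^ n) sums G x"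
    and dE: "\<And>x. \<bar>x\<bar> < h \<Longrightarrow> (E has_real_derivative E x * (k - G x)) (at x)"
    and dG: "\<And>x. \<bar>x\<bar> < h \<Longrightarrow> (G has_real_derivative E x - G x) (at x)"
    by (rule flow_power_series[OF k M(1) E0 M(3), folded h_def, folded R_def]) (rule that; assumption)
  define c where "c n = (case n of 0 \<Rightarrow> Y0 | Suc m \<Rightarrow> - b m / real n)" for n
  have c: "\<bar>c n\<bar> \<le> max M \<bar>Y0\<bar> * R ^ n" for n
  proof (cases n)
    case (Suc m)
    have "\<bar>c n\<bar> \<le> \<bar>b m\<bar> / 1"
      unfolding c_def Suc nat.case abs_divide abs_minus_cancel by (rule divide_left_mono) auto
    also have "\<dots> \<le> M * R ^ m" using ab(2) by simp
    also have "\<dots> \<le> max M \<bar>Y0\<bar> * R ^ n"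
      using R M unfolding Suc by (intro mult_mono power_increasing) auto
    finally show ?thesis .
  qed (simp add: c_def)
  have dc: "diffs c n = - b n" for n by (simp add: diffs_def c_def del: of_nat_Suc)
  define Y where "Y x = (\<Sum>n. c n * x ^ n)" for x
  have sumY: "(\<lambda>n. c n * x ^ n) sums Y x" if "\<bar>x\<bar> < h" for x
    unfolding Y_def
    by (rule summable_sums[OF summable_norm_cancel[OF geometric_bound_summable[OF c R(2) that[unfolded h]]]])
  have dY: "(Y has_real_derivative - G x) (at x)" if x: "\<bar>x\<bar> < h" for x
  proof -
    have "(\<lambda>n. diffs c n * x ^ n) sums (- G x)"
      using sums_minus[OF sumG[OF x]] by (simp add: dc)
    then have "(\<Sum>n. diffs c n * x ^ n) = - G x" by (rule sums_unique[symmetric])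
    then show ?thesis
      using geometric_bound_DERIV[OF c R(2) x[unfolded h]] unfolding Y_def[abs_def] by simp
  qed
  have Y0: "Y 0 = Y0" by (simp add: Y_def powser_zero c_def)
  have "\<exists>C. \<forall>x\<in>{-h<..<h}. E x * exp (- (k * (x0 + x) + Y x)) = C"
  proof (rule has_field_derivative_zero_constant)
    show "((\<lambda>x. E x * exp (- (k * (x0 + x) + Y x))) has_real_derivative 0) (at x within {-h<..<h})"
      if "x \<in> {-h<..<h}" for x
      by (rule has_field_derivative_at_within) 
         (use that in \<open>auto intro!: derivative_eq_intros dE dY simp: algebra_simps\<close>)
  qed simp
  then obtain C where "\<forall>x\<in>{-h<..<h}. E x * exp (- (k * (x0 + x) + Y x)) = C" by blast
  then have C: "E x * exp (- (k * (x0 + x) + Y x)) = C" if "\<bar>x\<bar> < h" for x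
    using that by (simp add: abs_less_iff)
  have "C = 1" using C[of 0] R init Y0 by (simp add: h mult_exp_exp)
  have E: "E x = exp (k * (x0 + x) + Y x)" if "\<bar>x\<bar> < h" for x
  proof -
    have "exp (- (k * (x0 + x) + Y x)) * exp (k * (x0 + x) + Y x) = 1"
      by (metis exp_minus_inverse mult.commute)
    then have "E x = (E x * exp (- (k * (x0 + x) + Y x))) * exp (k * (x0 + x) + Y x)"
      by (simp only: mult.assoc mult_1_right)
    then show ?thesis by (simp only: C[OF that] \<open>C = 1\<close> mult_1)
  qed
  show thesis
  proof (rule that[of "\<lambda>x. Y (x - x0)" "\<lambda>x. G (x - x0)" a c])
    show "flow_on k {x0 - h<..<x0 + h} (\<lambda>x. Y (x - x0)) (\<lambda>x. G (x - x0))"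
      unfolding flow_on_def
    proof (intro ballI conjI)
      fix x assume "x \<in> {x0 - h<..<x0 + h}"
      then have x: "\<bar>x - x0\<bar> < h" by auto
      have d: "((\<lambda>x. x - x0) has_real_derivative 1) (at x)" by (auto intro!: derivative_eq_intros)
      show "((\<lambda>x. Y (x - x0)) has_real_derivative - G (x - x0)) (at x)"
        using DERIV_chain2[OF dY[OF x] d] by simp
      show "((\<lambda>x. G (x - x0)) has_real_derivative exp (k * x + Y (x - x0)) - G (x - x0)) (at x)"
        using DERIV_chain2[OF dG[OF x] d] E[OF x] by simp
    qed
    show "(\<lambda>n. a n * (x - x0) ^ n) sums exp (k * x + Y (x - x0))" if "\<bar>x - x0\<bar> < h" for x
      using sumE[OF that] E[OF that] by simp
  qed (use Y0 init sumY in simp_all)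
qed

section \<open>Existence, continuation and analyticity of the global orbit\<close>

lemma ancient_flow_germ:
  assumes k: "k > 0"
  obtains T Y G where "ancient_flow k {..<T} Y G"
proof -
  obtain H K where H0: "H 0 = 1"
    and dH: "\<And>q. \<bar>q\<bar> < k \<Longrightarrow> (H has_real_derivative - H q * K q / k) (at q)"
    and dK: "\<And>q. \<bar>q\<bar> < k \<Longrightarrow> ((\<lambda>q. q * K q) has_real_derivative (H q - K q) / k) (at q)"
    and cK: "isCont K 0"
    by (rule germ_power_series[OF k]) (rule that; assumption)
  have cH: "H \<midarrow>0\<rightarrow> 1" using dH[of 0] k H0 DERIV_isCont isCont_def by force
  have q0: "filterlim (\<lambda>x. exp (k * x)) (at 0) at_bot"
    using exp_linear_at_bot[OF k] by (simp add: filterlim_at)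
  have "\<forall>\<^sub>F q in at 0. H q > 0" using order_tendstoD(1)[OF cH, of 0] by simp
  moreover have "\<forall>\<^sub>F q in at 0. \<bar>q\<bar> < k" using k by (auto simp: eventually_at dist_real_def)
  ultimately have "\<forall>\<^sub>F x in at_bot. H (exp (k * x)) > 0 \<and> \<bar>exp (k * x)\<bar> < k"
    using q0 by (auto simp: filterlim_iff intro: eventually_conj)
  then obtain T where T: "\<And>x. x \<le> T \<Longrightarrow> H (exp (k * x)) > 0 \<and> \<bar>exp (k * x)\<bar> < k"
    by (auto simp: eventually_at_bot_linorder)
  define Y where "Y x = ln (H (exp (k * x)))" for x
  define G where "G x = exp (k * x) * K (exp (k * x))" for x
  have "ancient_flow k {..<T} Y G"
    unfolding ancient_flow_def flow_on_def
  proof (intro conjI ballI)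
    fix x assume "x \<in> {..<T}"
    then have x: "H (exp (k * x)) > 0" "\<bar>exp (k * x)\<bar> < k" using T[of x] by auto
    have d: "((\<lambda>x. exp (k * x)) has_real_derivative k * exp (k * x)) (at x)"
      by (auto intro!: derivative_eq_intros)
    show "(Y has_real_derivative - G x) (at x)"
      unfolding Y_def G_def using x k 
      by (auto intro!: derivative_eq_intros DERIV_chain2[OF dH[OF x(2)] d])
    have "exp (k * x + Y x) = exp (k * x) * H (exp (k * x))" using x by (simp add: Y_def exp_add)
    then show "(G has_real_derivative exp (k * x + Y x) - G x) (at x)"
      using k unfolding G_def[abs_def] 
      by (intro DERIV_cong[OF DERIV_chain2[OF dK[OF x(2)] d]]) (simp add: field_simps)
  next
    have "((\<lambda>x. ln (H (exp (k * x)))) \<longlongrightarrow> ln 1) at_bot"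
      by (intro tendsto_ln filterlim_compose[OF cH q0]) auto
    then show "(Y \<longlongrightarrow> 0) at_bot" by (simp add: Y_def[abs_def])
    have "((\<lambda>x. exp x * (exp (k * x) * K (exp (k * x)))) \<longlongrightarrow> 0 * (0 * K 0)) at_bot"
      using cK by (intro tendsto_intros exp_at_bot exp_linear_at_bot k filterlim_compose[OF _ q0]) 
        (auto simp: isCont_def)
    then show "((\<lambda>x. exp x * G x) \<longlongrightarrow> 0) at_bot" by (simp add: G_def[abs_def])
  qed
  then show thesis by (rule that)
qed

text \<open>\<open>1 + k * (1 + k)\<close> bounds \<open>E\<close> and \<open>G\<close> along every
  ancient flow, so \<open>h\<close> does not depend on \<open>T\<close>. The local solution started
  at \<open>T - h / 2\<close> lives up to \<open>T + h / 2\<close> and agrees with the given flow on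
  the overlap.\<close>

lemma ancient_flow_extend:
  fixes k :: real
  assumes k: "k > 0" and anc: "ancient_flow k {..<T} Y G"
  defines "h \<equiv> 1 / (k + (1 + k * (1 + k)) + 1)"
  shows "\<exists>Y G. ancient_flow k {..<T + h / 2} Y G"
proof -
  have h: "h > 0" using k by (simp add: h_def add_pos_pos)
  define x0 where "x0 = T - h / 2"
  have x0: "x0 < T" using h by (simp add: x0_def)
  obtain a c Y2 G2 where 2: "flow_on k {x0 - h<..<x0 + h} Y2 G2" "Y2 x0 = Y x0" "G2 x0 = G x0"
  proof -
    have "1 \<le> 1 + k * (1 + k)" "exp (k * x0 + Y x0) \<le> 1 + k * (1 + k)" "\<bar>G x0\<bar> \<le> 1 + k * (1 + k)"
      using ancient_E_le[OF k anc x0] ancient_G_le[OF k anc x0] ancient_G_pos[OF k anc x0] k by auto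
    note bounds = this
    show thesis by (rule flow_local_solution[OF k bounds, folded h_def]) (rule that; assumption)
  qed
  have 1: "flow_on k {..<T} Y G" using anc by (simp add: ancient_flow_def)
  have eq: "Y x = Y2 x \<and> G x = G2 x" if "x0 - h < x" "x < T" for x
  proof (rule flow_unique[OF k, of "min x x0" "max x x0" Y G Y2 G2 x0 x])
    show "flow_on k {min x x0..max x x0} Y G"
      by (rule flow_on_subset[OF 1]) (use that x0 in auto)
    show "flow_on k {min x x0..max x x0} Y2 G2"
      by (rule flow_on_subset[OF 2(1)]) (use that x0 h in \<open>auto simp: x0_def\<close>)
  qed (use 2 in auto)
  define Y3 where "Y3 x = (if x < T then Y x else Y2 x)" for x
  define G3 where "G3 x = (if x < T then G x else G2 x)" for x
  have "flow_on k {..<T + h / 2} Y3 G3"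
    unfolding flow_on_def
  proof (intro ballI)
    fix x assume x: "x \<in> {..<T + h / 2}"
    show "(Y3 has_real_derivative - G3 x) (at x) \<and>
          (G3 has_real_derivative exp (k * x + Y3 x) - G3 x) (at x)"
    proof (cases "x < T")
      case True
      have "(Y3 has_real_derivative - G x) (at x)"
        by (rule has_field_derivative_transform_within_open[OF flow_onD(1)[OF 1], of _ "{..<T}"])
           (use True in \<open>auto simp: Y3_def\<close>)
      moreover have "(G3 has_real_derivative exp (k * x + Y x) - G x) (at x)"
        by (rule has_field_derivative_transform_within_open[OF flow_onD(2)[OF 1], of _ "{..<T}"])
           (use True in \<open>auto simp: G3_def\<close>)
      ultimately show ?thesis using True by (simp add: Y3_def G3_def)
    next
      case False
      have e: "Y2 y = Y3 y" "G2 y = G3 y" if "y \<in> {x0 - h<..<x0 + h}" for y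
        using eq[of y] that by (auto simp: Y3_def G3_def)
      have x': "x \<in> {x0 - h<..<x0 + h}" using False x h by (auto simp: x0_def)
      have "(Y3 has_real_derivative - G2 x) (at x)"
        by (rule has_field_derivative_transform_within_open[OF flow_onD(1)[OF 2(1) x'] _ x'])
           (use e in auto)
      moreover have "(G3 has_real_derivative exp (k * x + Y2 x) - G2 x) (at x)"
        by (rule has_field_derivative_transform_within_open[OF flow_onD(2)[OF 2(1) x'] _ x'])
           (use e in auto)
      ultimately show ?thesis using e[OF x'] by simp
    qed
  qed
  moreover have "\<forall>\<^sub>F x in at_bot. x < T" by (rule eventually_gt_at_bot)
  then have "\<forall>\<^sub>F x in at_bot. Y x = Y3 x" "\<forall>\<^sub>F x in at_bot. exp x * G x = exp x * G3 x"
    by (eventually_elim, simp add: Y3_def G3_def)+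
  from Lim_transform_eventually[OF ancient_limits(1)[OF k anc] this(1)]
    Lim_transform_eventually[OF ancient_limits(2)[OF k anc] this(2)]
  have "(Y3 \<longlongrightarrow> 0) at_bot" "((\<lambda>x. exp x * G3 x) \<longlongrightarrow> 0) at_bot" .
  ultimately show ?thesis by (auto simp: ancient_flow_def)
qed

lemma ancient_flow_exists:
  assumes k: "k > 0"
  obtains Y G where "ancient_flow k UNIV Y G"
proof -
  obtain T0 Y0 G0 where germ: "ancient_flow k {..<T0} Y0 G0" using ancient_flow_germ[OF k] by blast
  define h where "h = 1 / (k + (1 + k * (1 + k)) + 1) / 2"
  have h: "h > 0" using k by (simp add: h_def add_pos_pos)
  have "\<exists>Y G. ancient_flow k {..<T0 + real n * h} Y G" for n
  proof (induction n)
    case 0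
    show ?case using germ by auto
  next
    case (Suc n)
    then obtain Y G where "ancient_flow k {..<T0 + real n * h} Y G" by blast
    have "T0 + real (Suc n) * h = (T0 + real n * h) + h" by (simp add: algebra_simps)
    with ancient_flow_extend[OF k \<open>ancient_flow k {..<T0 + real n * h} Y G\<close>, folded h_def] 
    show ?case by (simp only:)
  qed
  then obtain Yn Gn where n: "\<And>n. ancient_flow k {..<T0 + real n * h} (Yn n) (Gn n)" by metis
  \<comment> \<open>Each point is assigned a stage whose domain contains it; uniqueness makes the
    resulting value independent of the stage.\<close>
  define N where "N x = (SOME n. x < T0 + real n * h)" for x
  have N: "x < T0 + real (N x) * h" for x
  proof -
    obtain n where "x - T0 < real n * h" using reals_Archimedean3[OF h] by blast
    then have "x < T0 + real n * h" by simp
    then show ?thesis unfolding N_def by (rule someI)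
  qed
  define Y where "Y x = Yn (N x) x" for x
  define G where "G x = Gn (N x) x" for x
  have eq: "Yn n x = Y x" "Gn n x = G x" if "x < T0 + real n * h" for n x
  proof -
    define T where "T = min (T0 + real n * h) (T0 + real (N x) * h)"
    have "ancient_flow k {..<T} (Yn n) (Gn n)" "ancient_flow k {..<T} (Yn (N x)) (Gn (N x))" "x < T"
      using n[of n] n[of "N x"] that N[of x] by (auto simp: T_def ancient_flow_def flow_on_def)
    from ancient_flow_unique[OF k this] show "Yn n x = Y x" "Gn n x = G x"
      by (simp_all add: Y_def G_def)
  qed
  have "flow_on k UNIV Y G"
    unfolding flow_on_def
  proof (intro ballI)
    fix x
    let ?S = "{..<T0 + real (N x) * h}"
    have "flow_on k ?S (Yn (N x)) (Gn (N x))" using n by (simp add: ancient_flow_def)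
    note D = flow_onD[OF this, of x]
    have x: "x \<in> ?S" using N[of x] by simp
    have "(Y has_real_derivative - Gn (N x) x) (at x)"
      by (rule has_field_derivative_transform_within_open[OF D(1)[OF x] _ x]) (use eq in auto)
    moreover have "(G has_real_derivative exp (k * x + Yn (N x) x) - Gn (N x) x) (at x)"
      by (rule has_field_derivative_transform_within_open[OF D(2)[OF x] _ x]) (use eq in auto)
    ultimately show "(Y has_real_derivative - G x) (at x) \<and> (G has_real_derivative exp (k * x + Y x) - G x) (at x)"
      using N[of x] by (simp add: eq)
  qed
  moreover have "\<forall>\<^sub>F x in at_bot. x < T0" by (rule eventually_gt_at_bot)
  then have "\<forall>\<^sub>F x in at_bot. Yn 0 x = Y x" "\<forall>\<^sub>F x in at_bot. exp x * Gn 0 x = exp x * G x"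
    by (eventually_elim, simp add: eq)+
  from Lim_transform_eventually[OF ancient_limits(1)[OF k n[of 0]] this(1)]
    Lim_transform_eventually[OF ancient_limits(2)[OF k n[of 0]] this(2)]
  have "(Y \<longlongrightarrow> 0) at_bot" "((\<lambda>x. exp x * G x) \<longlongrightarrow> 0) at_bot" .
  ultimately show thesis using that by (auto simp: ancient_flow_def)
qed

text \<open>By uniqueness the flow coincides near \<open>x0\<close> with the power series solution
  that has the same values at \<open>x0\<close>.\<close>

lemma flow_analytic:
  assumes k: "k > 0" and flow: "flow_on k UNIV Y G"
  obtains a c h where "h > 0" 
    "\<And>x. \<bar>x - x0\<bar> < h \<Longrightarrow> (\<lambda>n. a n * (x - x0) ^ n) sums exp (k * x + Y x)"
    "\<And>x. \<bar>x - x0\<bar> < h \<Longrightarrow> (\<lambda>n. c n * (x - x0) ^ n) sums Y x"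
proof -
  define M where "M = max 1 (max (exp (k * x0 + Y x0)) \<bar>G x0\<bar>)"
  define h where "h = 1 / (k + M + 1)"
  have h: "h > 0" using k by (auto simp: h_def M_def intro!: add_pos_pos divide_pos_pos)
  obtain a c Y2 G2 where 2: "flow_on k {x0 - h<..<x0 + h} Y2 G2" "Y2 x0 = Y x0" "G2 x0 = G x0"
    "\<And>x. \<bar>x - x0\<bar> < h \<Longrightarrow> (\<lambda>n. a n * (x - x0) ^ n) sums exp (k * x + Y2 x)"
    "\<And>x. \<bar>x - x0\<bar> < h \<Longrightarrow> (\<lambda>n. c n * (x - x0) ^ n) sums Y2 x"
  proof -
    have "1 \<le> M" "exp (k * x0 + Y x0) \<le> M" "\<bar>G x0\<bar> \<le> M"
      by (auto simp: M_def)
    note bounds = this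
    show thesis by (rule flow_local_solution[OF k bounds, folded h_def]) (rule that; assumption)
  qed
  have eq: "Y2 x = Y x" if "\<bar>x - x0\<bar> < h" for x
  proof -
    have "Y x = Y2 x \<and> G x = G2 x"
    proof (rule flow_unique[OF k, of "min x x0" "max x x0" Y G Y2 G2 x0 x])
      show "flow_on k {min x x0..max x x0} Y G" by (rule flow_on_subset[OF flow]) simp
      show "flow_on k {min x x0..max x x0} Y2 G2"
        by (rule flow_on_subset[OF 2(1)]) (use that h in auto)
    qed (use 2 in auto)
    then show ?thesis by simp
  qed
  show thesis by (rule that[OF h, of a c]) (use 2(4,5) eq in auto)
qed

section \<open>Smooth functions on open sets\<close>

lemma partial_eqI: "(f has_derivative f') (at x) \<Longrightarrow> partial b f x = f' b"
  by (simp add: partial_def frechet_derivative_at[symmetric])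

lemma has_derivative_cong_open:
  assumes "open S" "x \<in> S" "\<And>y. y \<in> S \<Longrightarrow> f y = g y"
  shows "(f has_derivative D) (at x) \<longleftrightarrow> (g has_derivative D) (at x)"
  using has_derivative_transform_within_open[of f D x UNIV S g]
    has_derivative_transform_within_open[of g D x UNIV S f] assms by auto

lemma partial_cong_open:
  assumes "open S" "x \<in> S" "\<And>y. y \<in> S \<Longrightarrow> f y = g y"
  shows "partial b f x = partial b g x"
  unfolding partial_def frechet_derivative_def using has_derivative_cong_open[OF assms] by simp

lemma has_derivative_partial:
  "f differentiable (at x) \<Longrightarrow> (f has_derivative (\<lambda>h. partial h f x)) (at x)"
  by (simp add: partial_def frechet_derivative_works)

text \<open>The radial functions below are smooth on the punctured ball only, whereas
  \<open>C_k\<close> speaks about the whole space. Regularity on open pieces is assembled by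
  \<open>C_k_on_local\<close>.\<close>

primrec C_k_on :: "nat \<Rightarrow> 'a::euclidean_space set \<Rightarrow> ('a \<Rightarrow> real) \<Rightarrow> bool" where
  "C_k_on 0 S f \<longleftrightarrow> continuous_on S f"
| "C_k_on (Suc n) S f \<longleftrightarrow> (\<forall>x\<in>S. f differentiable (at x)) \<and> (\<forall>b\<in>Basis. C_k_on n S (partial b f))"

lemma C_k_on_UNIV: "C_k_on n UNIV f \<longleftrightarrow> C_k n f"
  by (induction n arbitrary: f) auto

lemma C_k_on_cong:
  assumes "open S" "\<And>x. x \<in> S \<Longrightarrow> f x = g x"
  shows "C_k_on n S f \<longleftrightarrow> C_k_on n S g"
  using assms(2)
proof (induction n arbitrary: f g)
  case 0
  then show ?case by (simp cong: continuous_on_cong)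
next
  case (Suc n)
  have "f differentiable (at x) \<longleftrightarrow> g differentiable (at x)" if "x \<in> S" for x
    using has_derivative_cong_open[OF assms(1) that Suc.prems] by (simp add: differentiable_def)
  moreover have "C_k_on n S (partial b f) \<longleftrightarrow> C_k_on n S (partial b g)" for b
    by (rule Suc.IH) (use partial_cong_open[OF assms(1) _ Suc.prems] in auto)
  ultimately show ?case by simp
qed

lemma C_k_on_subset: "C_k_on n S f \<Longrightarrow> S' \<subseteq> S \<Longrightarrow> C_k_on n S' f"
  by (induction n arbitrary: f) (auto intro: continuous_on_subset)

lemma C_k_on_SucD: "C_k_on (Suc n) S f \<Longrightarrow> C_k_on n S f"
  by (induction n arbitrary: f)
     (auto intro!: continuous_at_imp_continuous_on differentiable_imp_continuous_within)

lemma C_k_on_local: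
  assumes "\<And>x. x \<in> S \<Longrightarrow> \<exists>U. open U \<and> x \<in> U \<and> C_k_on n U f"
  shows "C_k_on n S f"
  using assms
proof (induction n arbitrary: f)
  case 0
  show ?case unfolding C_k_on.simps
  proof (intro continuous_at_imp_continuous_on ballI)
    fix x assume "x \<in> S"
    from 0[OF this] show "isCont f x" by (auto simp: continuous_on_eq_continuous_at)
  qed
next
  case (Suc n)
  have "C_k_on n S (partial b f)" if "b \<in> Basis" for b
  proof (rule Suc.IH)
    fix x assume "x \<in> S"
    from Suc.prems[OF this] that show "\<exists>U. open U \<and> x \<in> U \<and> C_k_on n U (partial b f)" by auto
  qed
  moreover have "f differentiable (at x)" if "x \<in> S" for x
    using Suc.prems[OF that] by auto
  ultimately show ?case by simp
qed

lemma C_k_on_const [simp]: "C_k_on n S (\<lambda>x. c)"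
proof (induction n arbitrary: c)
  case (Suc n)
  have "partial b (\<lambda>x. c) = (\<lambda>x. 0)" for b :: 'a
    by (rule ext, rule partial_eqI[THEN trans]) (rule has_derivative_const, simp)
  then show ?case using Suc by simp
qed simp

lemma C_k_on_inner [simp]: "C_k_on n S (\<lambda>x. x \<bullet> a)"
proof (cases n)
  case (Suc m)
  have d: "((\<lambda>x. x \<bullet> a) has_derivative (\<lambda>h. h \<bullet> a)) (at x)" for x :: 'a
    by (auto intro!: derivative_eq_intros)
  then have "partial b (\<lambda>x. x \<bullet> a) = (\<lambda>x. b \<bullet> a)" for b
    by (intro ext partial_eqI)
  then show ?thesis using d Suc by (auto simp: differentiable_def)
qed (simp add: continuous_intros)

lemma C_k_on_add:
  assumes "open S" "C_k_on n S f" "C_k_on n S g"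
  shows "C_k_on n S (\<lambda>x. f x + g x)"
  using assms(2,3)
proof (induction n arbitrary: f g)
  case 0
  then show ?case by (simp add: continuous_on_add)
next
  case (Suc n)
  have "C_k_on n S (partial b (\<lambda>x. f x + g x))" if b: "b \<in> Basis" for b
  proof -
    have "partial b (\<lambda>x. f x + g x) x = partial b f x + partial b g x" if "x \<in> S" for x
      using Suc.prems that by (intro partial_eqI has_derivative_add has_derivative_partial) auto
    from C_k_on_cong[OF assms(1) this] show ?thesis using Suc b by simp
  qed
  then show ?case using Suc.prems by simp
qed

lemma C_k_on_mult:
  assumes "open S" "C_k_on n S f" "C_k_on n S g"
  shows "C_k_on n S (\<lambda>x. f x * g x)"
  using assms(2,3)
proof (induction n arbitrary: f g)
  case 0
  then show ?case by (simp add: continuous_on_mult)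
next
  case (Suc n)
  have "C_k_on n S (partial b (\<lambda>x. f x * g x))" if b: "b \<in> Basis" for b
  proof -
    have "partial b (\<lambda>x. f x * g x) x = f x * partial b g x + partial b f x * g x" if "x \<in> S" for x
      using Suc.prems that 
      by (intro partial_eqI[where f' = "\<lambda>h. f x * partial h g x + partial h f x * g x"] 
           has_derivative_mult has_derivative_partial) auto
    moreover have "C_k_on n S (\<lambda>x. f x * partial b g x + partial b f x * g x)"
      using Suc.prems b C_k_on_SucD[OF Suc.prems(1)] C_k_on_SucD[OF Suc.prems(2)]
      by (intro C_k_on_add[OF assms(1)] Suc.IH) simp_all
    ultimately show ?thesis by (subst C_k_on_cong[OF assms(1)])
  qed
  then show ?case using Suc.prems by simp
qed

lemma C_k_on_diff:
  assumes "open S" "C_k_on n S f" "C_k_on n S g"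
  shows "C_k_on n S (\<lambda>x. f x - g x)"
  using C_k_on_add[OF assms(1,2) C_k_on_mult[OF assms(1) C_k_on_const[of n S "-1"] assms(3)]] by simp

section \<open>Flat functions and smooth truncations\<close>

definition flat :: "nat \<Rightarrow> real \<Rightarrow> real" where
  "flat m y = (if y > 0 then (1 / y) ^ m * exp (- 1 / y) else 0)"

lemma flat_nonpos [simp]: "y \<le> 0 \<Longrightarrow> flat m y = 0"
  by (simp add: flat_def)

text \<open>The powers of \<open>1 / y\<close> close the family under differentiation, so smoothness
  of \<open>flat 0\<close>, the usual \<open>exp (- 1 / y)\<close>, follows by an induction that
  runs over all \<open>m\<close> at once. At \<open>0\<close> the exponential beats every
  power.\<close>

lemma flat_DERIV: "(flat m has_real_derivative (- real m * flat (m + 1) y + flat (m + 2) y)) (at y)"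
proof -
  consider "y > 0" | "y < 0" | "y = 0" by linarith
  then show ?thesis
  proof cases
    case 1
    have "((\<lambda>y. (1 / y) ^ m * exp (- 1 / y)) has_real_derivative
        (- real m * flat (m + 1) y + flat (m + 2) y)) (at y)"
    proof (cases m)
      case 0
      then show ?thesis using 1
        by (auto intro!: derivative_eq_intros simp: flat_def power2_eq_square)
    next
      case (Suc n)
      then show ?thesis using 1
        by (auto intro!: derivative_eq_intros simp: flat_def power2_eq_square) (cases n; simp add: field_simps)
    qed
    then show ?thesis
      by (rule has_field_derivative_transform_within_open[where S = "{0<..}"]) (use 1 in \<open>auto simp: flat_def\<close>)
  next
    case 2
    have "((\<lambda>y. 0) has_real_derivative 0) (at y)" by simp
    then have "(flat m has_real_derivative 0) (at y)"
      by (rule has_field_derivative_transform_within_open[where S = "{..<0}"]) (use 2 in auto)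
    then show ?thesis using 2 by simp
  next
    case 3
    have "((\<lambda>y. flat m y / y) \<longlongrightarrow> 0) (at_right 0)"
    proof (rule Lim_transform_eventually)
      show "((\<lambda>y. inverse y ^ (m + 1) / exp (inverse y)) \<longlongrightarrow> 0) (at_right (0::real))"
        by (rule filterlim_compose[OF tendsto_power_div_exp_0 filterlim_inverse_at_top_right])
      show "\<forall>\<^sub>F y in at_right 0. inverse y ^ (m + 1) / exp (inverse y) = flat m y / y"
        unfolding eventually_at_right_field
        by (rule exI[of _ 1]) (auto simp: flat_def exp_minus field_simps)
    qed
    moreover have "((\<lambda>y. flat m y / y) \<longlongrightarrow> 0) (at_left 0)"
    proof (rule Lim_transform_eventually[OF tendsto_const])
      show "\<forall>\<^sub>F y in at_left 0. 0 = flat m y / y"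
        unfolding eventually_at_left_field by (rule exI[of _ "-1"]) auto
    qed
    ultimately have "((\<lambda>y. flat m y / y) \<longlongrightarrow> 0) (at 0)" by (simp add: filterlim_at_split)
    then show ?thesis using 3 by (simp add: has_field_derivative_iff)
  qed
qed

lemma continuous_on_flat: "continuous_on S (flat m)"
  by (intro continuous_at_imp_continuous_on ballI DERIV_isCont[OF flat_DERIV])

lemma C_k_on_flat:
  assumes "open S" "C_k_on n S f"
  shows "C_k_on n S (\<lambda>x. flat m (f x))"
  using assms(2)
proof (induction n arbitrary: m)
  case 0
  then show ?case by (auto intro: continuous_on_compose2[OF continuous_on_flat[of UNIV]])
next
  case (Suc n)
  have d: "((\<lambda>x. flat m (f x)) has_derivative
      (\<lambda>h. (- real m * flat (m + 1) (f x) + flat (m + 2) (f x)) * partial h f x)) (at x)" if "x \<in> S" for x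
  proof -
    have "f differentiable (at x)" using Suc.prems that by simp
    from has_derivative_compose[OF has_derivative_partial[OF this] flat_DERIV[unfolded has_field_derivative_def]]
    show ?thesis .
  qed
  have "C_k_on n S (partial b (\<lambda>x. flat m (f x)))" if b: "b \<in> Basis" for b
  proof -
    have "C_k_on n S (\<lambda>x. (- real m * flat (m + 1) (f x) + flat (m + 2) (f x)) * partial b f x)"
      using Suc.prems b C_k_on_SucD[OF Suc.prems]
      by (intro C_k_on_mult[OF assms(1)] C_k_on_add[OF assms(1)] Suc.IH C_k_on_const) auto
    moreover have "partial b (\<lambda>x. flat m (f x)) x =
        (- real m * flat (m + 1) (f x) + flat (m + 2) (f x)) * partial b f x" if "x \<in> S" for x
      by (rule partial_eqI[OF d[OF that]])
    ultimately show ?thesis by (subst C_k_on_cong[OF assms(1)])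
  qed
  then show ?case using d by (auto simp: differentiable_def)
qed

text \<open>A smooth substitute for the truncation \<open>max 0 (y - d)\<close>.\<close>

definition soft_trunc :: "real \<Rightarrow> real \<Rightarrow> real" where
  "soft_trunc d y = y * flat 0 ((y - d) / d)"

definition soft_trunc_deriv :: "real \<Rightarrow> real \<Rightarrow> real" where
  "soft_trunc_deriv d y = flat 0 ((y - d) / d) + y / d * flat 2 ((y - d) / d)"

lemma soft_trunc_DERIV:
  assumes "d > 0"
  shows "(soft_trunc d has_real_derivative soft_trunc_deriv d y) (at y)"
proof -
  have "((\<lambda>y. flat 0 ((y - d) / d)) has_real_derivative flat 2 ((y - d) / d) * (1 / d)) (at y)"
  proof (rule DERIV_cong[OF DERIV_chain2[where f = "flat 0" and g = "\<lambda>y. (y - d) / d" and Db = "1 / d"]])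
    show "((\<lambda>y. (y - d) / d) has_real_derivative 1 / d) (at y)"
      using assms by (auto intro!: derivative_eq_intros)
    show "(flat 0 has_real_derivative flat 2 ((y - d) / d)) (at ((y - d) / d))"
      using flat_DERIV[of 0] by (simp add: numeral_2_eq_2)
  qed simp
  from DERIV_mult[OF DERIV_ident this] show ?thesis
    by (simp add: soft_trunc_def[abs_def] soft_trunc_deriv_def mult.commute)
qed

lemma soft_trunc_zero:
  assumes "d > 0" "y \<le> d"
  shows "soft_trunc d y = 0" "soft_trunc_deriv d y = 0"
proof -
  have "(y - d) / d \<le> 0" using assms by (intro divide_nonpos_pos) auto
  then show "soft_trunc d y = 0" "soft_trunc_deriv d y = 0"
    by (simp_all add: soft_trunc_def soft_trunc_deriv_def)
qed

text \<open>Apart from the factor \<open>y\<close>, everything depends on the single variable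
  \<open>z\<close>, which tends to \<open>0\<close> with \<open>d\<close>; bounds and limits become
  statements about \<open>exp (- z)\<close>.\<close>

lemma soft_trunc_eq:
  assumes "d > 0" "y > d"
  defines "z \<equiv> d / (y - d)"
  shows "soft_trunc d y = y * exp (- z)" "soft_trunc_deriv d y = exp (- z) * (1 + z + z\<^sup>2)"
proof -
  have w: "(y - d) / d > 0" "1 / ((y - d) / d) = z" "y / d = 1 + 1 / z" "z > 0"
    using assms by (auto simp: field_simps)
  have "flat m ((y - d) / d) = z ^ m * exp (- z)" for m
    using w(1) by (simp add: flat_def z_def power_divide)
  then show "soft_trunc d y = y * exp (- z)" "soft_trunc_deriv d y = exp (- z) * (1 + z + z\<^sup>2)"
    unfolding soft_trunc_def soft_trunc_deriv_def w(3) using w(4)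
    by (simp_all add: field_simps power2_eq_square)
qed

lemma soft_trunc_bounds:
  assumes "d > 0" "y \<ge> 0"
  shows "0 \<le> soft_trunc d y" "soft_trunc d y \<le> y" 
proof -
  have "0 \<le> soft_trunc d y \<and> soft_trunc d y \<le> y"
  proof (cases "y \<le> d")
    case False
    then show ?thesis using assms soft_trunc_eq[of d y] by (simp add: mult_le_cancel_left1)
  qed (use soft_trunc_zero assms in simp)
  then show "0 \<le> soft_trunc d y" "soft_trunc d y \<le> y" by auto
qed

text \<open>From \<open>1 + z + z\<^sup>2 / 2 \<le> exp z\<close> follows
  \<open>1 + z + z\<^sup>2 \<le> 2 * exp z\<close>. The bound is uniform in \<open>d\<close> and
  provides majorants when \<open>d\<close> tends to zero.\<close>

lemma soft_trunc_deriv_bounds: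
  assumes "d > 0"
  shows "0 \<le> soft_trunc_deriv d y" "soft_trunc_deriv d y \<le> 2"
proof -
  have "0 \<le> soft_trunc_deriv d y \<and> soft_trunc_deriv d y \<le> 2"
  proof (cases "y \<le> d")
    case False
    define z where "z = d / (y - d)"
    have z: "z > 0" using False assms by (simp add: z_def)
    have "1 + z + z\<^sup>2 / 2 \<le> exp z" using exp_lower_Taylor_quadratic[of z] z by simp
    then have "1 + z + z\<^sup>2 \<le> 2 * exp z" using z by auto
    then have "exp (- z) * (1 + z + z\<^sup>2) \<le> exp (- z) * (2 * exp z)"
      by (intro mult_left_mono) auto
    also have "\<dots> = 2" by (simp add: mult_exp_exp mult.left_commute)
    finally show ?thesis using soft_trunc_eq(2)[OF assms, of y] False z by (simp add: z_def)
  qed (use soft_trunc_zero assms in simp)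
  then show "0 \<le> soft_trunc_deriv d y" "soft_trunc_deriv d y \<le> 2" by auto
qed

lemma soft_trunc_tendsto:
  assumes d: "(d \<longlongrightarrow> 0) F" "\<forall>\<^sub>F x in F. d x > 0" and y: "(y \<longlongrightarrow> l) F" "l > 0"
  shows "((\<lambda>x. soft_trunc (d x) (y x)) \<longlongrightarrow> l) F" "((\<lambda>x. soft_trunc_deriv (d x) (y x)) \<longlongrightarrow> 1) F"
proof -
  have "((\<lambda>x. y x - d x) \<longlongrightarrow> l - 0) F" by (intro tendsto_intros d y)
  then have *: "\<forall>\<^sub>F x in F. d x > 0 \<and> d x < y x"
    using eventually_conj[OF d(2) order_tendstoD(1)[of "\<lambda>x. y x - d x" "l - 0" F 0]] y(2) 
    by (simp add: eventually_mono)
  define z where "z x = d x / (y x - d x)" for x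
  have z: "(z \<longlongrightarrow> 0) F"
    unfolding z_def[abs_def] using y by (auto intro!: tendsto_eq_intros d y)
  have "((\<lambda>x. y x * exp (- z x)) \<longlongrightarrow> l) F" "((\<lambda>x. exp (- z x) * (1 + z x + (z x)\<^sup>2)) \<longlongrightarrow> 1) F"
    by (auto intro!: tendsto_eq_intros z y)
  note limits = this
  have "\<forall>\<^sub>F x in F. y x * exp (- z x) = soft_trunc (d x) (y x)"
    "\<forall>\<^sub>F x in F. exp (- z x) * (1 + z x + (z x)\<^sup>2) = soft_trunc_deriv (d x) (y x)"
    using * by (auto elim!: eventually_mono simp: soft_trunc_eq z_def)
  from Lim_transform_eventually[OF limits(1) this(1)] Lim_transform_eventually[OF limits(2) this(2)]
  show "((\<lambda>x. soft_trunc (d x) (y x)) \<longlongrightarrow> l) F" "((\<lambda>x. soft_trunc_deriv (d x) (y x)) \<longlongrightarrow> 1) F" .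
qed

lemma soft_trunc_continuous_on: "d > 0 \<Longrightarrow> continuous_on S (soft_trunc d)"
  by (intro continuous_at_imp_continuous_on ballI DERIV_isCont[OF soft_trunc_DERIV])

lemma C_k_on_soft_trunc:
  assumes "open S" "C_k_on n S f"
  shows "C_k_on n S (\<lambda>x. soft_trunc d (f x))"
proof -
  have "C_k_on n S (\<lambda>x. f x * flat 0 ((1 / d) * (f x - d)))"
    using assms by (intro C_k_on_mult C_k_on_flat C_k_on_diff) auto
  then show ?thesis by (simp add: soft_trunc_def)
qed

section \<open>Integration\<close>

lemma finite_measure_lebesgue_on_bounded:
  fixes S :: "'a::euclidean_space set"
  assumes "open S" "bounded S"
  shows "finite_measure (lebesgue_on S)"
  using assms by (intro finite_measureI)
    (use emeasure_bounded_finite[OF assms(2)] in \<open>simp add: emeasure_restrict_space space_restrict_space\<close>)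

lemma
  fixes S :: "'a::euclidean_space set" and f :: "'a \<Rightarrow> 'b::euclidean_space"
  assumes S: "open S" and f: "f \<in> borel_measurable borel" and supp: "\<And>x. x \<notin> S \<Longrightarrow> f x = 0"
  shows integral_lebesgue_on_support: "integral\<^sup>L (lebesgue_on S) f = integral\<^sup>L lborel f"
    and integrable_lebesgue_on_support: "integrable (lebesgue_on S) f \<longleftrightarrow> integrable lborel f"
proof -
  have eq: "(\<lambda>x. indicat_real S x *\<^sub>R f x) = f" using supp by (auto simp: fun_eq_iff indicator_def)
  show "integral\<^sup>L (lebesgue_on S) f = integral\<^sup>L lborel f"
    using S f by (simp add: integral_restrict_space eq integral_completion)
  show "integrable (lebesgue_on S) f \<longleftrightarrow> integrable lborel f"
    using S f by (simp add: integrable_restrict_space eq integrable_completion)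
qed

lemma borel_measurable_lebesgue_on:
  fixes S :: "'a::euclidean_space set" and f :: "'a \<Rightarrow> 'b::euclidean_space"
  assumes "f \<in> borel_measurable borel"
  shows "f \<in> borel_measurable (lebesgue_on S)"
  using assms by (intro measurable_restrict_space1 measurable_completion) simp

lemma continuous_punctured_measurable:
  fixes S :: "'a::euclidean_space set" and f :: "'a \<Rightarrow> 'b::euclidean_space"
  assumes S: "open S" and f: "continuous_on (S - {a}) f"
  shows "f \<in> borel_measurable (lebesgue_on S)"
proof -
  have "(\<lambda>x. indicat_real (S - {a}) x *\<^sub>R f x) \<in> borel_measurable borel"
    using S f by (intro borel_measurable_continuous_on_indicator) auto
  then have "(\<lambda>x. if x = a then f a else indicat_real (S - {a}) x *\<^sub>R f x) \<in> borel_measurable borel"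
    by (intro measurable_If) auto
  from borel_measurable_lebesgue_on[OF this, of S] show ?thesis
    by (rule measurable_cong[THEN iffD1, rotated]) (auto simp: space_restrict_space)
qed

lemma AE_lebesgue_on_neq:
  fixes S :: "'a::euclidean_space set"
  assumes "open S"
  shows "AE x in lebesgue_on S. x \<noteq> a"
proof -
  have "AE x in lebesgue. x \<noteq> a"
    by (intro AE_completion AE_lborel_singleton)
  then show ?thesis using assms by (subst AE_restrict_space_iff) (auto elim: eventually_mono)
qed

lemma AE_lebesgue_onI:
  fixes S :: "'a::euclidean_space set"
  assumes "open S" "\<And>x. x \<in> S \<Longrightarrow> x \<noteq> a \<Longrightarrow> P x"
  shows "AE x in lebesgue_on S. P x"
proof -
  have "AE x in lebesgue_on S. x \<in> S"
    by (rule AE_I2) (simp add: space_restrict_space)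
  with AE_lebesgue_on_neq[OF assms(1), of a] show ?thesis
    by eventually_elim (rule assms(2))
qed

lemma integral_Fatou_bound:
  fixes f :: "'a \<Rightarrow> real" and s :: "nat \<Rightarrow> 'a \<Rightarrow> real"
  assumes f: "f \<in> borel_measurable M" and s: "\<And>n. integrable M (s n)"
    and lim: "AE x in M. (\<lambda>n. s n x) \<longlonglongrightarrow> f x"
    and nn: "\<And>n. AE x in M. 0 \<le> s n x"
    and C: "\<And>n. integral\<^sup>L M (s n) \<le> C"
  shows "integrable M f" "integral\<^sup>L M f \<le> C"
proof -
  have C0: "C \<ge> 0" using integral_nonneg_AE[OF nn[of 0]] C[of 0] by simp
  have f0: "AE x in M. 0 \<le> f x"
  proof -
    have "AE x in M. \<forall>n. 0 \<le> s n x" using nn by (simp add: AE_all_countable)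
    with lim show ?thesis by eventually_elim (rule LIMSEQ_le_const, auto)
  qed
  have "(\<integral>\<^sup>+x. ennreal (f x) \<partial>M) = (\<integral>\<^sup>+x. liminf (\<lambda>n. ennreal (s n x)) \<partial>M)"
  proof (rule nn_integral_cong_AE)
    show "AE x in M. ennreal (f x) = liminf (\<lambda>n. ennreal (s n x))"
      using lim
    proof eventually_elim
      fix x assume "(\<lambda>n. s n x) \<longlonglongrightarrow> f x"
      then have "(\<lambda>n. ennreal (s n x)) \<longlonglongrightarrow> ennreal (f x)" by (rule tendsto_ennrealI)
      then show "ennreal (f x) = liminf (\<lambda>n. ennreal (s n x))"
        using lim_imp_Liminf[OF sequentially_bot] by metis
    qed
  qed
  also have "\<dots> \<le> liminf (\<lambda>n. \<integral>\<^sup>+x. ennreal (s n x) \<partial>M)"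
    using s by (intro nn_integral_liminf) auto
  also have "\<dots> \<le> liminf (\<lambda>n::nat. ennreal C)"
    using C by (intro Liminf_mono always_eventually allI)
      (simp add: nn_integral_eq_integral[OF s nn] ennreal_leI)
  also have "\<dots> = ennreal C" by (simp add: Liminf_const)
  finally have *: "(\<integral>\<^sup>+x. ennreal (f x) \<partial>M) \<le> ennreal C" .
  show int: "integrable M f"
    using f f0 * by (intro integrableI_nonneg) (auto simp: top.extremum_unique less_top[symmetric] intro: le_less_trans)
  show "integral\<^sup>L M f \<le> C"
    using * C0 by (simp add: nn_integral_eq_integral[OF int f0])
qed

lemma continuous_compact_support_integrable:
  fixes f :: "'a::euclidean_space \<Rightarrow> real"
  assumes "continuous_on UNIV f" "\<And>x. norm x > R \<Longrightarrow> f x = 0"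
  shows "integrable lborel f"
proof -
  have "compact (f ` cball 0 R)"
    by (intro compact_continuous_image continuous_on_subset[OF assms(1)]) auto
  then obtain B where "\<And>x. x \<in> cball 0 R \<Longrightarrow> \<bar>f x\<bar> \<le> B"
    using bounded_pos by (metis compact_imp_bounded imageI real_norm_def)
  then show ?thesis using assms(2) borel_measurable_continuous_onI[OF assms(1)]
    by (intro integrableI_bounded_set[of "cball 0 R" _ _ B]) (use emeasure_bounded_finite[OF bounded_cball] in \<open>auto simp: less_top\<close>)
qed

text \<open>Integrals of partial derivatives vanish because Lebesgue measure is translation invariant:
  difference quotients have integral zero.\<close>

lemma integral_partial_eq_0:
  fixes h :: "'a::euclidean_space \<Rightarrow> real"
  assumes h: "C_k 1 h" and supp: "\<And>x. norm x > R \<Longrightarrow> h x = 0" and b: "b \<in> Basis"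
  shows "integral\<^sup>L lborel (partial b h) = 0"
proof -
  define g where "g = partial b h"
  have contg: "continuous_on UNIV g" and diffh: "h differentiable (at x)" for x
    using h b by (auto simp: g_def)
  have dh: "(h has_derivative (\<lambda>k. partial k h x)) (at x)" for x
    by (rule has_derivative_partial[OF diffh])
  have conth: "continuous_on UNIV h"
    using diffh by (intro continuous_at_imp_continuous_on ballI differentiable_imp_continuous_within) auto
  have g0: "g x = 0" if "norm x > R" for x
  proof -
    have "open {y. norm y > R}" by (intro open_Collect_less continuous_intros)
    then have "partial b h x = partial b (\<lambda>x. 0) x"
      by (rule partial_cong_open) (use that supp in auto)
    then show ?thesis using partial_eqI[OF has_derivative_const] by (simp add: g_def)
  qed
  have "compact (g ` cball 0 R)"
    by (intro compact_continuous_image continuous_on_subset[OF contg]) auto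
  then obtain L where L: "\<And>x. x \<in> cball 0 R \<Longrightarrow> \<bar>g x\<bar> \<le> L" "L \<ge> 0"
    using bounded_pos by (metis compact_imp_bounded imageI less_imp_le real_norm_def)
  have gL: "\<bar>g x\<bar> \<le> L" for x using L g0[of x] by (cases "norm x > R") auto
  define t where "t n = 1 / real (Suc n)" for n
  have t: "t n > 0" "t n \<le> 1" for n by (auto simp: t_def field_simps)
  have t0: "t \<longlonglongrightarrow> 0" unfolding t_def using LIMSEQ_inverse_real_of_nat by (simp add: inverse_eq_divide)
  define q where "q n x = (h (t n *\<^sub>R b + x) - h x) / t n" for n x
  have line: "((\<lambda>s. h (s *\<^sub>R b + x)) has_real_derivative g (s *\<^sub>R b + x)) (at s)" for s x
  proof -
    have "((\<lambda>s. s *\<^sub>R b + x) has_derivative (\<lambda>r. r *\<^sub>R b)) (at s)"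
      by (auto intro!: derivative_eq_intros)
    from has_derivative_compose[OF this dh]
    have "((\<lambda>s. h (s *\<^sub>R b + x)) has_derivative (\<lambda>r. partial (r *\<^sub>R b) h (s *\<^sub>R b + x))) (at s)" .
    moreover have "partial (r *\<^sub>R b) h y = g y * r" for r y
      using linear_scale[OF has_derivative_linear[OF dh[of y]], of r b] by (simp add: g_def)
    ultimately show ?thesis by (simp add: has_field_derivative_def)
  qed
  have qL: "\<bar>q n x\<bar> \<le> L" for n x
  proof -
    obtain s where "h (t n *\<^sub>R b + x) - h (0 *\<^sub>R b + x) = (t n - 0) * g (s *\<^sub>R b + x)"
      using MVT2[OF t(1)[of n], of "\<lambda>s. h (s *\<^sub>R b + x)" "\<lambda>s. g (s *\<^sub>R b + x)"] line by blast
    then show ?thesis using t(1)[of n] gL by (simp add: q_def)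
  qed
  have q0: "q n x = 0" if "norm x > R + 1" for n x
  proof -
    have "norm x \<le> norm (t n *\<^sub>R b + x) + norm (t n *\<^sub>R b)"
      by (metis add_diff_cancel_left' norm_triangle_ineq4 add.commute norm_minus_commute)
    moreover have "norm (t n *\<^sub>R b) \<le> 1" using t[of n] b by simp
    ultimately have "norm (t n *\<^sub>R b + x) > R" using that by linarith
    then show ?thesis using supp that by (simp add: q_def)
  qed
  have hm: "h \<in> borel_measurable borel" using conth by (rule borel_measurable_continuous_onI)
  have hint: "integrable lborel h" by (rule continuous_compact_support_integrable[OF conth supp])
  have "(\<lambda>n. integral\<^sup>L lborel (q n)) \<longlonglongrightarrow> integral\<^sup>L lborel g"
  proof (rule integral_dominated_convergence[where w = "\<lambda>x. L * indicat_real (cball 0 (R + 1)) x"])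
    show "g \<in> borel_measurable lborel" using contg borel_measurable_continuous_onI by simp
    show "q n \<in> borel_measurable lborel" for n unfolding q_def using hm by measurable
    show "integrable lborel (\<lambda>x. L * indicat_real (cball 0 (R + 1)) x)"
      using emeasure_lborel_cball_finite[of 0 "R + 1"]
      by (intro integrable_mult_right integrable_real_indicator) (auto simp: less_top)
    show "AE x in lborel. norm (q n x) \<le> L * indicat_real (cball 0 (R + 1)) x" for n
      using qL q0 by (intro AE_I2) (auto simp: indicator_def not_le)
    show "AE x in lborel. (\<lambda>n. q n x) \<longlonglongrightarrow> g x"
    proof (rule AE_I2)
      fix x
      have "((\<lambda>s. (h (s *\<^sub>R b + x) - h x) / s) \<longlongrightarrow> g x) (at 0)"
        using line[of x 0] by (simp add: has_field_derivative_iff)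
      moreover have "filterlim t (at 0) sequentially"
        using t0 t(1) by (auto simp: filterlim_at less_imp_neq[THEN not_sym])
      ultimately show "(\<lambda>n. q n x) \<longlonglongrightarrow> g x" unfolding q_def by (rule filterlim_compose)
    qed
  qed
  moreover have "integral\<^sup>L lborel (q n) = 0" for n
  proof -
    have "integrable lborel (\<lambda>x. h (t n *\<^sub>R b + x))" "(\<integral>x. h (t n *\<^sub>R b + x) \<partial>lborel) = integral\<^sup>L lborel h"
      using integrable_distr_eq[of "(+) (t n *\<^sub>R b)" lborel borel h] integral_distr[of "(+) (t n *\<^sub>R b)" lborel borel h] hm hint
      by (simp_all add: lborel_distr_plus)
    then show ?thesis using hint by (simp add: q_def[abs_def])
  qed
  ultimately show ?thesis by (simp add: g_def LIMSEQ_const_iff)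
qed

section \<open>Radial profiles\<close>

lemma gradient_inner:
  assumes "f differentiable (at x)"
  shows "gradient f x \<bullet> h = partial h f x"
proof -
  define D where "D h = partial h f x" for h
  have lin: "linear D"
    unfolding D_def[abs_def] by (rule has_derivative_linear[OF has_derivative_partial[OF assms]])
  have "D (\<Sum>b\<in>Basis. (h \<bullet> b) *\<^sub>R b) = (\<Sum>b\<in>Basis. (h \<bullet> b) * D b)"
    by (simp add: linear_sum[OF lin] linear_scale[OF lin])
  then have "D h = (\<Sum>b\<in>Basis. (h \<bullet> b) * D b)" by (simp only: euclidean_representation)
  then show ?thesis
    by (simp add: D_def gradient_def inner_sum_left inner_sum_right inner_commute mult.commute)
qed

lemma gradient_eqI:
  assumes "(f has_derivative (\<lambda>h. w \<bullet> h)) (at x)"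
  shows "gradient f x = w"
  unfolding gradient_def using partial_eqI[OF assms] by (simp add: euclidean_representation)

lemma gradient_cong_open:
  "open S \<Longrightarrow> x \<in> S \<Longrightarrow> (\<And>y. y \<in> S \<Longrightarrow> f y = g y) \<Longrightarrow> gradient f x = gradient g x"
  unfolding gradient_def by (auto intro!: sum.cong partial_cong_open)

lemma gradient_const [simp]: "gradient (\<lambda>x. c) x = 0"
  by (rule gradient_eqI) simp

lemma continuous_on_gradient:
  assumes "C_k 1 f"
  shows "continuous_on UNIV (gradient f)"
  using assms unfolding gradient_def[abs_def] by (auto intro!: continuous_intros)

lemma gradient_outside:
  assumes "\<And>y. norm y > R \<Longrightarrow> f y = 0" "norm x > R"
  shows "gradient f x = 0"
proof -
  have "open {y. norm y > R}" by (intro open_Collect_less continuous_intros)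
  then have "gradient f x = gradient (\<lambda>x. 0) x"
    by (rule gradient_cong_open) (use assms in auto)
  then show ?thesis by simp
qed

lemma has_derivative_radial:
  fixes x :: "'a::euclidean_space"
  assumes "x \<noteq> 0" "(f has_real_derivative D) (at (norm x))"
  shows "((\<lambda>x. f (norm x)) has_derivative (\<lambda>h. D / norm x * (x \<bullet> h))) (at x)"
proof -
  have "(norm has_derivative (\<lambda>h. sgn x \<bullet> h)) (at x)"
    using has_derivative_norm[OF assms(1)] by (simp add: inner_commute)
  from has_derivative_compose[OF this assms(2)[unfolded has_field_derivative_def]]
  show ?thesis by (simp add: sgn_div_norm divide_inverse mult_ac)
qed

lemma C_1_continuous: "C_k 1 f \<Longrightarrow> continuous_on S f"
  using C_k_on_SucD[of 0 UNIV f] continuous_on_subset by (fastforce simp: C_k_on_UNIV)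

lemma open_punctured: "open (B1 - {0})"
  by auto

lemma test_functionD:
  fixes \<phi> :: "real ^ 2 \<Rightarrow> real"
  assumes "test_function B1 \<phi>"
  obtains rho where "rho < 1" "\<And>x. norm x > rho \<Longrightarrow> \<phi> x = 0" "C_k 1 \<phi>"
proof -
  define K where "K = closure {x. \<phi> x \<noteq> 0}"
  have K: "compact K" "K \<subseteq> B1" and C: "C_k 1 \<phi>"
    using assms by (auto simp: test_function_def K_def)
  have sub: "\<phi> x = 0" if "x \<notin> K" for x
    using that closure_subset[of "{x. \<phi> x \<noteq> 0}"] by (auto simp: K_def)
  show thesis
  proof (cases "K = {}")
    case True
    then show thesis using sub C by (intro that[of 0]) auto
  next
    case False
    obtain y where y: "y \<in> K" "\<And>x. x \<in> K \<Longrightarrow> norm x \<le> norm y"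
      using continuous_attains_sup[OF K(1) False, of norm] by (auto intro: continuous_intros)
    have "norm y < 1" using y(1) K(2) by auto
    moreover have "\<phi> x = 0" if "norm x > norm y" for x
      using sub[of x] y(2)[of x] that by force
    ultimately show thesis using C by (intro that[of "norm y"])
  qed
qed

lemma gradient_bounded:
  fixes \<psi> :: "'a::euclidean_space \<Rightarrow> real"
  assumes "C_k 1 \<psi>" "\<And>x. norm x > rho \<Longrightarrow> \<psi> x = 0"
  obtains L where "L \<ge> 0" "\<And>x. norm (gradient \<psi> x) \<le> L"
proof -
  have "compact (gradient \<psi> ` cball 0 rho)"
    by (intro compact_continuous_image continuous_on_subset[OF continuous_on_gradient[OF assms(1)]]) auto
  then obtain L where L: "L > 0" "\<And>x. x \<in> cball 0 rho \<Longrightarrow> norm (gradient \<psi> x) \<le> L"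
    using bounded_pos by (metis compact_imp_bounded imageI)
  have "norm (gradient \<psi> x) \<le> L" for x
    using L gradient_outside[of rho \<psi> x] assms(2) by (cases "norm x > rho") auto
  then show thesis using L(1) by (intro that[of L]) auto
qed

lemma C_1_bounded:
  fixes \<psi> :: "'a::euclidean_space \<Rightarrow> real"
  assumes "C_k 1 \<psi>" "\<And>x. norm x > rho \<Longrightarrow> \<psi> x = 0"
  obtains B where "B \<ge> 0" "\<And>x. \<bar>\<psi> x\<bar> \<le> B"
proof -
  have "compact (\<psi> ` cball 0 rho)"
    by (intro compact_continuous_image C_1_continuous[OF assms(1)]) auto
  then obtain B where B: "B > 0" "\<And>x. x \<in> cball 0 rho \<Longrightarrow> \<bar>\<psi> x\<bar> \<le> B"
    using bounded_pos by (metis compact_imp_bounded imageI real_norm_def)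
  have "\<bar>\<psi> x\<bar> \<le> B" for x using B assms(2)[of x] by (cases "norm x > rho") auto
  then show thesis using B(1) by (intro that[of B]) auto
qed

lemma C_1_measurable:
  fixes \<psi> :: "'a::euclidean_space \<Rightarrow> real"
  assumes "C_k 1 \<psi>"
  shows "\<psi> \<in> borel_measurable (lebesgue_on S)" "gradient \<psi> \<in> borel_measurable (lebesgue_on S)"
proof -
  show "\<psi> \<in> borel_measurable (lebesgue_on S)"
    by (intro borel_measurable_lebesgue_on borel_measurable_continuous_onI C_1_continuous assms)
  show "gradient \<psi> \<in> borel_measurable (lebesgue_on S)"
    by (intro borel_measurable_lebesgue_on borel_measurable_continuous_onI continuous_on_gradient assms)
qed

lemma finite_measure_B1: "finite_measure (lebesgue_on B1)"
  by (rule finite_measure_lebesgue_on_bounded) auto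

lemma integrable_B1_bounded:
  fixes f :: "real ^ 2 \<Rightarrow> 'b::euclidean_space"
  assumes "f \<in> borel_measurable (lebesgue_on B1)" "\<And>x. x \<in> B1 \<Longrightarrow> x \<noteq> 0 \<Longrightarrow> norm (f x) \<le> B"
  shows "integrable (lebesgue_on B1) f"
  by (rule finite_measure.integrable_const_bound[OF finite_measure_B1 AE_lebesgue_onI[OF open_ball] assms(1)])
     (rule assms(2))

lemma integral_gradient_eq_0:
  fixes h :: "real ^ 2 \<Rightarrow> real"
  assumes h: "C_k 1 h" and rho: "rho < 1" "\<And>x. norm x > rho \<Longrightarrow> h x = 0"
  shows "(LINT x|lebesgue_on B1. gradient h x) = 0"
proof (rule euclidean_eqI)
  fix b :: "real^2" assume b: "b \<in> Basis"
  let ?M = "lebesgue_on B1"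
  obtain L where L: "L \<ge> 0" "\<And>x. norm (gradient h x) \<le> L" using gradient_bounded[OF h rho(2)] by blast
  have int: "integrable ?M (gradient h)"
    by (rule integrable_B1_bounded[OF C_1_measurable(2)[OF h] L(2)])
  have gb: "gradient h x \<bullet> b = partial b h x" for x using h by (intro gradient_inner) simp
  have out: "partial b h x = 0" if "x \<notin> B1" for x
    using gradient_outside[of rho h x] rho that gb[of x] by auto
  have "(LINT x|?M. gradient h x) \<bullet> b = (LINT x|?M. gradient h x \<bullet> b)"
    by (rule integral_inner_left[symmetric]) (rule int)
  also have "\<dots> = (LINT x|?M. partial b h x)" by (simp only: gb)
  also have "\<dots> = integral\<^sup>L lborel (partial b h)"
    by (rule integral_lebesgue_on_support[OF open_ball[of 0 1] borel_measurable_continuous_onI out])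
       (use h b in auto)
  also have "\<dots> = 0" by (rule integral_partial_eq_0[OF h rho(2) b])
  finally show "(LINT x|?M. gradient h x) \<bullet> b = 0 \<bullet> b" by simp
qed

text \<open>The weight \<open>t\<close> stays free: in the density argument it tends to zero
  together with the approximation error.\<close>

lemma weighted_AM_GM: "(t::real) > 0 \<Longrightarrow> a * b \<le> t * a\<^sup>2 + 1 / t * b\<^sup>2"
proof -
  assume t: "t > 0"
  have "0 \<le> (t * a - b)\<^sup>2 + (t * a)\<^sup>2 + b\<^sup>2" by simp
  then have "t * (a * b) \<le> t * (t * a\<^sup>2 + 1 / t * b\<^sup>2)"
    using t by (simp add: power2_eq_square algebra_simps)
  then show ?thesis using t by (simp only: mult_le_cancel_left_pos)
qed

lemma norm_diff_sq_le: "(norm (a - b))\<^sup>2 \<le> 2 * (norm a)\<^sup>2 + 2 * (norm b)\<^sup>2" for a b :: "'a::real_inner"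
proof -
  have "0 \<le> (norm (a + b))\<^sup>2" by simp
  then show ?thesis
    by (simp add: power2_norm_eq_inner inner_add_left inner_add_right inner_diff_left inner_diff_right inner_commute)
qed

lemma L2_diff_integrable:
  fixes f g :: "'a \<Rightarrow> 'b::euclidean_space"
  assumes [measurable]: "f \<in> borel_measurable M" "g \<in> borel_measurable M"
    and "integrable M (\<lambda>x. (norm (f x))\<^sup>2)" "integrable M (\<lambda>x. (norm (g x))\<^sup>2)"
  shows "integrable M (\<lambda>x. (norm (f x - g x))\<^sup>2)"
proof (rule Bochner_Integration.integrable_bound)
  show "integrable M (\<lambda>x. 2 * (norm (f x))\<^sup>2 + 2 * (norm (g x))\<^sup>2)" using assms(3,4) by simp
  show "AE x in M. norm ((norm (f x - g x))\<^sup>2) \<le> norm (2 * (norm (f x))\<^sup>2 + 2 * (norm (g x))\<^sup>2)"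
    by (rule AE_I2) (use norm_diff_sq_le in auto)
qed measurable

text \<open>A modulus that stays differentiable across the zeros of \<open>\<phi>\<close>; its
  gradient is that of \<open>\<phi>\<close> times a factor of modulus at most \<open>1\<close>.
  Subtracting \<open>e\<close> makes it vanish wherever \<open>\<phi>\<close> does.\<close>

lemma C_1_smooth_abs:
  fixes \<phi> :: "'a::euclidean_space \<Rightarrow> real"
  assumes \<phi>: "C_k 1 \<phi>" and e: "e > 0"
  defines "\<psi> \<equiv> \<lambda>x. sqrt ((\<phi> x)\<^sup>2 + e\<^sup>2) - e"
  shows "C_k 1 \<psi>" "gradient \<psi> x = (\<phi> x / sqrt ((\<phi> x)\<^sup>2 + e\<^sup>2)) *\<^sub>R gradient \<phi> x"
proof -
  have diff: "\<phi> differentiable (at x)" for x using \<phi> by simp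
  have pos: "(\<phi> x)\<^sup>2 + e\<^sup>2 > 0" for x using e by (simp add: add_nonneg_pos)
  have d: "(\<psi> has_derivative (\<lambda>h. \<phi> x / sqrt ((\<phi> x)\<^sup>2 + e\<^sup>2) * partial h \<phi> x)) (at x)" for x
  proof -
    have "((\<lambda>y. sqrt (y\<^sup>2 + e\<^sup>2) - e) has_real_derivative \<phi> x / sqrt ((\<phi> x)\<^sup>2 + e\<^sup>2)) (at (\<phi> x))"
      using pos[of x] e by (auto intro!: derivative_eq_intros simp: field_simps)
    from has_derivative_compose[OF has_derivative_partial[OF diff] this[unfolded has_field_derivative_def]]
    show ?thesis by (simp add: \<psi>_def)
  qed
  have cont: "continuous_on UNIV \<phi>" by (rule C_1_continuous[OF \<phi>])
  have "continuous_on UNIV (partial b \<psi>)" if "b \<in> Basis" for b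
  proof -
    have "partial b \<psi> = (\<lambda>x. \<phi> x / sqrt ((\<phi> x)\<^sup>2 + e\<^sup>2) * partial b \<phi> x)"
      by (rule ext) (rule partial_eqI[OF d])
    moreover have "sqrt ((\<phi> x)\<^sup>2 + e\<^sup>2) \<noteq> 0" for x using pos[of x] e by simp
    ultimately show ?thesis using \<phi> that by (auto intro!: continuous_intros cont)
  qed
  moreover have "\<psi> differentiable (at x)" for x using d[of x] unfolding differentiable_def by blast
  ultimately show "C_k 1 \<psi>" by simp
  show "gradient \<psi> x = (\<phi> x / sqrt ((\<phi> x)\<^sup>2 + e\<^sup>2)) *\<^sub>R gradient \<phi> x"
    by (rule gradient_eqI) (use d[of x] in \<open>simp add: gradient_inner[OF diff]\<close>)
qed

lemma C_1_diff:
  assumes "C_k 1 f" "C_k 1 g"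
  shows "C_k 1 (\<lambda>x. f x - g x)" "gradient (\<lambda>x. f x - g x) x = gradient f x - gradient g x"
proof -
  show "C_k 1 (\<lambda>x. f x - g x)"
    using C_k_on_diff[of UNIV 1 f g] assms by (simp only: C_k_on_UNIV open_UNIV)
  show "gradient (\<lambda>x. f x - g x) x = gradient f x - gradient g x"
    using assms
    by (intro gradient_eqI has_derivative_eq_rhs[OF has_derivative_diff[OF has_derivative_partial has_derivative_partial]])
       (auto simp: inner_diff_left gradient_inner)
qed

lemma H10_grad_cong:
  assumes eq: "\<And>x. x \<in> S \<Longrightarrow> u x = w x" and w: "H10_grad S w G"
  shows "H10_grad S u G"
proof -
  have sp: "space (lebesgue_on S) = S" by (simp add: space_restrict_space)
  have 1: "u \<in> borel_measurable (lebesgue_on S) \<longleftrightarrow> w \<in> borel_measurable (lebesgue_on S)"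
    by (rule measurable_cong) (simp add: eq sp)
  have 2: "integrable (lebesgue_on S) (\<lambda>x. (norm (u x))\<^sup>2) \<longleftrightarrow> integrable (lebesgue_on S) (\<lambda>x. (norm (w x))\<^sup>2)"
    by (rule Bochner_Integration.integrable_cong) (simp_all add: eq sp)
  have 3: "(LINT x|lebesgue_on S. u x *\<^sub>R gradient \<phi> x) = (LINT x|lebesgue_on S. w x *\<^sub>R gradient \<phi> x)" for \<phi>
    by (rule Bochner_Integration.integral_cong) (simp_all add: eq sp)
  have 4: "(LINT x|lebesgue_on S. (u x - \<phi> x)\<^sup>2) = (LINT x|lebesgue_on S. (w x - \<phi> x)\<^sup>2)" for \<phi>
    by (rule Bochner_Integration.integral_cong) (simp_all add: eq sp)
  show ?thesis using w unfolding H10_grad_def H1_grad_def L2_on_def 1 2 3 4 .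
qed

section \<open>The weight \<open>V\<close> and the radial equation as a first-order system\<close>

lemma V_eq: "r > 0 \<Longrightarrow> V k r = 1 / (r\<^sup>2 * (1 - ln r) powr (2 + k))"
  by (simp add: V_def ln_div)

lemma V_pos:
  assumes "0 < r" "r \<le> 1"
  shows "V k r > 0"
proof -
  have "1 - ln r > 0" using ln_le_zero_iff[OF assms(1)] assms(2) by linarith
  then show ?thesis using assms by (simp add: V_eq)
qed

text \<open>With the derivative written as \<open>r * g r\<close>, the partial derivatives of
  \<open>f (norm x)\<close> are \<open>g (norm x) * (x \<bullet> b)\<close>: no division by the norm
  remains, and regularity of \<open>f\<close> is reduced to that of \<open>g\<close>.\<close>

lemma C_k_on_radial_Suc:
  fixes f :: "real \<Rightarrow> real"
  assumes f: "\<And>r. 0 < r \<Longrightarrow> r < 1 \<Longrightarrow> (f has_real_derivative r * g r) (at r)"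
    and g: "C_k_on n (ball 0 1 - {0}) (\<lambda>x::'a::euclidean_space. g (norm x))"
  shows "C_k_on (Suc n) (ball 0 1 - {0}) (\<lambda>x::'a. f (norm x))"
proof -
  let ?S = "ball 0 1 - {0} :: 'a set"
  have op: "open ?S" by auto
  have d: "((\<lambda>x. f (norm x)) has_derivative (\<lambda>h. g (norm x) * (x \<bullet> h))) (at x)" if "x \<in> ?S" for x
    using has_derivative_radial[of x f "norm x * g (norm x)"] f[of "norm x"] that by simp
  have "C_k_on n ?S (partial b (\<lambda>x. f (norm x)))" if "b \<in> Basis" for b
  proof -
    have "C_k_on n ?S (\<lambda>x. g (norm x) * (x \<bullet> b))"
      by (intro C_k_on_mult[OF op] g C_k_on_inner)
    moreover have "partial b (\<lambda>x. f (norm x)) x = g (norm x) * (x \<bullet> b)" if "x \<in> ?S" for x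
      by (rule partial_eqI[OF d[OF that]])
    ultimately show ?thesis by (subst C_k_on_cong[OF op])
  qed
  moreover have "(\<lambda>x. f (norm x)) differentiable (at x)" if "x \<in> ?S" for x
    using d[OF that] unfolding differentiable_def by blast
  ultimately show ?thesis by simp
qed

text \<open>A ball around the origin, the punctured unit ball and the exterior of the ball of radius
  \<open>rho\<close> cover the space. Regularity on the punctured ball thus needs to be supplemented
  only near the origin and near the unit sphere.\<close>

lemma C_k_glue:
  fixes f :: "'a::euclidean_space \<Rightarrow> real"
  assumes e: "e > 0" "\<And>x. norm x < e \<Longrightarrow> f x = c"
    and S: "C_k_on n (ball 0 1 - {0}) f"
    and rho: "rho < 1" "\<And>x. norm x > rho \<Longrightarrow> f x = 0"
  shows "C_k n f"
  unfolding C_k_on_UNIV[symmetric]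
proof (rule C_k_on_local)
  fix x :: 'a
  consider "norm x < e" | "norm x > rho" | "x \<in> ball 0 1 - {0}"
    using e rho(1) by (cases "x = 0"; cases "norm x < 1") auto
  then show "\<exists>U. open U \<and> x \<in> U \<and> C_k_on n U f"
  proof cases
    case 1
    have "C_k_on n (ball 0 e) f \<longleftrightarrow> C_k_on n (ball 0 e :: 'a set) (\<lambda>x. c)"
      by (rule C_k_on_cong) (use e in auto)
    then show ?thesis using 1 by (intro exI[of _ "ball 0 e"]) auto
  next
    case 2
    have op: "open {y::'a. norm y > rho}" by (intro open_Collect_less continuous_intros)
    have "C_k_on n {y::'a. norm y > rho} f \<longleftrightarrow> C_k_on n {y::'a. norm y > rho} (\<lambda>x. 0)"
      by (rule C_k_on_cong[OF op]) (use rho in auto)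
    then show ?thesis using 2 op by (intro exI[of _ "{y. norm y > rho}"]) auto
  next
    case 3
    then show ?thesis using S by (intro exI[of _ "ball 0 1 - {0}"]) auto
  qed
qed

text \<open>\<open>A\<close> is the flux \<open>- r v'\<close>. The equations are demanded for
  \<open>0 < r < 1\<close> only; the regularity at the origin and at the boundary is just continuity
  of \<open>v\<close>, and the behaviour of \<open>A\<close> at the origin has to be
  derived.\<close>

locale radial_profile =
  fixes k lam :: real and v A :: "real \<Rightarrow> real"
  assumes k_pos: "k > 0" and lam_pos: "lam > 0"
    and v_cont: "continuous_on {0..1} v" and v_1: "v 1 = 0"
    and v_pos: "\<And>r. 0 \<le> r \<Longrightarrow> r < 1 \<Longrightarrow> v r > 0"
    and v_DERIV: "\<And>r. 0 < r \<Longrightarrow> r < 1 \<Longrightarrow> (v has_real_derivative - A r / r) (at r)"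
    and A_DERIV: "\<And>r. 0 < r \<Longrightarrow> r < 1 \<Longrightarrow> (A has_real_derivative lam * r * V k r * exp (v r)) (at r)"
begin

lemma A_less: "0 < r \<Longrightarrow> r < s \<Longrightarrow> s < 1 \<Longrightarrow> A r < A s"
proof (rule DERIV_pos_imp_increasing[of r s A])
  fix x assume "0 < r" "r < s" "s < 1" "r \<le> x" "x \<le> s"
  then show "\<exists>y. (A has_real_derivative y) (at x) \<and> y > 0"
    using A_DERIV[of x] V_pos[of x k] lam_pos by (intro exI[of _ "lam * x * V k x * exp (v x)"]) auto
qed

text \<open>The logarithm is the fundamental solution in the plane: a nonzero limit of \<open>A\<close> at the origin
  would make \<open>v\<close> unbounded.\<close>

lemma A_nonneg:
  assumes r: "0 < r" "r < 1"
  shows "A r \<ge> 0"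
proof (rule ccontr)
  assume neg: "\<not> A r \<ge> 0"
  define c where "c = - A r"
  have c: "c > 0" using neg by (simp add: c_def)
  \<comment> \<open>Chosen so that \<open>c * (ln s - ln r) = - v r - c\<close>; the monotonicity of
    \<open>v x - c * ln x\<close> then pushes \<open>v s\<close> down to \<open>- c\<close>.\<close>
  define s where "s = r * exp (- v r / c - 1)"
  have vr: "v r > 0" using v_pos r by simp
  have "v r / c > 0" using vr c by simp
  then have s: "0 < s" "s \<le> r" using r by (auto simp: s_def mult_le_cancel_left1)
  have "v s - c * ln s \<le> v r - c * ln r"
  proof (rule DERIV_nonneg_imp_nondecreasing[OF s(2), of "\<lambda>x. v x - c * ln x"])
    fix x assume x: "s \<le> x" "x \<le> r"
    have "((\<lambda>x. v x - c * ln x) has_real_derivative (- A x - c) / x) (at x)"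
      using x s r by (auto intro!: derivative_eq_intros v_DERIV simp: diff_divide_distrib)
    moreover have "A x \<le> A r" using A_less[of x r] x s r by (cases "x = r") auto
    then have "(- A x - c) / x \<ge> 0" using x s by (simp add: c_def)
    ultimately show "\<exists>y. ((\<lambda>x. v x - c * ln x) has_real_derivative y) (at x) \<and> y \<ge> 0" by blast
  qed
  moreover have "ln s = ln r + (- v r / c - 1)" using r by (simp add: s_def ln_mult)
  ultimately have "v s \<le> - c" using c by (simp add: algebra_simps)
  then show False using v_pos[of s] s r c by simp
qed

text \<open>If \<open>A\<close> stayed above some \<open>e > 0\<close>, then
  \<open>v + e * ln r\<close> would be nonincreasing in \<open>r\<close>, and \<open>v\<close> would
  grow like \<open>- e * ln r\<close> at the origin, against its boundedness. So \<open>A\<close>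
  takes values below \<open>e\<close>, and monotonicity turns one such value into a limit.\<close>

lemma A_tendsto: "(A \<longlongrightarrow> 0) (at_right 0)"
proof (rule tendstoI)
  fix e :: real assume e: "e > 0"
  have "\<exists>r. 0 < r \<and> r < 1 \<and> A r < e"
  proof (rule ccontr)
    assume "\<not> ?thesis"
    then have ge: "A r \<ge> e" if "0 < r" "r < 1" for r using that by force
    have "compact (v ` {0..1})" using v_cont by (intro compact_continuous_image) auto
    then have "bdd_above (v ` {0..1})" by (intro bounded_imp_bdd_above compact_imp_bounded)
    then obtain B where B: "\<forall>r\<in>{0..1}. v r \<le> B" unfolding bdd_above_def by blast
    \<comment> \<open>Chosen so that \<open>e * (ln (1 / 2) - ln s) = \<bar>B\<bar> + 1\<close>,
      which lifts \<open>v s\<close> above the bound \<open>B\<close>.\<close>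
    define s where "s = exp (- (\<bar>B\<bar> + 1) / e) / 2"
    have "exp (- (\<bar>B\<bar> + 1) / e) \<le> 1" using e by (simp add: divide_nonpos_pos)
    then have s: "0 < s" "s \<le> 1 / 2" by (auto simp: s_def)
    have "v s + e * ln s \<ge> v (1 / 2) + e * ln (1 / 2)"
    proof (rule DERIV_nonpos_imp_nonincreasing[OF s(2), of "\<lambda>x. v x + e * ln x"])
      fix x assume x: "s \<le> x" "x \<le> 1 / 2"
      have "((\<lambda>x. v x + e * ln x) has_real_derivative (- A x + e) / x) (at x)"
        using x s by (auto intro!: derivative_eq_intros v_DERIV simp: add_divide_distrib diff_divide_distrib)
      moreover have "(- A x + e) / x \<le> 0" using ge[of x] x s by (simp add: divide_nonpos_pos)
      ultimately show "\<exists>y. ((\<lambda>x. v x + e * ln x) has_real_derivative y) (at x) \<and> y \<le> 0" by blast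
    qed
    moreover have "ln s = - (\<bar>B\<bar> + 1) / e + ln (1 / 2)" by (simp add: s_def ln_div)
    then have "e * ln s = - (\<bar>B\<bar> + 1) + e * ln (1 / 2)" using e by (simp only: distrib_left) simp
    ultimately have "v s \<ge> v (1 / 2) + (\<bar>B\<bar> + 1)" by linarith
    then show False using B[THEN bspec, of s] v_pos[of "1 / 2"] s by auto
  qed
  then obtain r0 where r0: "0 < r0" "r0 < 1" "A r0 < e" by blast
  show "\<forall>\<^sub>F r in at_right 0. dist (A r) 0 < e"
    unfolding eventually_at_right_field
  proof (intro exI[of _ r0] conjI allI impI r0)
    fix r assume "0 < r" "r < r0"
    then show "dist (A r) 0 < e" using A_nonneg[of r] A_less[of r r0] r0 by simp
  qed
qed

lemma A_pos: "0 < r \<Longrightarrow> r < 1 \<Longrightarrow> A r > 0"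
  using A_nonneg[of "r / 2"] A_less[of "r / 2" r] by simp

lemma v_less:
  assumes "0 \<le> r" "r < s" "s \<le> 1"
  shows "v s < v r"
proof (rule DERIV_neg_imp_decreasing_open[OF assms(2)])
  fix x assume "r < x" "x < s"
  then show "\<exists>y. (v has_real_derivative y) (at x) \<and> y < 0"
    using v_DERIV[of x] A_pos[of x] assms by (intro exI[of _ "- A x / x"]) auto
qed (use assms in \<open>auto intro: continuous_on_subset[OF v_cont]\<close>)

lemma v_bounds: "0 \<le> r \<Longrightarrow> r \<le> 1 \<Longrightarrow> 0 \<le> v r \<and> v r \<le> v 0"
  using v_less[of 0 r] v_less[of r 1] v_1 by (cases "r = 0"; cases "r = 1") auto

text \<open>The functions \<open>q\<close>, \<open>p\<close>, \<open>v\<close>, \<open>A\<close>,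
  \<open>w\<close> are closed under passing from \<open>f\<close> to \<open>f' / r\<close>, each
  result being a polynomial in them. By \<open>C_k_on_radial_Suc\<close> all five gain regularity in
  one simultaneous induction.\<close>

lemma C_k_on_profile:
  "C_k_on n (ball 0 1 - {0}) (\<lambda>x::'a::euclidean_space. 1 / (norm x)\<^sup>2)"
  "C_k_on n (ball 0 1 - {0}) (\<lambda>x::'a. v (norm x))"
  "C_k_on n (ball 0 1 - {0}) (\<lambda>x::'a. A (norm x))"
  "C_k_on n (ball 0 1 - {0}) (\<lambda>x::'a. V k (norm x) * exp (v (norm x)))"
proof -
  let ?S = "ball 0 1 - {0} :: 'a set"
  have op: "open ?S" by auto
  define q where "q r = 1 / r\<^sup>2" for r :: real
  define p where "p r = 1 / (1 - ln r)" for r :: real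
  define w where "w r = exp (v r) * (1 - ln r) powr (- (2 + k))" for r
  have t: "1 - ln r > 0" if "0 < r" "r < 1" for r :: real 
    using ln_less_zero[OF that] by simp
  have Vw: "V k r * exp (v r) = q r * w r" if "0 < r" "r < 1" for r
    using that by (simp add: V_eq[OF that(1)] q_def w_def powr_minus_divide[of _ "2 + k"] del: minus_add_distrib)
  have dq: "(q has_real_derivative r * (- 2 * q r * q r)) (at r)" if "0 < r" "r < 1" for r
    unfolding q_def using that by (auto intro!: derivative_eq_intros simp: power2_eq_square field_simps)
  have dp: "(p has_real_derivative r * (p r * p r * q r)) (at r)" if "0 < r" "r < 1" for r
    unfolding p_def q_def using that t[OF that]
    by (auto intro!: derivative_eq_intros simp: power2_eq_square)
  \<comment> \<open>The factor \<open>- 1\<close> is spelled out so that the right-hand side is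
    visibly a product of constants and functions of the list.\<close>
  have dv: "(v has_real_derivative r * (- 1 * A r * q r)) (at r)" if "0 < r" "r < 1" for r
    using v_DERIV[OF that] that by (simp add: q_def power2_eq_square)
  have dA: "(A has_real_derivative r * (lam * q r * w r)) (at r)" if "0 < r" "r < 1" for r
    using A_DERIV[OF that] Vw[OF that] by (simp add: mult_ac)
  have dw: "(w has_real_derivative r * (w r * (- 1 * A r * q r) + (2 + k) * w r * (p r * q r))) (at r)"
    if r: "0 < r" "r < 1" for r
  proof -
    have dpow: "((\<lambda>r. (1 - ln r) powr (- (2 + k))) has_real_derivative
        (2 + k) * (1 - ln r) powr (- (2 + k)) * p r * (r * q r)) (at r)"
    proof -
      have D: "((\<lambda>r. (1 - ln r) powr (- (2 + k))) has_real_derivative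
          - (2 + k) * (1 - ln r) powr (- (2 + k) - 1) * (- 1 / r)) (at r)"
        using r t[OF r] 
        by (intro DERIV_cong[OF DERIV_fun_powr[of "\<lambda>r. 1 - ln r" "- 1 / r"]]) (auto intro!: derivative_eq_intros)
      have eq: "(1 - ln r) powr (- (2 + k) - 1) = (1 - ln r) powr (- (2 + k)) * p r"
        using powr_diff[of "1 - ln r" "- (2 + k)" 1] t[OF r] by (simp add: p_def del: minus_add_distrib)
      show ?thesis
        by (rule DERIV_cong[OF D], unfold eq) (use r in \<open>simp add: q_def power2_eq_square field_simps\<close>)
    qed
    have dexp: "((\<lambda>r. exp (v r)) has_real_derivative exp (v r) * (r * (- 1 * A r * q r))) (at r)"
      by (auto intro!: derivative_eq_intros dv[OF r])
    show ?thesis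
      unfolding w_def[abs_def] by (rule DERIV_cong[OF DERIV_mult[OF dexp dpow]]) (simp add: algebra_simps)
  qed
  have cont: "continuous_on ?S (\<lambda>x. f (norm x))" if der: "\<And>r. 0 < r \<Longrightarrow> r < 1 \<Longrightarrow> \<exists>D. (f has_real_derivative D) (at r)"
    for f :: "real \<Rightarrow> real"
  proof -
    have "continuous_on {0<..<1} f"
    proof (intro continuous_at_imp_continuous_on ballI)
      fix r :: real assume "r \<in> {0<..<1}"
      then obtain D where "(f has_real_derivative D) (at r)" using der[of r] by auto
      then show "isCont f r" by (rule DERIV_isCont)
    qed
    then show ?thesis by (rule continuous_on_compose2) (auto intro!: continuous_intros)
  qed
  have "C_k_on n ?S (\<lambda>x. q (norm x)) \<and> C_k_on n ?S (\<lambda>x. p (norm x)) \<and> C_k_on n ?S (\<lambda>x. v (norm x)) \<and>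
        C_k_on n ?S (\<lambda>x. A (norm x)) \<and> C_k_on n ?S (\<lambda>x. w (norm x))"
  proof (induction n)
    case 0
    show ?case unfolding C_k_on.simps
      by (intro conjI cont) (use dq dp dv dA dw in blast)+
  next
    case (Suc n)
    note I = Suc.IH[THEN conjunct1] Suc.IH[THEN conjunct2, THEN conjunct1]
      Suc.IH[THEN conjunct2, THEN conjunct2, THEN conjunct1]
      Suc.IH[THEN conjunct2, THEN conjunct2, THEN conjunct2, THEN conjunct1]
      Suc.IH[THEN conjunct2, THEN conjunct2, THEN conjunct2, THEN conjunct2]
    show ?case
      by (intro conjI C_k_on_radial_Suc[OF dq] C_k_on_radial_Suc[OF dp] C_k_on_radial_Suc[OF dv]
          C_k_on_radial_Suc[OF dA] C_k_on_radial_Suc[OF dw] C_k_on_mult[OF op] C_k_on_add[OF op] C_k_on_const I)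
  qed
  note C = this
  then show "C_k_on n ?S (\<lambda>x. 1 / (norm x)\<^sup>2)" "C_k_on n ?S (\<lambda>x. v (norm x))" "C_k_on n ?S (\<lambda>x. A (norm x))"
    by (simp_all add: q_def)
  have "C_k_on n ?S (\<lambda>x. q (norm x) * w (norm x))" using C by (intro C_k_on_mult[OF op]) auto
  moreover have "V k (norm x) * exp (v (norm x)) = q (norm x) * w (norm x)" if "x \<in> ?S" for x
    using Vw[of "norm x"] that by auto
  ultimately show "C_k_on n ?S (\<lambda>x. V k (norm x) * exp (v (norm x)))"
    by (subst C_k_on_cong[OF op])
qed

section \<open>Flux identity away from the origin\<close>

definition W :: "real ^ 2 \<Rightarrow> real" where
  "W x = V k (norm x) * exp (v (norm x))"

text \<open>The gradient of \<open>v (norm x)\<close> off the origin, by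
  \<open>v' = - A / r\<close>; at the origin the value is \<open>0\<close>.\<close>

definition grad_v :: "real ^ 2 \<Rightarrow> real ^ 2" where
  "grad_v x = - (A (norm x) / (norm x)\<^sup>2) *\<^sub>R x"

lemma A_small:
  assumes "d > 0"
  obtains e where "0 < e" "e < 1" "\<And>r. 0 < r \<Longrightarrow> r < e \<Longrightarrow> A r < d"
proof -
  have "\<forall>\<^sub>F r in at_right 0. A r < d" using order_tendstoD(2)[OF A_tendsto assms] .
  then obtain b where b: "b > 0" "\<And>r. 0 < r \<Longrightarrow> r < b \<Longrightarrow> A r < d"
    unfolding eventually_at_right_field by auto
  show thesis by (rule that[of "min b (1 / 2)"]) (use b in auto)
qed

lemma W_nonneg: "x \<in> B1 \<Longrightarrow> W x \<ge> 0"
  using V_pos[of "norm x" k] by (cases "x = 0") (auto simp: W_def V_def)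

lemma C_k_on_W: "C_k_on n (B1 - {0}) W"
  using C_k_on_profile(4)[of n] by (simp add: W_def[abs_def])

text \<open>The divergence theorem for the field \<open>- soft_trunc d A x / |x|^2\<close>, which vanishes near the
  origin; since \<open>x / |x|^2\<close> is divergence free in the plane, its divergence is
  \<open>- soft_trunc_deriv d A\<close> times \<open>lam W\<close>.\<close>

lemma
  assumes d: "d > 0" and \<psi>: "C_k 1 \<psi>" and rho: "rho < 1" "\<And>x::real^2. norm x > rho \<Longrightarrow> \<psi> x = 0"
  shows flux_integrable:
    "integrable (lebesgue_on B1) (\<lambda>x. soft_trunc_deriv d (A (norm x)) * (lam * W x) * \<psi> x)"
    "integrable (lebesgue_on B1) (\<lambda>x. soft_trunc d (A (norm x)) / (norm x)\<^sup>2 * (x \<bullet> gradient \<psi> x))"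
  and flux_identity:
    "(LINT x|lebesgue_on B1. soft_trunc_deriv d (A (norm x)) * (lam * W x) * \<psi> x) =
     - (LINT x|lebesgue_on B1. soft_trunc d (A (norm x)) / (norm x)\<^sup>2 * (x \<bullet> gradient \<psi> x))"
proof -
  let ?S = "B1 - {0}"
  note op = open_punctured
  obtain e where e: "0 < e" "\<And>r. 0 < r \<Longrightarrow> r < e \<Longrightarrow> A r < d"
    using A_small[OF d] by blast
  have near0: "soft_trunc d (A (norm x)) = 0 \<and> soft_trunc_deriv d (A (norm x)) = 0" 
    if "norm x < e" "x \<noteq> 0" for x :: "real^2"
    using soft_trunc_zero[OF d, of "A (norm x)"] e(2)[of "norm x"] that by simp
  have \<psi>S: "C_k_on 1 ?S \<psi>" using \<psi> C_k_on_subset[of 1 UNIV \<psi> ?S] by (simp add: C_k_on_UNIV)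
  have grad\<psi>: "gradient \<psi> x = 0" if "norm x > rho" for x
    using gradient_outside[of rho \<psi> x] rho(2) that by blast
  define f1 where "f1 x = soft_trunc_deriv d (A (norm x)) * (lam * W x) * \<psi> x" for x
  define f2 where "f2 x = soft_trunc d (A (norm x)) / (norm x)\<^sup>2 * (x \<bullet> gradient \<psi> x)" for x
  define p where "p r = soft_trunc d (A r) * (1 / r\<^sup>2)" for r
  define h where "h b x = p (norm x) * (x \<bullet> b) * \<psi> x" for b x
  have Cp: "C_k_on n ?S (\<lambda>x. p (norm x))" for n
    unfolding p_def by (intro C_k_on_mult[OF op] C_k_on_soft_trunc[OF op] C_k_on_profile)
  have Ch: "C_k 1 (h b)" for b
  proof (rule C_k_glue[OF e(1)])
    show "h b x = 0" if "norm x < e" for x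
      using near0[OF that] by (cases "x = 0") (auto simp: h_def p_def)
    show "C_k_on 1 ?S (h b)"
      unfolding h_def[abs_def] by (intro C_k_on_mult[OF op] Cp C_k_on_inner \<psi>S)
  qed (use rho in \<open>auto simp: h_def\<close>)
  define p' where "p' r = soft_trunc_deriv d (A r) * (lam * r * V k r * exp (v r)) / r\<^sup>2 - 2 * p r / r" for r
  have dp: "(p has_real_derivative p' r) (at r)" if r: "0 < r" "r < 1" for r
  proof -
    have "((\<lambda>r. 1 / r\<^sup>2) has_real_derivative - 2 / r ^ 3) (at r)"
      using r by (auto intro!: derivative_eq_intros simp: power2_eq_square power3_eq_cube)
    from DERIV_mult[OF DERIV_chain2[OF soft_trunc_DERIV[OF d] A_DERIV[OF r]] this]
    show ?thesis
      unfolding p_def[abs_def] by (rule DERIV_cong) (use r in \<open>simp add: p'_def p_def power2_eq_square power3_eq_cube field_simps\<close>)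
  qed
  \<comment> \<open>The dimension enters here: the \<open>2\<close> that comes from the divergence
    of \<open>x\<close> in the plane cancels the derivative of \<open>1 / r\<^sup>2\<close>.\<close>
  have p': "p' r * r + 2 * p r = soft_trunc_deriv d (A r) * (lam * (V k r * exp (v r)))" if "r > 0" for r
    using that by (simp add: p'_def power2_eq_square field_simps)
  have h_partial: "partial b (h b) x = p' (norm x) / norm x * \<psi> x * (x \<bullet> b)\<^sup>2 + p (norm x) * \<psi> x +
      p (norm x) * ((x \<bullet> b) * partial b \<psi> x)" 
    if x: "x \<in> ?S" and b: "b \<in> Basis" for b x
  proof -
    have d1: "((\<lambda>x. p (norm x)) has_derivative (\<lambda>h. p' (norm x) / norm x * (x \<bullet> h))) (at x)"
      using x by (intro has_derivative_radial dp) auto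
    have d2: "((\<lambda>x. x \<bullet> b) has_derivative (\<lambda>h. h \<bullet> b)) (at x)"
      by (auto intro!: derivative_eq_intros)
    have d3: "(\<psi> has_derivative (\<lambda>h. partial h \<psi> x)) (at x)"
      using \<psi> by (intro has_derivative_partial) simp
    show ?thesis
      using partial_eqI[OF has_derivative_mult[OF has_derivative_mult[OF d1 d2] d3], of b] b
      unfolding h_def[abs_def] by (simp add: algebra_simps power2_eq_square)
  qed
  have div: "(\<Sum>b\<in>Basis. partial b (h b) x) = f1 x + f2 x" if x: "x \<in> ?S" for x
  proof -
    have "(\<Sum>b\<in>Basis. partial b (h b) x) = p' (norm x) / norm x * \<psi> x * (\<Sum>b\<in>Basis. (x \<bullet> b)\<^sup>2) +
        (\<Sum>b\<in>(Basis :: (real^2) set). p (norm x) * \<psi> x) + p (norm x) * (\<Sum>b\<in>Basis. (x \<bullet> b) * partial b \<psi> x)"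
      by (simp only: h_partial[OF x] sum.distrib sum_distrib_left cong: sum.cong)
    also have "(\<Sum>b\<in>Basis. (x \<bullet> b)\<^sup>2) = (norm x)\<^sup>2"
      unfolding power2_norm_eq_inner by (subst euclidean_inner) (simp add: power2_eq_square)
    also have "(\<Sum>b\<in>Basis. (x \<bullet> b) * partial b \<psi> x) = x \<bullet> gradient \<psi> x"
      by (simp add: gradient_def inner_sum_right mult.commute)
    also have "p' (norm x) / norm x * \<psi> x * (norm x)\<^sup>2 + (\<Sum>b\<in>(Basis :: (real^2) set). p (norm x) * \<psi> x) =
        (p' (norm x) * norm x + 2 * p (norm x)) * \<psi> x"
      using x by (simp add: power2_eq_square algebra_simps)
    finally show ?thesis
      using p'[of "norm x"] x by (simp add: f1_def f2_def W_def p_def)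
  qed
  have norm0: "f1 0 = 0" "f2 0 = 0" by (simp_all add: f1_def f2_def W_def V_def)
  have cont_chid: "continuous_on UNIV (soft_trunc_deriv d)"
    unfolding soft_trunc_deriv_def[abs_def] using d
    by (intro continuous_intros continuous_on_compose2[OF continuous_on_flat[of UNIV]]) auto
  have CA: "continuous_on ?S (\<lambda>x. A (norm x))" using C_k_on_profile(3)[of 0] by simp
  have Cf1: "continuous_on UNIV f1"
    unfolding C_k.simps(1)[symmetric]
  proof (rule C_k_glue[OF e(1)])
    show "f1 x = 0" if "norm x < e" for x
      using near0[OF that] norm0 by (cases "x = 0") (auto simp: f1_def)
    show "C_k_on 0 ?S f1"
      unfolding f1_def[abs_def]
      using C_k_on_W[of 0] C_k_on_SucD[of 0 ?S \<psi>] \<psi>S 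
      by (auto intro!: continuous_intros continuous_on_compose2[OF cont_chid CA])
  qed (use rho in \<open>auto simp: f1_def\<close>)
  have Cf2: "continuous_on UNIV f2"
    unfolding C_k.simps(1)[symmetric]
  proof (rule C_k_glue[OF e(1)])
    show "f2 x = 0" if "norm x < e" for x
      using near0[OF that] norm0 by (cases "x = 0") (auto simp: f2_def)
    have "continuous_on ?S (\<lambda>x. p (norm x) * (x \<bullet> gradient \<psi> x))"
      using Cp[of 0] continuous_on_subset[OF continuous_on_gradient[OF \<psi>], of ?S]
      by (intro continuous_on_mult continuous_on_inner continuous_on_id) auto
    then show "C_k_on 0 ?S f2"
      by (simp add: f2_def[abs_def] p_def)
  qed (use rho grad\<psi> in \<open>auto simp: f2_def\<close>)
  have supp: "f1 x = 0" "f2 x = 0" if "norm x > rho" for x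
    using that rho(2) grad\<psi> by (auto simp: f1_def f2_def)
  have intf: "integrable lborel f1" "integrable lborel f2"
    by (rule continuous_compact_support_integrable[OF Cf1 supp(1)] continuous_compact_support_integrable[OF Cf2 supp(2)]; assumption)+
  have meas: "f1 \<in> borel_measurable borel" "f2 \<in> borel_measurable borel"
    using Cf1 Cf2 by (auto intro: borel_measurable_continuous_onI)
  have supp': "f1 x = 0" "f2 x = 0" if "x \<notin> B1" for x
    using that rho(1) supp[of x] by auto
  have outside: "partial b (h b) x = 0" if "norm x > rho" for b x
  proof -
    have "open {y::real^2. norm y > rho}" by (intro open_Collect_less continuous_intros)
    then have "partial b (h b) x = partial b (\<lambda>x. 0) x"
      by (rule partial_cong_open) (use that rho(2) in \<open>auto simp: h_def\<close>)
    then show ?thesis using partial_eqI[OF has_derivative_const] by simp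
  qed
  have inth: "integrable lborel (partial b (h b))" if "b \<in> Basis" for b
    by (rule continuous_compact_support_integrable[OF _ outside]) (use Ch[of b] that in auto)
  have "0 = (\<Sum>b\<in>Basis. integral\<^sup>L lborel (partial b (h b)))"
    by (subst sum.neutral) (auto intro!: integral_partial_eq_0[OF Ch, of rho] simp: h_def rho(2))
  also have "\<dots> = (\<integral>x. (\<Sum>b\<in>Basis. partial b (h b) x) \<partial>lborel)"
    using inth by (intro Bochner_Integration.integral_sum[symmetric])
  also have "\<dots> = (\<integral>x. f1 x + f2 x \<partial>lborel)"
  proof (rule integral_cong_AE)
    show "AE x in lborel. (\<Sum>b\<in>Basis. partial b (h b) x) = f1 x + f2 x"
      using AE_lborel_singleton[of 0]
    proof eventually_elim
      case (elim x)
      show ?case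
      proof (cases "norm x > rho")
        case True
        then show ?thesis using outside supp by simp
      next
        case False
        then show ?thesis using rho(1) elim by (intro div) auto
      qed
    qed
  qed (use inth intf in auto)
  also have "\<dots> = integral\<^sup>L lborel f1 + integral\<^sup>L lborel f2"
    using intf by (rule Bochner_Integration.integral_add)
  finally have "integral\<^sup>L lborel f1 = - integral\<^sup>L lborel f2" by simp
  then have "integral\<^sup>L (lebesgue_on B1) f1 = - integral\<^sup>L (lebesgue_on B1) f2"
    using integral_lebesgue_on_support[OF open_ball[of 0 1] meas(1) supp'(1)] 
      integral_lebesgue_on_support[OF open_ball[of 0 1] meas(2) supp'(2)] by simp
  moreover have "integrable (lebesgue_on B1) f1" "integrable (lebesgue_on B1) f2"
    using intf integrable_lebesgue_on_support[OF open_ball[of 0 1] meas(1) supp'(1)]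
      integrable_lebesgue_on_support[OF open_ball[of 0 1] meas(2) supp'(2)] by simp_all
  ultimately show
    "integrable (lebesgue_on B1) (\<lambda>x. soft_trunc_deriv d (A (norm x)) * (lam * W x) * \<psi> x)"
    "integrable (lebesgue_on B1) (\<lambda>x. soft_trunc d (A (norm x)) / (norm x)\<^sup>2 * (x \<bullet> gradient \<psi> x))"
    "(LINT x|lebesgue_on B1. soft_trunc_deriv d (A (norm x)) * (lam * W x) * \<psi> x) =
     - (LINT x|lebesgue_on B1. soft_trunc d (A (norm x)) / (norm x)\<^sup>2 * (x \<bullet> gradient \<psi> x))"
    by (simp_all add: f1_def[abs_def] f2_def[abs_def])
qed

text \<open>The inner truncation acts on \<open>v 0 - v\<close> and makes the function constant near
  the origin; the outer one removes small values and with them a neighbourhood of the boundary. The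
  outer level is \<open>2 * d\<close> because the inner truncation lifts the boundary value above
  \<open>0\<close>, by less than \<open>2 * d\<close> when \<open>2 * d < v 0\<close>.\<close>

definition cutoff :: "real \<Rightarrow> real ^ 2 \<Rightarrow> real" where
  "cutoff d x = (if x \<in> B1 then soft_trunc (2 * d) (v 0 - soft_trunc d (v 0 - v (norm x))) else 0)"

text \<open>The chain rule factor between the gradients of \<open>cutoff d\<close> and of
  \<open>v\<close>; the two minus signs have cancelled.\<close>

definition gain :: "real \<Rightarrow> real ^ 2 \<Rightarrow> real" where
  "gain d x = soft_trunc_deriv (2 * d) (v 0 - soft_trunc d (v 0 - v (norm x))) *
     soft_trunc_deriv d (v 0 - v (norm x))"

lemma v0_pos: "v 0 > 0"
  using v_pos by simp

lemma v_norm_bounds: "x \<in> cball 0 1 \<Longrightarrow> 0 \<le> v (norm x) \<and> v (norm x) \<le> v 0"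
  using v_bounds by simp

lemma gain_bounds:
  assumes "d > 0"
  shows "0 \<le> gain d x" "gain d x \<le> 4"
proof -
  show "0 \<le> gain d x"
    unfolding gain_def using assms by (intro mult_nonneg_nonneg soft_trunc_deriv_bounds) auto
  have "gain d x \<le> 2 * 2"
    unfolding gain_def using assms by (intro mult_mono soft_trunc_deriv_bounds) auto
  then show "gain d x \<le> 4" by simp
qed

lemma cutoff_bounds:
  assumes d: "d > 0"
  shows "0 \<le> cutoff d x" "cutoff d x \<le> v 0"
proof -
  have "0 \<le> cutoff d x \<and> cutoff d x \<le> v 0"
  proof (cases "x \<in> B1")
    case True
    then have v: "0 \<le> v (norm x)" "v (norm x) \<le> v 0" using v_norm_bounds[of x] by auto
    have s: "0 \<le> soft_trunc d (v 0 - v (norm x))" "soft_trunc d (v 0 - v (norm x)) \<le> v 0 - v (norm x)"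
      using soft_trunc_bounds[OF d, of "v 0 - v (norm x)"] v by auto
    have "0 \<le> v 0 - soft_trunc d (v 0 - v (norm x))" using s v by simp
    from soft_trunc_bounds[OF _ this, of "2 * d"] show ?thesis
      using True d s by (simp add: cutoff_def)
  qed (use v0_pos in \<open>simp add: cutoff_def\<close>)
  then show "0 \<le> cutoff d x" "cutoff d x \<le> v 0" by auto
qed

lemma cutoff_structure:
  assumes d: "0 < d" "2 * d < v 0"
  obtains e rho where "0 < e" "\<And>x. norm x < e \<Longrightarrow> cutoff d x = soft_trunc (2 * d) (v 0)"
    "rho < 1" "\<And>x. norm x > rho \<Longrightarrow> cutoff d x = 0"
proof -
  obtain e where e: "e > 0" "\<And>r. r \<in> {0..1} \<Longrightarrow> dist r 0 < e \<Longrightarrow> dist (v r) (v 0) < d"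
    using v_cont d(1) unfolding continuous_on_iff by (metis atLeastAtMost_iff order_refl zero_le_one)
  have near0: "cutoff d x = soft_trunc (2 * d) (v 0)" if "norm x < min e 1" for x
  proof -
    have "v 0 - v (norm x) \<le> d" using e(2)[of "norm x"] that by (simp add: dist_real_def)
    then show ?thesis using soft_trunc_zero(1)[OF d(1)] that by (simp add: cutoff_def)
  qed
  define s where "s r = v 0 - soft_trunc d (v 0 - v r)" for r
  have s: "continuous_on {0..1} s"
    unfolding s_def
    by (intro continuous_intros v_cont continuous_on_compose2[OF soft_trunc_continuous_on[OF d(1), of UNIV]]) auto
  \<comment> \<open>Here \<open>s 1 = v 0 * (1 - exp (- z))\<close> is at most
    \<open>v 0 * z\<close>, and \<open>2 * d < v 0\<close> makes this smaller than the outer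
    level.\<close>
  have "s 1 < 2 * d"
  proof -
    define z where "z = d / (v 0 - d)"
    have "1 - z \<le> exp (- z)" using exp_ge_add_one_self[of "- z"] by simp
    then have "v 0 * (1 - z) \<le> v 0 * exp (- z)" using v0_pos by simp
    moreover have "soft_trunc d (v 0) = v 0 * exp (- z)"
      using soft_trunc_eq(1)[of d "v 0"] d by (simp add: z_def)
    moreover have "v 0 * z < 2 * d" using d by (simp add: z_def field_simps)
    ultimately show ?thesis by (simp add: s_def v_1 algebra_simps)
  qed
  then obtain a where a: "a > 0" "\<And>r. r \<in> {0..1} \<Longrightarrow> dist r 1 < a \<Longrightarrow> dist (s r) (s 1) < 2 * d - s 1"
    using s unfolding continuous_on_iff by (metis atLeastAtMost_iff order_refl zero_le_one diff_gt_0_iff_gt)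
  have "cutoff d x = 0" if "norm x > 1 - a" for x
  proof (cases "x \<in> B1")
    case True
    then have "s (norm x) \<le> 2 * d" using a(2)[of "norm x"] that by (auto simp: dist_real_def)
    then show ?thesis using soft_trunc_zero(1)[of "2 * d"] d True by (simp add: cutoff_def s_def)
  qed (simp add: cutoff_def)
  then show thesis using near0 e(1) a(1) by (intro that[of "min e 1" "1 - a"]) auto
qed

lemma cutoff_test_function:
  assumes d: "0 < d" "2 * d < v 0"
  shows "test_function B1 (cutoff d)"
proof -
  obtain e rho where *: "0 < e" "\<And>x. norm x < e \<Longrightarrow> cutoff d x = soft_trunc (2 * d) (v 0)"
    "rho < 1" "\<And>x. norm x > rho \<Longrightarrow> cutoff d x = 0"
    using cutoff_structure[OF d] by metis
  have "C_k_on n (B1 - {0}) (\<lambda>x. soft_trunc (2 * d) (v 0 - soft_trunc d (v 0 - v (norm x))))" for n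
    by (intro C_k_on_soft_trunc[OF open_punctured] C_k_on_diff[OF open_punctured] C_k_on_const C_k_on_profile)
  then have "C_k_on n (B1 - {0}) (cutoff d)" for n
    by (rule C_k_on_cong[OF open_punctured, THEN iffD1, rotated]) (simp add: cutoff_def)
  from C_k_glue[OF *(1,2) this *(3,4)] have "C_k n (cutoff d)" for n .
  moreover have sub: "closure {x. cutoff d x \<noteq> 0} \<subseteq> cball 0 rho"
    by (rule closure_minimal) (use *(4) in \<open>auto simp: not_less[symmetric]\<close>)
  moreover have "compact (closure {x. cutoff d x \<noteq> 0})"
    using bounded_subset[OF bounded_cball sub] by (simp add: compact_eq_bounded_closed)
  moreover have "cball 0 rho \<subseteq> B1" using *(3) by auto
  ultimately show ?thesis by (auto simp: test_function_def)
qed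

lemma cutoff_gradient:
  assumes d: "d > 0" and x: "x \<in> B1 - {0}"
  shows "gradient (cutoff d) x = gain d x *\<^sub>R grad_v x"
proof -
  let ?f = "\<lambda>r. soft_trunc (2 * d) (v 0 - soft_trunc d (v 0 - v r))"
  have r: "0 < norm x" "norm x < 1" using x by auto
  have "((\<lambda>r. v 0 - v r) has_real_derivative A (norm x) / norm x) (at (norm x))"
    by (auto intro!: derivative_eq_intros v_DERIV[OF r])
  from DERIV_chain2[OF soft_trunc_DERIV[OF d] this]
  have "((\<lambda>r. v 0 - soft_trunc d (v 0 - v r)) has_real_derivative
      - soft_trunc_deriv d (v 0 - v (norm x)) * (A (norm x) / norm x)) (at (norm x))"
    by (auto intro!: derivative_eq_intros)
  from DERIV_chain2[OF soft_trunc_DERIV[of "2 * d"] this] d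
  have "(?f has_real_derivative - gain d x * (A (norm x) / norm x)) (at (norm x))"
    by (simp add: gain_def mult_ac)
  from has_derivative_radial[OF _ this]
  have "((\<lambda>x. ?f (norm x)) has_derivative (\<lambda>h. (gain d x *\<^sub>R grad_v x) \<bullet> h)) (at x)"
    using x by (simp add: grad_v_def power2_eq_square mult_ac)
  then have "gradient (\<lambda>x. ?f (norm x)) x = gain d x *\<^sub>R grad_v x"
    by (rule gradient_eqI)
  then show ?thesis
    using gradient_cong_open[OF open_punctured x, of "cutoff d" "\<lambda>x. ?f (norm x)"]
    by (simp add: cutoff_def)
qed

text \<open>Truncation levels tending to zero; the shift by \<open>4\<close> ensures
  \<open>2 * dseq n < v 0\<close> from \<open>n = 0\<close> on.\<close>

definition dseq :: "nat \<Rightarrow> real" where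
  "dseq n = v 0 / (real n + 4)"

lemma dseq: "dseq n > 0" "2 * dseq n < v 0" "dseq \<longlonglongrightarrow> 0"
proof -
  show "dseq n > 0" using v0_pos by (simp add: dseq_def)
  have "v 0 * 2 < v 0 * (real n + 4)" using v0_pos by (intro mult_strict_left_mono) auto
  then show "2 * dseq n < v 0" by (simp add: dseq_def field_simps)
  have "(\<lambda>n. v 0 / real (n + 4)) \<longlonglongrightarrow> 0"
    by (rule LIMSEQ_ignore_initial_segment[OF lim_const_over_n])
  then show "dseq \<longlonglongrightarrow> 0" by (simp add: dseq_def[abs_def])
qed

lemma dseq_limits:
  assumes x: "x \<in> B1 - {0}"
  shows "(\<lambda>n. cutoff (dseq n) x) \<longlonglongrightarrow> v (norm x)" "(\<lambda>n. gain (dseq n) x) \<longlonglongrightarrow> 1"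
    "(\<lambda>n. soft_trunc (dseq n) (A (norm x))) \<longlonglongrightarrow> A (norm x)"
    "(\<lambda>n. soft_trunc_deriv (dseq n) (A (norm x))) \<longlonglongrightarrow> 1"
proof -
  have r: "0 < norm x" "norm x < 1" using x by auto
  have d: "dseq \<longlonglongrightarrow> 0" "\<forall>\<^sub>F n in sequentially. dseq n > 0" using dseq by auto
  have d2: "(\<lambda>n. 2 * dseq n) \<longlonglongrightarrow> 0" "\<forall>\<^sub>F n in sequentially. 2 * dseq n > 0"
    using dseq tendsto_mult_right_zero[OF dseq(3), of 2] by auto
  show "(\<lambda>n. soft_trunc (dseq n) (A (norm x))) \<longlonglongrightarrow> A (norm x)"
    "(\<lambda>n. soft_trunc_deriv (dseq n) (A (norm x))) \<longlonglongrightarrow> 1"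
    using soft_trunc_tendsto[OF d tendsto_const A_pos[OF r]] .
  have "v 0 - v (norm x) > 0" using v_less[of 0 "norm x"] r by simp
  note 1 = soft_trunc_tendsto[OF d tendsto_const this]
  have "(\<lambda>n. v 0 - soft_trunc (dseq n) (v 0 - v (norm x))) \<longlonglongrightarrow> v 0 - (v 0 - v (norm x))"
    by (intro tendsto_intros 1)
  then have "(\<lambda>n. v 0 - soft_trunc (dseq n) (v 0 - v (norm x))) \<longlonglongrightarrow> v (norm x)" by simp
  note 2 = soft_trunc_tendsto[OF d2 this v_pos]
  show "(\<lambda>n. cutoff (dseq n) x) \<longlonglongrightarrow> v (norm x)"
    using 2(1) x r by (simp add: cutoff_def)
  show "(\<lambda>n. gain (dseq n) x) \<longlonglongrightarrow> 1"
    using tendsto_mult[OF 2(2) 1(2)] r by (simp add: gain_def)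
qed

section \<open>Integrability near the origin and the limit of the flux identity\<close>

lemma continuous_on_grad_v: "continuous_on (B1 - {0}) grad_v"
proof -
  have "continuous_on (B1 - {0}) (\<lambda>x. - (A (norm x) * (1 / (norm x)\<^sup>2)) *\<^sub>R x)"
    using C_k_on_profile(1)[of 0] C_k_on_profile(3)[of 0]
    by (intro continuous_on_scaleR continuous_on_minus continuous_on_mult continuous_on_id) (simp_all)
  then show ?thesis by (simp add: grad_v_def[abs_def])
qed

lemma measurable_grad_v: "grad_v \<in> borel_measurable (lebesgue_on B1)"
  by (rule continuous_punctured_measurable[OF open_ball continuous_on_grad_v])

lemma measurable_W: "W \<in> borel_measurable (lebesgue_on B1)"
  by (rule continuous_punctured_measurable[OF open_ball]) (use C_k_on_W[of 0] in simp)

lemma measurable_v: "(\<lambda>x. v (norm x)) \<in> borel_measurable (lebesgue_on B1)"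
  by (rule continuous_punctured_measurable[OF open_ball]) (use C_k_on_profile(2)[of 0] in simp)

lemma norm_grad_v: "norm (grad_v x) = \<bar>A (norm x)\<bar> / norm x"
  by (simp add: grad_v_def power2_eq_square)

text \<open>The flux identity is tested with one fixed cutoff \<open>\<psi>\<close>. Near the origin
  it is a positive constant, so its gradient lives on an annulus where the flux is bounded uniformly
  in \<open>n\<close>. Fatou's lemma yields integrability of \<open>W * \<psi>\<close>, and away
  from the origin \<open>W\<close> is bounded.\<close>

lemma integrable_W: "integrable (lebesgue_on B1) W"
proof -
  let ?M = "lebesgue_on B1"
  define \<psi> where "\<psi> = cutoff (dseq 0)"
  define c where "c = soft_trunc (2 * dseq 0) (v 0)"
  obtain e rho where e: "0 < e" "\<And>x. norm x < e \<Longrightarrow> \<psi> x = c"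
    and rho: "rho < 1" "\<And>x. norm x > rho \<Longrightarrow> \<psi> x = 0"
    using cutoff_structure[OF dseq(1,2)[of 0], folded \<psi>_def c_def] by metis
  have c: "c > 0"
    using soft_trunc_eq(1)[of "2 * dseq 0" "v 0"] dseq(1,2)[of 0] v0_pos by (simp add: c_def)
  have \<psi>0: "\<psi> x \<ge> 0" for x unfolding \<psi>_def by (rule cutoff_bounds[OF dseq(1)])
  have \<psi>: "C_k 1 \<psi>" using cutoff_test_function[OF dseq(1,2)] by (simp add: \<psi>_def test_function_def)
  obtain L where L: "L \<ge> 0" "\<And>x. norm (gradient \<psi> x) \<le> L" using gradient_bounded[OF \<psi> rho(2)] by blast
  have grad0: "gradient \<psi> x = 0" if "norm x < e" for x
  proof -
    have "gradient \<psi> x = gradient (\<lambda>x. c) x"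
      by (rule gradient_cong_open[of "ball 0 e"]) (use that e in auto)
    then show ?thesis by simp
  qed
  \<comment> \<open>On the annulus \<open>e \<le> norm x \<le> rho\<close> the flux is at most
    \<open>\<bar>A rho\<bar>\<close> by monotonicity, and \<open>norm x < 1\<close> removes the
    factor \<open>norm x\<close> from the inner product.\<close>
  define B where "B = \<bar>A rho\<bar> / e\<^sup>2 * L"
  have B0: "B \<ge> 0" using L by (simp add: B_def)
  define f2 where "f2 n x = soft_trunc (dseq n) (A (norm x)) / (norm x)\<^sup>2 * (x \<bullet> gradient \<psi> x)" for n x
  have bound: "\<bar>f2 n x\<bar> \<le> B" if x: "x \<in> B1 - {0}" for n x
  proof (cases "e \<le> norm x \<and> norm x \<le> rho")
    case True
    have r: "0 < norm x" "norm x < 1" using x by auto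
    have "A (norm x) \<le> A rho" using A_less[of "norm x" rho] True rho(1) r by (cases "norm x = rho") auto
    then have 1: "0 \<le> soft_trunc (dseq n) (A (norm x))" "soft_trunc (dseq n) (A (norm x)) \<le> \<bar>A rho\<bar>"
      using soft_trunc_bounds[OF dseq(1), of "A (norm x)" n] A_nonneg[OF r] by auto
    have "\<bar>x \<bullet> gradient \<psi> x\<bar> \<le> norm x * norm (gradient \<psi> x)" by (rule Cauchy_Schwarz_ineq2)
    also have "\<dots> \<le> 1 * L" using r L by (intro mult_mono) auto
    finally have 2: "\<bar>x \<bullet> gradient \<psi> x\<bar> \<le> L" by simp
    have "\<bar>f2 n x\<bar> = soft_trunc (dseq n) (A (norm x)) / (norm x)\<^sup>2 * \<bar>x \<bullet> gradient \<psi> x\<bar>"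
      using 1 by (simp add: f2_def abs_mult)
    also have "\<dots> \<le> \<bar>A rho\<bar> / e\<^sup>2 * L"
      using 1 2 True e(1) by (intro mult_mono frac_le power_mono) auto
    finally show ?thesis by (simp add: B_def)
  next
    case False
    then have "gradient \<psi> x = 0" using grad0[of x] gradient_outside[of rho \<psi> x] rho(2) by force
    then show ?thesis using B0 by (simp add: f2_def)
  qed
  have int: "integrable ?M (\<lambda>x. (lam * W x) * \<psi> x)"
  proof (rule integral_Fatou_bound(1))
    show "(\<lambda>x. (lam * W x) * \<psi> x) \<in> borel_measurable ?M"
      using C_1_measurable(1)[OF \<psi>] measurable_W by measurable
    show "integrable ?M (\<lambda>x. soft_trunc_deriv (dseq n) (A (norm x)) * (lam * W x) * \<psi> x)" for n
      by (rule flux_integrable(1)[OF dseq(1) \<psi> rho])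
    show "AE x in ?M. (\<lambda>n. soft_trunc_deriv (dseq n) (A (norm x)) * (lam * W x) * \<psi> x) \<longlonglongrightarrow> (lam * W x) * \<psi> x"
    proof (rule AE_lebesgue_onI[OF open_ball])
      fix x :: "real^2" assume "x \<in> B1" "x \<noteq> 0"
      then have "(\<lambda>n. soft_trunc_deriv (dseq n) (A (norm x)) * (lam * W x) * \<psi> x) \<longlonglongrightarrow> 1 * (lam * W x) * \<psi> x"
        by (intro tendsto_intros dseq_limits) auto
      then show "(\<lambda>n. soft_trunc_deriv (dseq n) (A (norm x)) * (lam * W x) * \<psi> x) \<longlonglongrightarrow> (lam * W x) * \<psi> x"
        by simp
    qed
    show "AE x in ?M. 0 \<le> soft_trunc_deriv (dseq n) (A (norm x)) * (lam * W x) * \<psi> x" for n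
      by (rule AE_lebesgue_onI[OF open_ball])
         (use \<psi>0 W_nonneg lam_pos in \<open>auto intro!: mult_nonneg_nonneg soft_trunc_deriv_bounds dseq\<close>)
    show "(LINT x|?M. soft_trunc_deriv (dseq n) (A (norm x)) * (lam * W x) * \<psi> x) \<le> (LINT x|?M. B)" for n
    proof -
      have "(LINT x|?M. - f2 n x) \<le> (LINT x|?M. B)"
      proof (rule integral_mono_AE)
        show "integrable ?M (\<lambda>x. - f2 n x)"
          unfolding f2_def using flux_integrable(2)[OF dseq(1) \<psi> rho] by simp
        show "integrable ?M (\<lambda>x. B)" using finite_measure.integrable_const[OF finite_measure_B1] .
        show "AE x in ?M. - f2 n x \<le> B"
          by (rule AE_lebesgue_onI[OF open_ball, of _ _ 0]) (use bound in \<open>force simp: abs_le_iff\<close>)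
      qed
      then show ?thesis using flux_identity[OF dseq(1) \<psi> rho, of n] by (simp add: f2_def)
    qed
  qed
  \<comment> \<open>Bounds \<open>W\<close> outside the ball of radius \<open>e\<close>, where
    \<open>V k (norm x) \<le> 1 / e\<^sup>2\<close> because
    \<open>1 - ln (norm x) \<ge> 1\<close>.\<close>
  define K where "K = exp (v 0) / e\<^sup>2"
  have "integrable ?M (\<lambda>x. 1 / (lam * c) * ((lam * W x) * \<psi> x) + K)"
    using int finite_measure.integrable_const[OF finite_measure_B1] by (intro Bochner_Integration.integrable_add integrable_mult_right) auto
  then show ?thesis
  proof (rule Bochner_Integration.integrable_bound[OF _ measurable_W])
    show "AE x in ?M. norm (W x) \<le> norm (1 / (lam * c) * ((lam * W x) * \<psi> x) + K)"
    proof (rule AE_lebesgue_onI[OF open_ball])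
      fix x :: "real^2" assume x: "x \<in> B1" "x \<noteq> 0"
      have pos: "1 / (lam * c) * ((lam * W x) * \<psi> x) \<ge> 0" "K \<ge> 0"
        using c lam_pos \<psi>0 W_nonneg[OF x(1)] by (auto simp: K_def)
      have "W x \<le> 1 / (lam * c) * ((lam * W x) * \<psi> x) + K"
      proof (cases "norm x < e")
        case True
        then show ?thesis using e(2) c lam_pos pos by simp
      next
        case False
        have r: "0 < norm x" "norm x < 1" using x by auto
        have "1 \<le> (1 - ln (norm x)) powr (2 + k)"
          using r k_pos ln_less_zero[OF r] by (intro ge_one_powr_ge_zero) auto
        then have "e\<^sup>2 * 1 \<le> (norm x)\<^sup>2 * (1 - ln (norm x)) powr (2 + k)"
          using False e(1) by (intro mult_mono power_mono) auto
        then have "V k (norm x) \<le> 1 / e\<^sup>2"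
          unfolding V_eq[OF r(1)] using e(1) less_le_trans[OF zero_less_power[OF e(1), of 2]]
          by (intro divide_left_mono mult_pos_pos) auto
        moreover have "exp (v (norm x)) \<le> exp (v 0)" using v_bounds[of "norm x"] r by simp
        ultimately have "W x \<le> 1 / e\<^sup>2 * exp (v 0)"
          unfolding W_def by (intro mult_mono) auto
        then show ?thesis using pos by (simp add: K_def)
      qed
      then show "norm (W x) \<le> norm (1 / (lam * c) * ((lam * W x) * \<psi> x) + K)"
        using W_nonneg[OF x(1)] by simp
    qed
  qed
qed

text \<open>Now the flux identity is tested with the cutoffs of \<open>v\<close> themselves. The
  flux term becomes a nonnegative integrand that converges to
  \<open>(norm (grad_v x))\<^sup>2\<close>, while the other side is at most
  \<open>2 * lam * v 0\<close> times the integral of \<open>W\<close>.\<close>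

lemma integrable_grad_v_sq: "integrable (lebesgue_on B1) (\<lambda>x. (norm (grad_v x))\<^sup>2)"
proof (rule integral_Fatou_bound(1))
  let ?M = "lebesgue_on B1"
  define s where "s n x = - (soft_trunc (dseq n) (A (norm x)) / (norm x)\<^sup>2 * (x \<bullet> gradient (cutoff (dseq n)) x))" for n x
  have s: "s n x = soft_trunc (dseq n) (A (norm x)) * gain (dseq n) x * A (norm x) / (norm x)\<^sup>2"
    if x: "x \<in> B1 - {0}" for n x
    using x by (simp add: s_def cutoff_gradient[OF dseq(1) x] grad_v_def power2_norm_eq_inner)
  have T: "C_k 1 (cutoff (dseq n))" for n
    using cutoff_test_function[OF dseq(1,2)] by (simp add: test_function_def)
  show "(\<lambda>x. (norm (grad_v x))\<^sup>2) \<in> borel_measurable ?M" using measurable_grad_v by measurable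
  have "integrable ?M (s n) \<and> integral\<^sup>L ?M (s n) \<le> (LINT x|?M. 2 * lam * v 0 * W x)" for n
  proof -
    obtain rho where rho: "rho < 1" "\<And>x. norm x > rho \<Longrightarrow> cutoff (dseq n) x = 0"
      using cutoff_structure[OF dseq(1,2)[of n]] by metis
    have "integrable ?M (s n)"
      unfolding s_def using flux_integrable(2)[OF dseq(1) T rho] by simp
    moreover have "integral\<^sup>L ?M (s n) =
        (LINT x|?M. soft_trunc_deriv (dseq n) (A (norm x)) * (lam * W x) * cutoff (dseq n) x)"
      unfolding s_def using flux_identity[OF dseq(1)[of n] T rho] by simp
    moreover have "\<dots> \<le> (LINT x|?M. 2 * lam * v 0 * W x)"
    proof (rule integral_mono_AE[OF flux_integrable(1)[OF dseq(1) T rho]])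
      show "integrable ?M (\<lambda>x. 2 * lam * v 0 * W x)" using integrable_W by simp
      show "AE x in ?M. soft_trunc_deriv (dseq n) (A (norm x)) * (lam * W x) * cutoff (dseq n) x \<le> 2 * lam * v 0 * W x"
      proof (rule AE_lebesgue_onI[OF open_ball])
        fix x :: "real^2" assume "x \<in> B1" 
        then have W: "lam * W x \<ge> 0" using W_nonneg lam_pos by simp
        have "soft_trunc_deriv (dseq n) (A (norm x)) * (lam * W x) * cutoff (dseq n) x \<le> 2 * (lam * W x) * v 0"
          using W by (intro mult_mono[OF mult_right_mono[OF soft_trunc_deriv_bounds(2)[OF dseq(1)] W]
              cutoff_bounds(2)[OF dseq(1)]] cutoff_bounds(1)[OF dseq(1)]) simp
        then show "soft_trunc_deriv (dseq n) (A (norm x)) * (lam * W x) * cutoff (dseq n) x \<le> 2 * lam * v 0 * W x"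
          by (simp add: mult_ac)
      qed
    qed
    ultimately show ?thesis by simp
  qed
  then show "integrable ?M (s n)" "integral\<^sup>L ?M (s n) \<le> (LINT x|?M. 2 * lam * v 0 * W x)" for n
    by auto
  show "AE x in ?M. (\<lambda>n. s n x) \<longlonglongrightarrow> (norm (grad_v x))\<^sup>2"
  proof (rule AE_lebesgue_onI[OF open_ball])
    fix x :: "real^2" assume "x \<in> B1" "x \<noteq> 0"
    then have x: "x \<in> B1 - {0}" by simp
    have "(\<lambda>n. soft_trunc (dseq n) (A (norm x)) * gain (dseq n) x * A (norm x) / (norm x)\<^sup>2) \<longlonglongrightarrow>
        A (norm x) * 1 * A (norm x) / (norm x)\<^sup>2"
      using x by (intro tendsto_intros dseq_limits) auto
    then show "(\<lambda>n. s n x) \<longlonglongrightarrow> (norm (grad_v x))\<^sup>2"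
      by (simp add: s[OF x] norm_grad_v power_divide) (simp add: power2_eq_square)
  qed
  show "AE x in ?M. 0 \<le> s n x" for n
  proof (rule AE_lebesgue_onI[OF open_ball])
    fix x :: "real^2" assume "x \<in> B1" "x \<noteq> 0"
    then have x: "x \<in> B1 - {0}" and r: "0 < norm x" "norm x < 1" by auto
    show "0 \<le> s n x"
      unfolding s[OF x] using A_nonneg[OF r] soft_trunc_bounds(1)[OF dseq(1) A_nonneg[OF r]] gain_bounds(1)[OF dseq(1)]
      by simp
  qed
qed

lemma integrable_norm_grad_v: "integrable (lebesgue_on B1) (\<lambda>x. 1 + (norm (grad_v x))\<^sup>2)"
  by (rule Bochner_Integration.integrable_add[OF finite_measure.integrable_const[OF finite_measure_B1] integrable_grad_v_sq])

text \<open>The limit of the flux identity as \<open>d\<close> tends to zero. With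
  \<open>\<psi>\<close> and its gradient bounded, the integrability of \<open>W\<close> and of the
  squared gradient provides the majorants.\<close>

lemma
  assumes \<psi>: "C_k 1 \<psi>" and rho: "rho < 1" "\<And>x::real^2. norm x > rho \<Longrightarrow> \<psi> x = 0"
  shows integrable_grad_v_gradient: "integrable (lebesgue_on B1) (\<lambda>x. grad_v x \<bullet> gradient \<psi> x)"
    and integrable_W_mult: "integrable (lebesgue_on B1) (\<lambda>x. lam * W x * \<psi> x)"
    and grad_v_identity: "(LINT x|lebesgue_on B1. grad_v x \<bullet> gradient \<psi> x) = (LINT x|lebesgue_on B1. lam * W x * \<psi> x)"
proof -
  let ?M = "lebesgue_on B1"
  note [measurable] = C_1_measurable[OF \<psi>] measurable_W measurable_grad_v
  obtain L where L: "L \<ge> 0" "\<And>x. norm (gradient \<psi> x) \<le> L" using gradient_bounded[OF \<psi> rho(2)] by blast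
  obtain B where B: "B \<ge> 0" "\<And>x. \<bar>\<psi> x\<bar> \<le> B" using C_1_bounded[OF \<psi> rho(2)] by blast
  have gL: "integrable ?M (\<lambda>x. (1 + (norm (grad_v x))\<^sup>2) * L)" using integrable_norm_grad_v by simp
  have le: "norm y * norm (gradient \<psi> x) \<le> (1 + (norm y)\<^sup>2) * L" for x and y :: "real^2"
  proof (rule mult_mono)
    have "0 \<le> (norm y - 1)\<^sup>2" by simp
    then show "norm y \<le> 1 + (norm y)\<^sup>2" by (simp add: power2_diff) (use norm_ge_zero[of y] in linarith)
  qed (use L in auto)
  have WB: "integrable ?M (\<lambda>x. 2 * lam * B * W x)" using integrable_W by simp
  show "integrable ?M (\<lambda>x. grad_v x \<bullet> gradient \<psi> x)"
  proof (rule Bochner_Integration.integrable_bound[OF gL])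
    show "AE x in ?M. norm (grad_v x \<bullet> gradient \<psi> x) \<le> norm ((1 + (norm (grad_v x))\<^sup>2) * L)"
    proof (rule AE_I2)
      fix x
      have "\<bar>grad_v x \<bullet> gradient \<psi> x\<bar> \<le> norm (grad_v x) * norm (gradient \<psi> x)"
        by (rule Cauchy_Schwarz_ineq2)
      also note le
      also have "(1 + (norm (grad_v x))\<^sup>2) * L \<le> norm ((1 + (norm (grad_v x))\<^sup>2) * L)" by simp
      finally show "norm (grad_v x \<bullet> gradient \<psi> x) \<le> norm ((1 + (norm (grad_v x))\<^sup>2) * L)" by simp
    qed
  qed measurable
  have Wle: "\<bar>c * (lam * W x) * \<psi> x\<bar> \<le> 2 * lam * B * W x" if "0 \<le> c" "c \<le> 2" "x \<in> B1" for c x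
  proof -
    have "\<bar>c * (lam * W x) * \<psi> x\<bar> = c * (lam * W x) * \<bar>\<psi> x\<bar>"
      using that W_nonneg lam_pos by (simp add: abs_mult)
    also have "\<dots> \<le> 2 * (lam * W x) * B"
      using that W_nonneg[of x] lam_pos B(1) by (intro mult_mono[OF mult_right_mono[OF that(2)] B(2)]) auto
    finally show ?thesis by (simp add: mult_ac)
  qed
  show "integrable ?M (\<lambda>x. lam * W x * \<psi> x)"
  proof (rule Bochner_Integration.integrable_bound[OF WB])
    show "AE x in ?M. norm (lam * W x * \<psi> x) \<le> norm (2 * lam * B * W x)"
      by (rule AE_lebesgue_onI[OF open_ball]) (use Wle[of 1] W_nonneg lam_pos B in force)
  qed measurable
  have 1: "(\<lambda>n. LINT x|?M. soft_trunc_deriv (dseq n) (A (norm x)) * (lam * W x) * \<psi> x) \<longlonglongrightarrow> (LINT x|?M. lam * W x * \<psi> x)"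
  proof (rule integral_dominated_convergence[OF _ _ WB])
    show "(\<lambda>x. soft_trunc_deriv (dseq n) (A (norm x)) * (lam * W x) * \<psi> x) \<in> borel_measurable ?M" for n
      using flux_integrable(1)[OF dseq(1) \<psi> rho] by (rule borel_measurable_integrable)
    show "AE x in ?M. (\<lambda>n. soft_trunc_deriv (dseq n) (A (norm x)) * (lam * W x) * \<psi> x) \<longlonglongrightarrow> lam * W x * \<psi> x"
    proof (rule AE_lebesgue_onI[OF open_ball])
      fix x :: "real^2" assume "x \<in> B1" "x \<noteq> 0"
      then have "(\<lambda>n. soft_trunc_deriv (dseq n) (A (norm x)) * (lam * W x) * \<psi> x) \<longlonglongrightarrow> 1 * (lam * W x) * \<psi> x"
        by (intro tendsto_intros dseq_limits) auto
      then show "(\<lambda>n. soft_trunc_deriv (dseq n) (A (norm x)) * (lam * W x) * \<psi> x) \<longlonglongrightarrow> lam * W x * \<psi> x"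
        by simp
    qed
    show "AE x in ?M. norm (soft_trunc_deriv (dseq n) (A (norm x)) * (lam * W x) * \<psi> x) \<le> 2 * lam * B * W x" for n
      by (rule AE_lebesgue_onI[OF open_ball]) (use Wle soft_trunc_deriv_bounds[OF dseq(1)] in simp)
  qed measurable
  define f2 where "f2 n x = soft_trunc (dseq n) (A (norm x)) / (norm x)\<^sup>2 * (x \<bullet> gradient \<psi> x)" for n x
  have 2: "(\<lambda>n. LINT x|?M. - f2 n x) \<longlonglongrightarrow> (LINT x|?M. grad_v x \<bullet> gradient \<psi> x)"
  proof (rule integral_dominated_convergence[OF _ _ gL])
    show "(\<lambda>x. - f2 n x) \<in> borel_measurable ?M" for n
      unfolding f2_def using borel_measurable_integrable[OF flux_integrable(2)[OF dseq(1) \<psi> rho]] by simp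
    show "AE x in ?M. (\<lambda>n. - f2 n x) \<longlonglongrightarrow> grad_v x \<bullet> gradient \<psi> x"
    proof (rule AE_lebesgue_onI[OF open_ball])
      fix x :: "real^2" assume x: "x \<in> B1" "x \<noteq> 0"
      then have "(\<lambda>n. - f2 n x) \<longlonglongrightarrow> - (A (norm x) / (norm x)\<^sup>2 * (x \<bullet> gradient \<psi> x))"
        unfolding f2_def by (intro tendsto_intros dseq_limits) auto
      then show "(\<lambda>n. - f2 n x) \<longlonglongrightarrow> grad_v x \<bullet> gradient \<psi> x"
        by (simp add: grad_v_def)
    qed
    show "AE x in ?M. norm (- f2 n x) \<le> (1 + (norm (grad_v x))\<^sup>2) * L" for n
    proof (rule AE_lebesgue_onI[OF open_ball])
      fix x :: "real^2" assume x: "x \<in> B1" "x \<noteq> 0"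
      then have r: "0 < norm x" "norm x < 1" by auto
      have "\<bar>f2 n x\<bar> = soft_trunc (dseq n) (A (norm x)) / (norm x)\<^sup>2 * \<bar>x \<bullet> gradient \<psi> x\<bar>"
        using soft_trunc_bounds(1)[OF dseq(1) A_nonneg[OF r]] by (simp add: f2_def abs_mult)
      also have "\<dots> \<le> A (norm x) / (norm x)\<^sup>2 * (norm x * norm (gradient \<psi> x))"
        using soft_trunc_bounds[OF dseq(1) A_nonneg[OF r]] A_nonneg[OF r]
        by (intro mult_mono divide_right_mono Cauchy_Schwarz_ineq2) auto
      also have "\<dots> = norm (grad_v x) * norm (gradient \<psi> x)"
        using r A_nonneg[OF r] by (simp add: norm_grad_v power2_eq_square)
      also note le
      finally show "norm (- f2 n x) \<le> (1 + (norm (grad_v x))\<^sup>2) * L" by simp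
    qed
  qed measurable
  have "(LINT x|?M. - f2 n x) = (LINT x|?M. soft_trunc_deriv (dseq n) (A (norm x)) * (lam * W x) * \<psi> x)" for n
    using flux_identity[OF dseq(1) \<psi> rho, of n] by (simp add: f2_def)
  with 2 have "(\<lambda>n. LINT x|?M. soft_trunc_deriv (dseq n) (A (norm x)) * (lam * W x) * \<psi> x) \<longlonglongrightarrow> (LINT x|?M. grad_v x \<bullet> gradient \<psi> x)"
    by simp
  from LIMSEQ_unique[OF this 1] 
  show "(LINT x|?M. grad_v x \<bullet> gradient \<psi> x) = (LINT x|?M. lam * W x * \<psi> x)" .
qed

end

section \<open>Membership in \<open>H10\<close> and testing with arbitrary elements of
  \<open>H10\<close>\<close>

context radial_profile
begin

lemma integrable_bounded_mult_grad_v: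
  assumes "f \<in> borel_measurable (lebesgue_on B1)" "\<And>x. \<bar>f x\<bar> \<le> B"
  shows "integrable (lebesgue_on B1) (\<lambda>x. f x *\<^sub>R grad_v x)"
proof (rule Bochner_Integration.integrable_bound)
  show "integrable (lebesgue_on B1) (\<lambda>x. B * (1 + (norm (grad_v x))\<^sup>2))"
    using integrable_norm_grad_v by simp
  show "(\<lambda>x. f x *\<^sub>R grad_v x) \<in> borel_measurable (lebesgue_on B1)"
    using assms(1) measurable_grad_v by measurable
  have "norm y \<le> 1 + (norm y)\<^sup>2" for y :: "real^2"
    using weighted_AM_GM[of 1 1 "norm y"] by simp
  moreover have "B \<ge> 0" using assms(2)[of 0] abs_ge_zero[of "f 0"] by linarith
  ultimately show "AE x in lebesgue_on B1. norm (f x *\<^sub>R grad_v x) \<le> norm (B * (1 + (norm (grad_v x))\<^sup>2))"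
    using assms(2) by (intro AE_I2) (auto simp: abs_mult intro!: mult_mono)
qed

text \<open>The products \<open>cutoff (dseq n) x * \<phi> x\<close> are continuously differentiable
  and vanish near the boundary, so their gradients integrate to zero; the limit of the product rule
  is the assertion.\<close>

lemma weak_gradient:
  assumes "test_function B1 \<phi>"
  shows "(LINT x|lebesgue_on B1. v (norm x) *\<^sub>R gradient \<phi> x) = - (LINT x|lebesgue_on B1. \<phi> x *\<^sub>R grad_v x)"
proof -
  let ?M = "lebesgue_on B1"
  obtain rho where rho: "rho < 1" "\<And>x. norm x > rho \<Longrightarrow> \<phi> x = 0" and \<phi>: "C_k 1 \<phi>"
    using test_functionD[OF assms] by metis
  note [measurable] = C_1_measurable[OF \<phi>] measurable_grad_v measurable_v
  obtain L where L: "L \<ge> 0" "\<And>x. norm (gradient \<phi> x) \<le> L" using gradient_bounded[OF \<phi> rho(2)] by blast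
  obtain B where B: "B \<ge> 0" "\<And>x. \<bar>\<phi> x\<bar> \<le> B" using C_1_bounded[OF \<phi> rho(2)] by blast
  have int1: "integrable ?M (\<lambda>x. v (norm x) *\<^sub>R gradient \<phi> x)"
  proof (rule integrable_B1_bounded)
    show "norm (v (norm x) *\<^sub>R gradient \<phi> x) \<le> v 0 * L" if "x \<in> B1" for x
      using v_norm_bounds[of x] that L by (auto intro!: mult_mono)
  qed measurable
  have int2: "integrable ?M (\<lambda>x. \<phi> x *\<^sub>R grad_v x)"
    by (rule integrable_bounded_mult_grad_v[OF _ B(2)]) measurable
  have T: "C_k 1 (cutoff (dseq n))" for n
    using cutoff_test_function[OF dseq(1,2)] by (simp add: test_function_def)
  define h where "h n x = cutoff (dseq n) x * \<phi> x" for n x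
  have h: "C_k 1 (h n)" for n
    using C_k_on_mult[of UNIV 1 "cutoff (dseq n)" \<phi>] T[of n] \<phi> unfolding h_def[abs_def] 
    by (simp only: C_k_on_UNIV open_UNIV)
  have h_supp: "h n x = 0" if "norm x > rho" for n x using rho(2)[OF that] by (simp add: h_def)
  have h_gradient: "gradient (h n) x = cutoff (dseq n) x *\<^sub>R gradient \<phi> x + (\<phi> x * gain (dseq n) x) *\<^sub>R grad_v x"
    if x: "x \<in> B1 - {0}" for n x
  proof -
    have d: "\<phi> differentiable (at x)" "cutoff (dseq n) differentiable (at x)" using T[of n] \<phi> by auto
    have "gradient (h n) x = cutoff (dseq n) x *\<^sub>R gradient \<phi> x + \<phi> x *\<^sub>R gradient (cutoff (dseq n)) x"
      unfolding h_def[abs_def]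
      by (intro gradient_eqI has_derivative_eq_rhs[OF has_derivative_mult[OF has_derivative_partial[OF d(2)] has_derivative_partial[OF d(1)]]])
         (simp add: inner_add_left gradient_inner[OF d(1)] gradient_inner[OF d(2)] mult.commute)
    then show ?thesis using cutoff_gradient[OF dseq(1) x] by simp
  qed
  define w where "w x = v 0 * L + 4 * B * (1 + (norm (grad_v x))\<^sup>2)" for x
  have "(\<lambda>n. LINT x|?M. gradient (h n) x) \<longlonglongrightarrow> (LINT x|?M. v (norm x) *\<^sub>R gradient \<phi> x + \<phi> x *\<^sub>R grad_v x)"
  proof (rule integral_dominated_convergence[where w = w])
    show "gradient (h n) \<in> borel_measurable ?M" for n by (rule C_1_measurable[OF h])
    show "integrable ?M w"
      unfolding w_def using integrable_grad_v_sq finite_measure.integrable_const[OF finite_measure_B1]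
      by (intro Bochner_Integration.integrable_add integrable_mult_right) auto
    show "AE x in ?M. (\<lambda>n. gradient (h n) x) \<longlonglongrightarrow> v (norm x) *\<^sub>R gradient \<phi> x + \<phi> x *\<^sub>R grad_v x"
    proof (rule AE_lebesgue_onI[OF open_ball])
      fix x :: "real^2" assume "x \<in> B1" "x \<noteq> 0"
      then have x: "x \<in> B1 - {0}" by simp
      have "(\<lambda>n. gradient (h n) x) \<longlonglongrightarrow> v (norm x) *\<^sub>R gradient \<phi> x + (\<phi> x * 1) *\<^sub>R grad_v x"
        unfolding h_gradient[OF x] by (intro tendsto_intros dseq_limits x)
      then show "(\<lambda>n. gradient (h n) x) \<longlonglongrightarrow> v (norm x) *\<^sub>R gradient \<phi> x + \<phi> x *\<^sub>R grad_v x" by simp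
    qed
    show "AE x in ?M. norm (gradient (h n) x) \<le> w x" for n
    proof (rule AE_lebesgue_onI[OF open_ball])
      fix x :: "real^2" assume "x \<in> B1" "x \<noteq> 0"
      then have x: "x \<in> B1 - {0}" by simp
      have "norm (gradient (h n) x) \<le> norm (cutoff (dseq n) x *\<^sub>R gradient \<phi> x) + norm ((\<phi> x * gain (dseq n) x) *\<^sub>R grad_v x)"
        unfolding h_gradient[OF x] by (rule norm_triangle_ineq)
      also have "\<dots> = cutoff (dseq n) x * norm (gradient \<phi> x) + (\<bar>\<phi> x\<bar> * gain (dseq n) x) * norm (grad_v x)"
        using cutoff_bounds(1)[OF dseq(1)] gain_bounds(1)[OF dseq(1)] by (simp add: abs_mult)
      also have "\<dots> \<le> v 0 * L + (B * 4) * (1 + (norm (grad_v x))\<^sup>2)"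
        using cutoff_bounds[OF dseq(1)] gain_bounds[OF dseq(1)] L B v0_pos weighted_AM_GM[of 1 1 "norm (grad_v x)"]
        by (intro add_mono mult_mono) auto
      finally show "norm (gradient (h n) x) \<le> w x" by (simp add: w_def mult_ac)
    qed
  qed measurable
  then have "(LINT x|?M. v (norm x) *\<^sub>R gradient \<phi> x + \<phi> x *\<^sub>R grad_v x) = 0"
    using integral_gradient_eq_0[OF h rho(1) h_supp] by (simp add: LIMSEQ_const_iff)
  then have "(LINT x|?M. v (norm x) *\<^sub>R gradient \<phi> x) + (LINT x|?M. \<phi> x *\<^sub>R grad_v x) = 0"
    by (simp add: Bochner_Integration.integral_add[OF int1 int2])
  then show ?thesis by (simp add: eq_neg_iff_add_eq_0)
qed

text \<open>The cutoffs are the approximating test functions. The error in the gradient is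
  \<open>(1 - gain) *\<^sub>R grad_v\<close> with \<open>gain\<close> between \<open>0\<close> and
  \<open>4\<close> and tending to \<open>1\<close>, whence the majorant with factor
  \<open>16\<close>.\<close>

lemma H10_grad_profile: "H10_grad B1 (\<lambda>x. v (norm x)) grad_v"
proof -
  let ?M = "lebesgue_on B1"
  note [measurable] = measurable_grad_v measurable_v
  have T: "C_k 1 (cutoff (dseq n))" for n
    using cutoff_test_function[OF dseq(1,2)] by (simp add: test_function_def)
  note [measurable] = C_1_measurable[OF T]
  have "integrable ?M (\<lambda>x. (norm (v (norm x)))\<^sup>2)"
  proof (rule integrable_B1_bounded)
    show "norm ((norm (v (norm x)))\<^sup>2) \<le> (v 0)\<^sup>2" if "x \<in> B1" for x
      using v_norm_bounds[of x] that by (auto intro!: power_mono)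
  qed measurable
  then have "L2_on B1 (\<lambda>x. v (norm x))" "L2_on B1 grad_v"
    unfolding L2_on_def using integrable_grad_v_sq measurable_v measurable_grad_v by simp_all
  then have H1: "H1_grad B1 (\<lambda>x. v (norm x)) grad_v"
    unfolding H1_grad_def using weak_gradient by simp
  have lim1: "(\<lambda>n. LINT x|?M. (v (norm x) - cutoff (dseq n) x)\<^sup>2) \<longlonglongrightarrow> (LINT x|?M. 0)"
  proof (rule integral_dominated_convergence[where w = "\<lambda>x. (v 0)\<^sup>2"])
    show "integrable ?M (\<lambda>x. (v 0)\<^sup>2)" by (rule finite_measure.integrable_const[OF finite_measure_B1])
    show "AE x in ?M. (\<lambda>n. (v (norm x) - cutoff (dseq n) x)\<^sup>2) \<longlonglongrightarrow> 0"
    proof (rule AE_lebesgue_onI[OF open_ball])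
      fix x :: "real^2" assume "x \<in> B1" "x \<noteq> 0"
      then have "(\<lambda>n. (v (norm x) - cutoff (dseq n) x)\<^sup>2) \<longlonglongrightarrow> (v (norm x) - v (norm x))\<^sup>2"
        by (intro tendsto_intros dseq_limits) auto
      then show "(\<lambda>n. (v (norm x) - cutoff (dseq n) x)\<^sup>2) \<longlonglongrightarrow> 0" by simp
    qed
    show "AE x in ?M. norm ((v (norm x) - cutoff (dseq n) x)\<^sup>2) \<le> (v 0)\<^sup>2" for n
    proof (rule AE_lebesgue_onI[OF open_ball])
      fix x :: "real^2" assume "x \<in> B1"
      then have "\<bar>v (norm x) - cutoff (dseq n) x\<bar> \<le> \<bar>v 0\<bar>"
        using v_norm_bounds[of x] cutoff_bounds[OF dseq(1), of n x] by auto
      then show "norm ((v (norm x) - cutoff (dseq n) x)\<^sup>2) \<le> (v 0)\<^sup>2" by (simp add: abs_le_square_iff)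
    qed
  qed measurable
  have lim2: "(\<lambda>n. LINT x|?M. (norm (grad_v x - gradient (cutoff (dseq n)) x))\<^sup>2) \<longlonglongrightarrow> (LINT x|?M. 0)"
  proof (rule integral_dominated_convergence[where w = "\<lambda>x. 16 * (norm (grad_v x))\<^sup>2"])
    show "integrable ?M (\<lambda>x. 16 * (norm (grad_v x))\<^sup>2)" using integrable_grad_v_sq by simp
    have eq: "grad_v x - gradient (cutoff (dseq n)) x = (1 - gain (dseq n) x) *\<^sub>R grad_v x" if "x \<in> B1 - {0}" for n x
      using cutoff_gradient[OF dseq(1) that] by (simp add: scaleR_left_diff_distrib)
    show "AE x in ?M. (\<lambda>n. (norm (grad_v x - gradient (cutoff (dseq n)) x))\<^sup>2) \<longlonglongrightarrow> 0"
    proof (rule AE_lebesgue_onI[OF open_ball])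
      fix x :: "real^2" assume "x \<in> B1" "x \<noteq> 0"
      then have x: "x \<in> B1 - {0}" by simp
      have "(\<lambda>n. (norm (grad_v x - gradient (cutoff (dseq n)) x))\<^sup>2) \<longlonglongrightarrow> (norm ((1 - 1) *\<^sub>R grad_v x))\<^sup>2"
        unfolding eq[OF x] by (intro tendsto_intros dseq_limits x)
      then show "(\<lambda>n. (norm (grad_v x - gradient (cutoff (dseq n)) x))\<^sup>2) \<longlonglongrightarrow> 0" by simp
    qed
    show "AE x in ?M. norm ((norm (grad_v x - gradient (cutoff (dseq n)) x))\<^sup>2) \<le> 16 * (norm (grad_v x))\<^sup>2" for n
    proof (rule AE_lebesgue_onI[OF open_ball])
      fix x :: "real^2" assume "x \<in> B1" "x \<noteq> 0"
      then have x: "x \<in> B1 - {0}" by simp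
      have "\<bar>1 - gain (dseq n) x\<bar> \<le> 4" using gain_bounds[OF dseq(1), of n x] by auto
      then have "norm (grad_v x - gradient (cutoff (dseq n)) x) \<le> 4 * norm (grad_v x)"
        unfolding eq[OF x] by (simp add: mult_right_mono)
      then have "(norm (grad_v x - gradient (cutoff (dseq n)) x))\<^sup>2 \<le> (4 * norm (grad_v x))\<^sup>2"
        by (intro power_mono) auto
      then show "norm ((norm (grad_v x - gradient (cutoff (dseq n)) x))\<^sup>2) \<le> 16 * (norm (grad_v x))\<^sup>2"
        by (simp add: power_mult_distrib)
    qed
  qed measurable
  have "(\<lambda>n. (LINT x|?M. (v (norm x) - cutoff (dseq n) x)\<^sup>2) +
      (LINT x|?M. (norm (grad_v x - gradient (cutoff (dseq n)) x))\<^sup>2)) \<longlonglongrightarrow> 0"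
    using tendsto_add[OF lim1 lim2] by simp
  then show ?thesis
    unfolding H10_grad_def
    by (intro conjI exI[of _ "\<lambda>n. cutoff (dseq n)"] allI cutoff_test_function dseq H1)
qed

text \<open>A substitute for Hardy's inequality: test the equation with smooth approximations of
  \<open>\<bar>\<phi>\<bar>\<close>.\<close>

lemma
  assumes \<phi>: "C_k 1 \<phi>" and rho: "rho < 1" "\<And>x::real^2. norm x > rho \<Longrightarrow> \<phi> x = 0" and t: "t > 0"
  shows integrable_W_abs: "integrable (lebesgue_on B1) (\<lambda>x. lam * W x * \<bar>\<phi> x\<bar>)"
    and W_abs_bound: "(LINT x|lebesgue_on B1. lam * W x * \<bar>\<phi> x\<bar>) \<le>
      t * (LINT x|lebesgue_on B1. (norm (grad_v x))\<^sup>2) + 1 / t * (LINT x|lebesgue_on B1. (norm (gradient \<phi> x))\<^sup>2)"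
proof -
  let ?M = "lebesgue_on B1"
  note [measurable] = C_1_measurable[OF \<phi>] measurable_grad_v measurable_W
  obtain L where L: "L \<ge> 0" "\<And>x. norm (gradient \<phi> x) \<le> L" using gradient_bounded[OF \<phi> rho(2)] by blast
  define e where "e n = 1 / real (Suc n)" for n
  have e: "e n > 0" for n by (simp add: e_def)
  have e0: "e \<longlonglongrightarrow> 0" unfolding e_def[abs_def] using LIMSEQ_inverse_real_of_nat by (simp add: inverse_eq_divide)
  define \<psi> where "\<psi> n x = sqrt ((\<phi> x)\<^sup>2 + (e n)\<^sup>2) - e n" for n x
  have \<psi>: "C_k 1 (\<psi> n)" "gradient (\<psi> n) x = (\<phi> x / sqrt ((\<phi> x)\<^sup>2 + (e n)\<^sup>2)) *\<^sub>R gradient \<phi> x" for n x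
    using C_1_smooth_abs[OF \<phi> e[of n]] unfolding \<psi>_def[abs_def] by auto
  have \<psi>0: "\<psi> n x \<ge> 0" for n x
  proof -
    have "sqrt ((e n)\<^sup>2) \<le> sqrt ((\<phi> x)\<^sup>2 + (e n)\<^sup>2)" by (intro real_sqrt_le_mono) simp
    then show ?thesis using e[of n] by (simp add: \<psi>_def)
  qed
  have \<psi>_supp: "\<psi> n x = 0" if "norm x > rho" for n x
    using rho(2)[OF that] e[of n] by (simp add: \<psi>_def)
  have int_grad: "integrable ?M (\<lambda>x. (norm (gradient \<phi> x))\<^sup>2)"
  proof (rule integrable_B1_bounded)
    show "norm ((norm (gradient \<phi> x))\<^sup>2) \<le> L\<^sup>2" for x using L by (auto intro!: power_mono)
  qed measurable
  have int_rhs: "integrable ?M (\<lambda>x. t * (norm (grad_v x))\<^sup>2 + 1 / t * (norm (gradient \<phi> x))\<^sup>2)"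
    using integrable_grad_v_sq int_grad by (intro Bochner_Integration.integrable_add integrable_mult_right) auto
  let ?C = "LINT x|?M. t * (norm (grad_v x))\<^sup>2 + 1 / t * (norm (gradient \<phi> x))\<^sup>2"
  have C': "(LINT x|?M. grad_v x \<bullet> gradient (\<psi> n) x) \<le> ?C" for n
  proof (rule integral_mono_AE[OF integrable_grad_v_gradient[OF \<psi>(1)[of n] rho(1) \<psi>_supp[of _ n]] int_rhs], assumption, rule AE_I2)
    fix x
    have "\<bar>\<phi> x / sqrt ((\<phi> x)\<^sup>2 + (e n)\<^sup>2)\<bar> \<le> 1"
    proof -
      have "sqrt ((\<phi> x)\<^sup>2) \<le> sqrt ((\<phi> x)\<^sup>2 + (e n)\<^sup>2)" by (intro real_sqrt_le_mono) simp
      moreover have "sqrt ((\<phi> x)\<^sup>2 + (e n)\<^sup>2) > 0" using e[of n] by (simp add: add_nonneg_pos)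
      ultimately show ?thesis by (simp add: abs_divide)
    qed
    then have "norm (gradient (\<psi> n) x) \<le> 1 * norm (gradient \<phi> x)"
      unfolding \<psi>(2) norm_scaleR by (intro mult_right_mono) auto
    then have "norm (grad_v x) * norm (gradient (\<psi> n) x) \<le> norm (grad_v x) * norm (gradient \<phi> x)"
      by (intro mult_left_mono) auto
    also have "\<dots> \<le> t * (norm (grad_v x))\<^sup>2 + 1 / t * (norm (gradient \<phi> x))\<^sup>2"
      by (rule weighted_AM_GM[OF t])
    finally show "grad_v x \<bullet> gradient (\<psi> n) x \<le> t * (norm (grad_v x))\<^sup>2 + 1 / t * (norm (gradient \<phi> x))\<^sup>2"
      using norm_cauchy_schwarz[of "grad_v x" "gradient (\<psi> n) x"] by linarith
  qed
  have C: "(LINT x|?M. lam * W x * \<psi> n x) \<le> ?C" for n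
    using C'[of n] grad_v_identity[OF \<psi>(1)[of n] rho(1) \<psi>_supp[of _ n]] by simp
  have meas: "(\<lambda>x. lam * W x * \<bar>\<phi> x\<bar>) \<in> borel_measurable ?M" by measurable
  have nn: "AE x in ?M. 0 \<le> lam * W x * \<psi> n x" for n
    by (rule AE_lebesgue_onI[OF open_ball]) (use \<psi>0 W_nonneg lam_pos in auto)
  have lim: "AE x in ?M. (\<lambda>n. lam * W x * \<psi> n x) \<longlonglongrightarrow> lam * W x * \<bar>\<phi> x\<bar>"
  proof (rule AE_I2)
    fix x
    have "(\<lambda>n. lam * W x * \<psi> n x) \<longlonglongrightarrow> lam * W x * (sqrt ((\<phi> x)\<^sup>2 + 0\<^sup>2) - 0)"
      unfolding \<psi>_def by (intro tendsto_intros e0)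
    then show "(\<lambda>n. lam * W x * \<psi> n x) \<longlonglongrightarrow> lam * W x * \<bar>\<phi> x\<bar>" by simp
  qed
  note F = integral_Fatou_bound[OF meas integrable_W_mult[OF \<psi>(1) rho(1) \<psi>_supp] lim nn C]
  show "integrable ?M (\<lambda>x. lam * W x * \<bar>\<phi> x\<bar>)" by (rule F)
  have "?C = t * (LINT x|?M. (norm (grad_v x))\<^sup>2) + 1 / t * (LINT x|?M. (norm (gradient \<phi> x))\<^sup>2)"
    using integrable_grad_v_sq int_grad by simp
  with F(2) show "(LINT x|?M. lam * W x * \<bar>\<phi> x\<bar>) \<le>
      t * (LINT x|?M. (norm (grad_v x))\<^sup>2) + 1 / t * (LINT x|?M. (norm (gradient \<phi> x))\<^sup>2)" by simp
qed

text \<open>The setting of the density argument: \<open>e n\<close> is the squared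
  \<open>H^1\<close> distance from the pair \<open>\<phi>\<close>, \<open>\<Phi>\<close> to the test
  function \<open>f n\<close>.\<close>

context
  fixes \<phi> :: "real ^ 2 \<Rightarrow> real" and \<Phi> :: "real ^ 2 \<Rightarrow> real ^ 2" and f :: "nat \<Rightarrow> real ^ 2 \<Rightarrow> real"
    and e :: "nat \<Rightarrow> real"
  assumes L2: "L2_on B1 \<phi>" "L2_on B1 \<Phi>" and f: "\<And>n. test_function B1 (f n)"
    and e_def: "e = (\<lambda>n. (LINT x|lebesgue_on B1. (\<phi> x - f n x)\<^sup>2) +
        (LINT x|lebesgue_on B1. (norm (\<Phi> x - gradient (f n) x))\<^sup>2))"
    and e_lim: "e \<longlonglongrightarrow> 0"
begin

lemma approx_C_1: "C_k 1 (f n)"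
  using f by (simp add: test_function_def)

lemma approx_measurable:
  "f n \<in> borel_measurable (lebesgue_on B1)" "gradient (f n) \<in> borel_measurable (lebesgue_on B1)"
  "\<phi> \<in> borel_measurable (lebesgue_on B1)" "\<Phi> \<in> borel_measurable (lebesgue_on B1)"
  using C_1_measurable[OF approx_C_1] L2 by (auto simp: L2_on_def)

lemma approx_integrable:
  "integrable (lebesgue_on B1) (\<lambda>x. (\<phi> x - f n x)\<^sup>2)"
  "integrable (lebesgue_on B1) (\<lambda>x. (norm (\<Phi> x - gradient (f n) x))\<^sup>2)"
proof -
  note [measurable] = approx_measurable
  obtain rho where rho: "rho < 1" "\<And>x. norm x > rho \<Longrightarrow> f n x = 0" using test_functionD[OF f] by metis
  obtain L where L: "L \<ge> 0" "\<And>x. norm (gradient (f n) x) \<le> L" using gradient_bounded[OF approx_C_1 rho(2)] by blast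
  obtain B where B: "B \<ge> 0" "\<And>x. \<bar>f n x\<bar> \<le> B" using C_1_bounded[OF approx_C_1 rho(2)] by blast
  have "integrable (lebesgue_on B1) (\<lambda>x. (norm (f n x))\<^sup>2)"
    by (rule integrable_B1_bounded[where B = "B\<^sup>2"]) (measurable, use B in \<open>simp add: abs_le_square_iff[symmetric]\<close>)
  from L2_diff_integrable[OF approx_measurable(3,1) _ this] L2
  show "integrable (lebesgue_on B1) (\<lambda>x. (\<phi> x - f n x)\<^sup>2)" by (simp add: L2_on_def)
  have "integrable (lebesgue_on B1) (\<lambda>x. (norm (gradient (f n) x))\<^sup>2)"
    by (rule integrable_B1_bounded[where B = "L\<^sup>2"]) (measurable, use L in \<open>auto intro!: power_mono\<close>)
  from L2_diff_integrable[OF approx_measurable(4,2) _ this] L2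
  show "integrable (lebesgue_on B1) (\<lambda>x. (norm (\<Phi> x - gradient (f n) x))\<^sup>2)" by (simp add: L2_on_def)
qed

lemma approx_le:
  "(LINT x|lebesgue_on B1. (\<phi> x - f n x)\<^sup>2) \<le> e n"
  "(LINT x|lebesgue_on B1. (norm (\<Phi> x - gradient (f n) x))\<^sup>2) \<le> e n" "0 \<le> e n"
  unfolding e_def by (simp_all add: integral_nonneg_AE)

text \<open>Closeness in \<open>H^1\<close> does not directly control integrals against the
  unbounded weight \<open>W\<close>. \<open>W_abs_bound\<close> is applied to differences
  \<open>f (r n) - f m\<close> along an almost everywhere convergent subsequence, and Fatou's lemma
  replaces \<open>f (r n)\<close> by \<open>\<phi>\<close>; \<open>d\<close> absorbs the error
  \<open>e (r n)\<close>.\<close>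

lemma approx_weighted:
  assumes t: "t > 0" and d: "d > 0"
  shows "integrable (lebesgue_on B1) (\<lambda>x. lam * W x * \<bar>\<phi> x - f m x\<bar>)"
    and "(LINT x|lebesgue_on B1. lam * W x * \<bar>\<phi> x - f m x\<bar>) \<le>
      t * (LINT x|lebesgue_on B1. (norm (grad_v x))\<^sup>2) + 1 / t * (2 * d + 2 * e m)"
proof -
  let ?M = "lebesgue_on B1"
  note [measurable] = approx_measurable measurable_W
  have "(\<lambda>n. LINT x|?M. norm ((\<phi> x - f n x)\<^sup>2)) \<longlonglongrightarrow> 0"
    by (rule tendsto_sandwich[OF _ _ tendsto_const e_lim]) (use approx_le(1) in \<open>auto simp: integral_nonneg_AE\<close>)
  from tendsto_L1_AE_subseq[OF approx_integrable(1) this]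
  obtain r where r: "strict_mono r" "AE x in ?M. (\<lambda>n. (\<phi> x - f (r n) x)\<^sup>2) \<longlonglongrightarrow> 0" by blast
  have "\<forall>\<^sub>F n in sequentially. e (r n) < d"
    using order_tendstoD(2)[OF LIMSEQ_subseq_LIMSEQ[OF e_lim r(1)] d] by (simp add: o_def)
  then obtain J where J: "\<And>n. n \<ge> J \<Longrightarrow> e (r n) < d" by (auto simp: eventually_sequentially)
  \<comment> \<open>The shift by \<open>J\<close> puts every error \<open>e (r (n + J))\<close>
    below \<open>d\<close>, so the bound handed to Fatou's lemma is the same for all
    \<open>n\<close>.\<close>
  define g where "g n x = f (r (n + J)) x - f m x" for n x
  have g: "C_k 1 (g n)" "gradient (g n) x = gradient (f (r (n + J))) x - gradient (f m) x" for n x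
    unfolding g_def[abs_def] using C_1_diff[OF approx_C_1 approx_C_1] by blast+
  have g_supp: "\<exists>rho<1. \<forall>x. norm x > rho \<longrightarrow> g n x = 0" for n
  proof -
    obtain rho1 where "rho1 < 1" "\<And>x. norm x > rho1 \<Longrightarrow> f (r (n + J)) x = 0" using test_functionD[OF f] by metis
    moreover obtain rho2 where "rho2 < 1" "\<And>x. norm x > rho2 \<Longrightarrow> f m x = 0" using test_functionD[OF f] by metis
    ultimately show ?thesis by (intro exI[of _ "max rho1 rho2"]) (auto simp: g_def)
  qed
  let ?C = "t * (LINT x|?M. (norm (grad_v x))\<^sup>2) + 1 / t * (2 * d + 2 * e m)"
  have bound: "integrable ?M (\<lambda>x. lam * W x * \<bar>g n x\<bar>) \<and> (LINT x|?M. lam * W x * \<bar>g n x\<bar>) \<le> ?C" for n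
  proof -
    obtain rho where rho: "rho < 1" "\<And>x. norm x > rho \<Longrightarrow> g n x = 0" using g_supp by blast
    have "(LINT x|?M. (norm (gradient (g n) x))\<^sup>2) \<le>
        (LINT x|?M. 2 * (norm (\<Phi> x - gradient (f m) x))\<^sup>2 + 2 * (norm (\<Phi> x - gradient (f (r (n + J))) x))\<^sup>2)"
    proof (rule integral_mono_AE)
      obtain L where L: "L \<ge> 0" "\<And>x. norm (gradient (g n) x) \<le> L" using gradient_bounded[OF g(1) rho(2)] by blast
      note [measurable] = C_1_measurable[OF g(1)]
      show "integrable ?M (\<lambda>x. (norm (gradient (g n) x))\<^sup>2)"
        by (rule integrable_B1_bounded[where B = "L\<^sup>2"]) (measurable, use L in \<open>auto intro!: power_mono\<close>)
      show "integrable ?M (\<lambda>x. 2 * (norm (\<Phi> x - gradient (f m) x))\<^sup>2 + 2 * (norm (\<Phi> x - gradient (f (r (n + J))) x))\<^sup>2)"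
        using approx_integrable(2) by simp
      show "AE x in ?M. (norm (gradient (g n) x))\<^sup>2 \<le>
          2 * (norm (\<Phi> x - gradient (f m) x))\<^sup>2 + 2 * (norm (\<Phi> x - gradient (f (r (n + J))) x))\<^sup>2"
      proof (rule AE_I2)
        fix x
        show "(norm (gradient (g n) x))\<^sup>2 \<le>
          2 * (norm (\<Phi> x - gradient (f m) x))\<^sup>2 + 2 * (norm (\<Phi> x - gradient (f (r (n + J))) x))\<^sup>2"
          using norm_diff_sq_le[of "\<Phi> x - gradient (f m) x" "\<Phi> x - gradient (f (r (n + J))) x"]
          by (simp add: g(2))
      qed
    qed
    also have "\<dots> = 2 * (LINT x|?M. (norm (\<Phi> x - gradient (f m) x))\<^sup>2) +
        2 * (LINT x|?M. (norm (\<Phi> x - gradient (f (r (n + J))) x))\<^sup>2)"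
      using approx_integrable(2) by simp
    also have "\<dots> \<le> 2 * d + 2 * e m"
      using approx_le(2)[of m] approx_le(2)[of "r (n + J)"] J[of "n + J"] by simp
    finally have "1 / t * (LINT x|?M. (norm (gradient (g n) x))\<^sup>2) \<le> 1 / t * (2 * d + 2 * e m)"
      using t by (intro mult_left_mono) auto
    then show ?thesis using integrable_W_abs[OF g(1) rho t] W_abs_bound[OF g(1) rho t] by simp
  qed
  have meas: "(\<lambda>x. lam * W x * \<bar>\<phi> x - f m x\<bar>) \<in> borel_measurable ?M" by measurable
  have nn: "AE x in ?M. 0 \<le> lam * W x * \<bar>g n x\<bar>" for n
    by (rule AE_lebesgue_onI[OF open_ball]) (use W_nonneg lam_pos in auto)
  have lim: "AE x in ?M. (\<lambda>n. lam * W x * \<bar>g n x\<bar>) \<longlonglongrightarrow> lam * W x * \<bar>\<phi> x - f m x\<bar>"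
    using r(2)
  proof eventually_elim
    case (elim x)
    have "(\<lambda>n. sqrt ((\<phi> x - f (r n) x)\<^sup>2)) \<longlonglongrightarrow> sqrt 0" by (intro tendsto_real_sqrt elim)
    then have "(\<lambda>n. \<phi> x - f (r n) x) \<longlonglongrightarrow> 0" by (simp add: tendsto_rabs_zero_iff)
    then have "(\<lambda>n. \<phi> x - (\<phi> x - f (r n) x)) \<longlonglongrightarrow> \<phi> x - 0" by (intro tendsto_intros)
    then have "(\<lambda>n. f (r n) x) \<longlonglongrightarrow> \<phi> x" by simp
    then have "(\<lambda>n. f (r (n + J)) x) \<longlonglongrightarrow> \<phi> x" by (rule LIMSEQ_ignore_initial_segment)
    then show ?case unfolding g_def by (intro tendsto_intros)
  qed
  note bd = bound[THEN conjunct1] bound[THEN conjunct2]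
  show "integrable ?M (\<lambda>x. lam * W x * \<bar>\<phi> x - f m x\<bar>)"
    by (rule integral_Fatou_bound(1)[OF meas bd(1) lim nn bd(2)])
  show "(LINT x|?M. lam * W x * \<bar>\<phi> x - f m x\<bar>) \<le> ?C"
    by (rule integral_Fatou_bound(2)[OF meas bd(1) lim nn bd(2)])
qed

text \<open>Both sides of the identity for \<open>f n\<close> converge: the gradient side by
  Cauchy-Schwarz and \<open>weighted_AM_GM\<close>, the weighted side by
  \<open>approx_weighted\<close>.\<close>

lemma weak_formulation:
  "integrable (lebesgue_on B1) (\<lambda>x. lam * W x * \<phi> x)"
  "(LINT x|lebesgue_on B1. grad_v x \<bullet> \<Phi> x) = (LINT x|lebesgue_on B1. lam * W x * \<phi> x)"
proof -
  let ?M = "lebesgue_on B1"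
  note [measurable] = approx_measurable measurable_W measurable_grad_v
  let ?N = "LINT x|?M. (norm (grad_v x))\<^sup>2"
  have supp: "\<exists>rho<1. \<forall>x. norm x > rho \<longrightarrow> f n x = 0" for n
    using test_functionD[OF f[of n]] by metis
  have intf: "integrable ?M (\<lambda>x. lam * W x * f n x)" "integrable ?M (\<lambda>x. grad_v x \<bullet> gradient (f n) x)"
    and idf: "(LINT x|?M. grad_v x \<bullet> gradient (f n) x) = (LINT x|?M. lam * W x * f n x)" for n
    using supp[of n] integrable_W_mult[OF approx_C_1] integrable_grad_v_gradient[OF approx_C_1]
      grad_v_identity[OF approx_C_1] by blast+
  have int_diff: "integrable ?M (\<lambda>x. lam * W x * (\<phi> x - f n x))" for n
  proof (rule Bochner_Integration.integrable_bound[OF approx_weighted(1)[of 1 1 n]])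
    show "AE x in ?M. norm (lam * W x * (\<phi> x - f n x)) \<le> norm (lam * W x * \<bar>\<phi> x - f n x\<bar>)"
      by (rule AE_I2) (simp add: abs_mult)
  qed (simp_all, measurable)
  have "integrable ?M (\<lambda>x. lam * W x * (\<phi> x - f 0 x) + lam * W x * f 0 x)"
    by (rule Bochner_Integration.integrable_add[OF int_diff intf(1)])
  then show int: "integrable ?M (\<lambda>x. lam * W x * \<phi> x)" by (simp add: algebra_simps)
  have intG: "integrable ?M (\<lambda>x. grad_v x \<bullet> \<Phi> x)"
  proof (rule Bochner_Integration.integrable_bound)
    show "integrable ?M (\<lambda>x. 1 * (norm (grad_v x))\<^sup>2 + 1 / 1 * (norm (\<Phi> x))\<^sup>2)"
      using integrable_grad_v_sq L2(2) by (simp add: L2_on_def)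
    show "AE x in ?M. norm (grad_v x \<bullet> \<Phi> x) \<le> norm (1 * (norm (grad_v x))\<^sup>2 + 1 / 1 * (norm (\<Phi> x))\<^sup>2)"
    proof (rule AE_I2)
      fix x
      show "norm (grad_v x \<bullet> \<Phi> x) \<le> norm (1 * (norm (grad_v x))\<^sup>2 + 1 / 1 * (norm (\<Phi> x))\<^sup>2)"
        using Cauchy_Schwarz_ineq2[of "grad_v x" "\<Phi> x"] weighted_AM_GM[of 1 "norm (grad_v x)" "norm (\<Phi> x)"] by simp
    qed
  qed measurable
  \<comment> \<open>The error bounds have the shape \<open>t * ?N + error / t\<close>, and the
    square root of the error balances the two terms. The summand \<open>1 / real (Suc n)\<close>
    keeps \<open>t n\<close> positive when \<open>e n = 0\<close> and is also the \<open>d\<close>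
    given to \<open>approx_weighted\<close>.\<close>
  define t where "t n = sqrt (e n + 1 / real (Suc n))" for n
  have t: "t n > 0" for n using approx_le(3)[of n] by (simp add: t_def add_nonneg_pos)
  have t2: "1 / t n * (e n + 1 / real (Suc n)) = t n" for n
  proof -
    have "e n + 1 / real (Suc n) = t n * t n"
      using approx_le(3)[of n] unfolding t_def by (subst real_sqrt_mult_self) (simp add: add_nonneg_nonneg)
    then show ?thesis using t[of n] by simp
  qed
  have "(\<lambda>n. e n + 1 / real (Suc n)) \<longlonglongrightarrow> 0 + 0"
    by (intro tendsto_add e_lim LIMSEQ_Suc[OF lim_1_over_n])
  then have "t \<longlonglongrightarrow> sqrt (0 + 0)" unfolding t_def[abs_def] by (intro tendsto_real_sqrt)
  then have t0: "(\<lambda>n. t n * (?N + 2)) \<longlonglongrightarrow> 0" using tendsto_mult_left_zero[of t sequentially "?N + 2"] by simp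
  have "\<bar>(LINT x|?M. lam * W x * \<phi> x) - (LINT x|?M. lam * W x * f n x)\<bar> \<le> t n * (?N + 2)" for n
  proof -
    have "(LINT x|?M. lam * W x * \<phi> x) - (LINT x|?M. lam * W x * f n x) = (LINT x|?M. lam * W x * (\<phi> x - f n x))"
      using Bochner_Integration.integral_diff[OF int intf(1)] by (simp add: algebra_simps)
    also have "\<bar>\<dots>\<bar> \<le> (LINT x|?M. \<bar>lam * W x * (\<phi> x - f n x)\<bar>)" by (rule integral_abs_bound)
    also have "\<dots> = (LINT x|?M. lam * W x * \<bar>\<phi> x - f n x\<bar>)"
      by (rule Bochner_Integration.integral_cong) (use W_nonneg lam_pos in \<open>auto simp: abs_mult space_restrict_space\<close>)
    also have "\<dots> \<le> t n * ?N + 1 / t n * (2 * (1 / real (Suc n)) + 2 * e n)"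
      by (rule approx_weighted(2)[OF t]) simp
    also have "\<dots> = t n * ?N + 2 * (1 / t n * (e n + 1 / real (Suc n)))" by (simp add: algebra_simps)
    also have "\<dots> = t n * (?N + 2)" by (simp only: t2) (simp add: algebra_simps)
    finally show ?thesis .
  qed
  then have 1: "(\<lambda>n. LINT x|?M. lam * W x * f n x) \<longlonglongrightarrow> (LINT x|?M. lam * W x * \<phi> x)"
    by (intro Lim_null_comparison[OF always_eventually t0, THEN LIM_zero_cancel]) (simp add: abs_minus_commute)
  have "\<bar>(LINT x|?M. grad_v x \<bullet> \<Phi> x) - (LINT x|?M. grad_v x \<bullet> gradient (f n) x)\<bar> \<le> t n * (?N + 2)" for n
  proof -
    let ?D = "\<lambda>x. \<Phi> x - gradient (f n) x"
    have "(LINT x|?M. grad_v x \<bullet> \<Phi> x) - (LINT x|?M. grad_v x \<bullet> gradient (f n) x) = (LINT x|?M. grad_v x \<bullet> ?D x)"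
      using Bochner_Integration.integral_diff[OF intG intf(2)] by (simp add: inner_diff_right)
    also have "\<bar>\<dots>\<bar> \<le> (LINT x|?M. \<bar>grad_v x \<bullet> ?D x\<bar>)" by (rule integral_abs_bound)
    also have "\<dots> \<le> (LINT x|?M. t n * (norm (grad_v x))\<^sup>2 + 1 / t n * (norm (?D x))\<^sup>2)"
    proof (rule integral_mono_AE)
      show "integrable ?M (\<lambda>x. \<bar>grad_v x \<bullet> ?D x\<bar>)"
        using Bochner_Integration.integrable_diff[OF intG intf(2)] by (simp add: inner_diff_right)
      show "integrable ?M (\<lambda>x. t n * (norm (grad_v x))\<^sup>2 + 1 / t n * (norm (?D x))\<^sup>2)"
        using integrable_grad_v_sq approx_integrable(2) 
        by (intro Bochner_Integration.integrable_add integrable_mult_right) auto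
      show "AE x in ?M. \<bar>grad_v x \<bullet> ?D x\<bar> \<le> t n * (norm (grad_v x))\<^sup>2 + 1 / t n * (norm (?D x))\<^sup>2"
        by (rule AE_I2) (rule order_trans[OF Cauchy_Schwarz_ineq2 weighted_AM_GM[OF t]])
    qed
    also have "\<dots> = t n * ?N + 1 / t n * (LINT x|?M. (norm (?D x))\<^sup>2)"
      using integrable_grad_v_sq approx_integrable(2) by simp
    also have "\<dots> \<le> t n * ?N + 1 / t n * (e n + 1 / real (Suc n))"
      using approx_le(2)[of n] t[of n] by (intro add_left_mono mult_left_mono add_increasing2) auto
    also have "\<dots> \<le> t n * (?N + 2)" using t[of n] by (simp only: t2) (simp add: algebra_simps)
    finally show ?thesis .
  qed
  then have 2: "(\<lambda>n. LINT x|?M. grad_v x \<bullet> gradient (f n) x) \<longlonglongrightarrow> (LINT x|?M. grad_v x \<bullet> \<Phi> x)"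
    by (intro Lim_null_comparison[OF always_eventually t0, THEN LIM_zero_cancel]) (simp add: abs_minus_commute)
  from LIMSEQ_unique[OF 2] 1 idf show "(LINT x|?M. grad_v x \<bullet> \<Phi> x) = (LINT x|?M. lam * W x * \<phi> x)" by simp
qed

end

lemma weak_solution_profile:
  assumes u: "\<And>x. x \<in> B1 \<Longrightarrow> u x = v (norm x)"
  shows "H10_grad B1 u grad_v" "weak_solution k lam u"
proof -
  show H: "H10_grad B1 u grad_v" by (rule H10_grad_cong[OF u H10_grad_profile])
  show "weak_solution k lam u"
    unfolding weak_solution_def
  proof (intro exI[of _ grad_v] conjI H allI impI)
    fix \<phi> \<Phi> assume *: "H10_grad B1 \<phi> \<Phi>"
    then obtain f where f: "\<And>n. test_function B1 (f n)"
      "(\<lambda>n. (LINT x|lebesgue_on B1. (\<phi> x - f n x)\<^sup>2) +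
        (LINT x|lebesgue_on B1. (norm (\<Phi> x - gradient (f n) x))\<^sup>2)) \<longlonglongrightarrow> 0"
      unfolding H10_grad_def by blast
    have "L2_on B1 \<phi>" "L2_on B1 \<Phi>" using * by (auto simp: H10_grad_def H1_grad_def)
    note wf = weak_formulation[OF this f(1) refl f(2)]
    have eq: "V k (norm x) * exp (u x) * \<phi> x = W x * \<phi> x" if "x \<in> B1" for x
      using u[OF that] by (simp add: W_def)
    have sp: "space (lebesgue_on B1) = B1" by (simp add: space_restrict_space)
    have "integrable (lebesgue_on B1) (\<lambda>x. 1 / lam * (lam * W x * \<phi> x))"
      using wf(1) by (rule integrable_mult_right)
    then have intW: "integrable (lebesgue_on B1) (\<lambda>x. W x * \<phi> x)" using lam_pos by simp
    then show "integrable (lebesgue_on B1) (\<lambda>x. V k (norm x) * exp (u x) * \<phi> x)"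
      by (rule Bochner_Integration.integrable_cong[THEN iffD1, OF refl, rotated]) (simp_all add: eq sp)
    have "(LINT x|lebesgue_on B1. V k (norm x) * exp (u x) * \<phi> x) = (LINT x|lebesgue_on B1. W x * \<phi> x)"
      by (rule Bochner_Integration.integral_cong) (simp_all add: eq sp)
    then show "(LINT x|lebesgue_on B1. grad_v x \<bullet> \<Phi> x) =
        lam * (LINT x|lebesgue_on B1. V k (norm x) * exp (u x) * \<phi> x)"
      using wf(2) by (simp add: mult.assoc)
  qed
qed

end

section \<open>Classification of the radial solutions\<close>

lemma laplacian_radial:
  fixes u :: "real ^ 2 \<Rightarrow> real" and v v' v'' :: "real \<Rightarrow> real"
  assumes v: "\<And>r. 0 < r \<Longrightarrow> r < 1 \<Longrightarrow> (v has_real_derivative v' r) (at r)"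
    and v': "\<And>r. 0 < r \<Longrightarrow> r < 1 \<Longrightarrow> (v' has_real_derivative v'' r) (at r)"
    and u: "\<And>x. x \<in> B1 - {0} \<Longrightarrow> u x = v (norm x)" and x: "x \<in> B1 - {0}"
  shows "laplacian u x = v'' (norm x) + v' (norm x) / norm x"
proof -
  have op: "open (B1 - {0})" by auto
  define q where "q r = v' r / r" for r
  define q' where "q' r = v'' r / r - v' r / r\<^sup>2" for r
  have r: "0 < norm x" "norm x < 1" using x by auto
  have partial_u: "partial b u y = q (norm y) * (y \<bullet> b)" if y: "y \<in> B1 - {0}" for b y
  proof -
    have "partial b u y = partial b (\<lambda>x. v (norm x)) y" by (rule partial_cong_open[OF op y u])
    also have "\<dots> = v' (norm y) / norm y * (y \<bullet> b)"
      using y by (intro partial_eqI has_derivative_radial v) auto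
    finally show ?thesis by (simp add: q_def)
  qed
  have dq: "(q has_real_derivative q' (norm x)) (at (norm x))"
    unfolding q_def[abs_def] using r
    by (auto intro!: derivative_eq_intros v' simp: q'_def power2_eq_square field_simps)
  have "partial b (partial b u) x = q' (norm x) / norm x * (x \<bullet> b)\<^sup>2 + q (norm x)" if b: "b \<in> Basis" for b
  proof -
    have "partial b (partial b u) x = partial b (\<lambda>y. q (norm y) * (y \<bullet> b)) x"
      by (rule partial_cong_open[OF op x partial_u])
    also have "\<dots> = q (norm x) * (b \<bullet> b) + q' (norm x) / norm x * (x \<bullet> b) * (x \<bullet> b)"
    proof -
      have d1: "((\<lambda>x. q (norm x)) has_derivative (\<lambda>h. q' (norm x) / norm x * (x \<bullet> h))) (at x)"
        using x by (intro has_derivative_radial dq) auto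
      have d2: "((\<lambda>x. x \<bullet> b) has_derivative (\<lambda>h. h \<bullet> b)) (at x)"
        by (auto intro!: derivative_eq_intros)
      show ?thesis by (rule partial_eqI[OF has_derivative_mult[OF d1 d2], of b])
    qed
    finally show ?thesis using b by (simp add: power2_eq_square)
  qed
  then have "laplacian u x = q' (norm x) / norm x * (\<Sum>b\<in>Basis. (x \<bullet> b)\<^sup>2) + 2 * q (norm x)"
    unfolding laplacian_def by (simp add: sum.distrib sum_distrib_left)
  also have "(\<Sum>b\<in>Basis. (x \<bullet> b)\<^sup>2) = (norm x)\<^sup>2"
    unfolding power2_norm_eq_inner by (subst euclidean_inner) (simp add: power2_eq_square)
  finally show ?thesis using r by (simp add: q_def q'_def power2_eq_square field_simps)
qed

text \<open>Every radius is the norm of some point, so the equation on the ball becomes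
  \<open>- (v'' + v' / r) = lam * V * exp v\<close>; multiplied by \<open>r\<close>, its left side
  is the derivative of \<open>A = - r v'\<close>.\<close>

lemma radial_solution_profile:
  assumes k: "k > 0" and sol: "(lam, u) \<in> radial_solutions k"
  obtains v A where "radial_profile k lam v A" "\<And>x. x \<in> cball 0 1 \<Longrightarrow> u x = v (norm x)"
    "\<And>x. x \<notin> cball 0 1 \<Longrightarrow> u x = 0"
proof -
  obtain v where lam: "lam > 0" and v: "continuous_on {0..1} v" "C2_on {0<..1} v"
    and uv: "\<And>x. x \<in> cball 0 1 \<Longrightarrow> u x = v (norm x)"
    and pde: "\<And>x. x \<in> B1 - {0} \<Longrightarrow> - laplacian u x = lam * V k (norm x) * exp (u x)"
    and pos: "\<And>x. x \<in> B1 \<Longrightarrow> u x > 0" and bc: "\<And>x. x \<in> sphere 0 1 \<Longrightarrow> u x = 0"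
    and out: "\<And>x. x \<notin> cball 0 1 \<Longrightarrow> u x = 0"
    using sol unfolding radial_solutions_def by blast
  obtain v' v'' where d: "\<And>r. r \<in> {0<..1} \<Longrightarrow> (v has_real_derivative v' r) (at r within {0<..1})"
    "\<And>r. r \<in> {0<..1} \<Longrightarrow> (v' has_real_derivative v'' r) (at r within {0<..1})"
    using v(2) unfolding C2_on_def by blast
  have at: "at r within {0<..1} = at r" if "0 < r" "r < 1" for r :: real
    by (rule at_within_nhd[of r "{0<..<1}"]) (use that in auto)
  have dv: "(v has_real_derivative v' r) (at r)" "(v' has_real_derivative v'' r) (at r)" if "0 < r" "r < 1" for r
    using d[of r] that at[OF that] by auto
  have point: "\<exists>x::real^2. norm x = r" if "0 \<le> r" for r
    using vector_choose_size[OF that] by metis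
  have ode: "- (v'' r + v' r / r) = lam * V k r * exp (v r)" if r: "0 < r" "r < 1" for r
  proof -
    obtain x :: "real^2" where x: "norm x = r" using point r by (metis less_imp_le)
    then have xS: "x \<in> B1 - {0}" using r by auto
    have "laplacian u x = v'' (norm x) + v' (norm x) / norm x"
      by (rule laplacian_radial[OF dv _ xS]) (use uv in auto)
    then show ?thesis using pde[OF xS] uv[of x] x r by simp
  qed
  define A where "A r = - r * v' r" for r
  have "radial_profile k lam v A"
  proof
    show "v 1 = 0"
    proof -
      obtain x :: "real^2" where "norm x = 1" using point[of 1] by auto
      then show ?thesis using bc[of x] uv[of x] by simp
    qed
    show "v r > 0" if r: "0 \<le> r" "r < 1" for r
    proof -
      obtain x :: "real^2" where "norm x = r" using point[OF r(1)] by auto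
      then show ?thesis using pos[of x] uv[of x] r by simp
    qed
    show "(v has_real_derivative - A r / r) (at r)" if "0 < r" "r < 1" for r
      using dv(1)[OF that] that by (simp add: A_def)
    show "(A has_real_derivative lam * r * V k r * exp (v r)) (at r)" if r: "0 < r" "r < 1" for r
    proof -
      have "(A has_real_derivative r * - (v'' r + v' r / r)) (at r)"
        unfolding A_def[abs_def] using r by (auto intro!: derivative_eq_intros dv simp: algebra_simps)
      then show ?thesis unfolding ode[OF r] by (simp add: mult_ac)
    qed
  qed (use k lam v in auto)
  then show thesis using uv out by (rule that)
qed

section \<open>Solutions read off the global orbit\<close>

context
  fixes k :: real and Y G :: "real \<Rightarrow> real"
  assumes k: "k > 0" and anc: "ancient_flow k UNIV Y G"
begin

lemma anc_below: "ancient_flow k {..<T} Y G"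
  using anc by (auto simp: ancient_flow_def intro: flow_on_subset)

lemma universal_DERIV:
  "(Y has_real_derivative - G x) (at x)" "(G has_real_derivative exp (k * x + Y x) - G x) (at x)"
  using ancient_DERIV[OF k anc_below[of "x + 1"], of x] by auto

lemma universal_continuous: "continuous_on S Y" "continuous_on S G"
  by (auto intro!: continuous_at_imp_continuous_on DERIV_isCont universal_DERIV)

lemma universal_decreasing: "x < y \<Longrightarrow> Y y < Y x"
proof (rule DERIV_neg_imp_decreasing[of x y Y])
  fix z
  show "\<exists>d. (Y has_real_derivative d) (at z) \<and> d < 0"
    using universal_DERIV(1)[of z] ancient_G_pos[OF k anc_below[of "z + 1"], of z]
    by (intro exI[of _ "- G z"]) simp
qed

text \<open>At \<open>r = 0\<close> the argument of \<open>Y\<close> should be minus infinity, where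
  \<open>Y\<close> tends to \<open>0\<close>; this limit is written in explicitly. Subtracting
  \<open>Y (\<beta> / k)\<close> gives the value \<open>0\<close> at \<open>r = 1\<close>.\<close>

definition profile :: "real \<Rightarrow> real \<Rightarrow> real" where
  "profile \<beta> r = (if r = 0 then 0 else Y (\<beta> / k - ln (1 - ln r))) - Y (\<beta> / k)"

lemma one_minus_ln_pos: "0 < r \<Longrightarrow> r \<le> 1 \<Longrightarrow> 1 - ln r \<ge> (1::real)"
  using ln_le_zero_iff[of r] by simp

text \<open>The derivatives are two-sided even at \<open>r = 1\<close>, since the orbit continues
  beyond \<open>x = \<beta> / k\<close>; this yields \<open>C2_on\<close> up to the
  boundary.\<close>

lemma profile_DERIV:
  fixes r \<beta> :: real
  assumes r: "0 < r" "r \<le> 1"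
  defines "t \<equiv> 1 - ln r" and "X \<equiv> \<beta> / k - ln (1 - ln r)"
  shows "(profile \<beta> has_real_derivative - G X / (t * r)) (at r)"
    "((\<lambda>r. - G (\<beta> / k - ln (1 - ln r)) / ((1 - ln r) * r)) has_real_derivative
       (G X * t - exp (k * X + Y X)) / (t * r)\<^sup>2) (at r)"
proof -
  have t: "t > 0" using one_minus_ln_pos[OF r] unfolding t_def by linarith
  have dX: "((\<lambda>r. \<beta> / k - ln (1 - ln r)) has_real_derivative 1 / (t * r)) (at r)"
    using r t unfolding t_def by (auto intro!: derivative_eq_intros)
  have "((\<lambda>r. Y (\<beta> / k - ln (1 - ln r)) - Y (\<beta> / k)) has_real_derivative - G X / (t * r)) (at r)"
    unfolding X_def by (auto intro!: derivative_eq_intros DERIV_chain2[OF universal_DERIV(1) dX])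
  then show "(profile \<beta> has_real_derivative - G X / (t * r)) (at r)"
    by (rule has_field_derivative_transform_within_open[of _ _ _ "{0<..}"]) (use r in \<open>auto simp: profile_def\<close>)
  have dG: "((\<lambda>r. G (\<beta> / k - ln (1 - ln r))) has_real_derivative (exp (k * X + Y X) - G X) * (1 / (t * r))) (at r)"
    unfolding X_def by (rule DERIV_chain2[OF universal_DERIV(2) dX])
  have dtr: "((\<lambda>r. (1 - ln r) * r) has_real_derivative t - 1) (at r)"
    using r unfolding t_def by (auto intro!: derivative_eq_intros)
  have tr: "(1 - ln r) * r \<noteq> 0" using t r by (simp add: t_def)
  show "((\<lambda>r. - G (\<beta> / k - ln (1 - ln r)) / ((1 - ln r) * r)) has_real_derivative
       (G X * t - exp (k * X + Y X)) / (t * r)\<^sup>2) (at r)"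
    by (rule DERIV_cong[OF DERIV_divide[OF DERIV_minus[OF dG] dtr tr]])
       (unfold X_def[symmetric], unfold t_def[symmetric], use t r in \<open>simp add: power2_eq_square field_simps\<close>)
qed

lemma profile_tendsto_0: "(profile \<beta> \<longlongrightarrow> profile \<beta> 0) (at_right 0)"
proof -
  have "filterlim (\<lambda>r::real. 1 - ln r) at_top (at_right 0)"
    using filterlim_tendsto_add_at_top[OF tendsto_const[of 1] filterlim_uminus_at_top_at_bot[THEN filterlim_compose, OF ln_at_0]]
    by simp
  from filterlim_tendsto_add_at_top[OF tendsto_const[of "- (\<beta> / k)"] filterlim_compose[OF ln_at_top this]]
  have "filterlim (\<lambda>r::real. \<beta> / k - ln (1 - ln r)) at_bot (at_right 0)" by (simp add: filterlim_uminus_at_bot)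
  from filterlim_compose[OF ancient_limits(1)[OF k anc_below[of 0]] this]
  have "((\<lambda>r. Y (\<beta> / k - ln (1 - ln r)) - Y (\<beta> / k)) \<longlongrightarrow> 0 - Y (\<beta> / k)) (at_right 0)"
    by (intro tendsto_intros)
  moreover have "\<forall>\<^sub>F r in at_right 0. Y (\<beta> / k - ln (1 - ln r)) - Y (\<beta> / k) = profile \<beta> r"
    unfolding eventually_at_right_field by (auto simp: profile_def intro!: exI[of _ 1])
  ultimately show ?thesis by (simp add: profile_def[of _ 0] Lim_transform_eventually)
qed

lemma profile_continuous: "continuous_on {0..1} (profile \<beta>)"
  unfolding continuous_on_def
proof
  fix r :: real assume "r \<in> {0..1}"
  then consider "r = 0" | "0 < r" "r \<le> 1" by fastforce
  then show "(profile \<beta> \<longlongrightarrow> profile \<beta> r) (at r within {0..1})"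
  proof cases
    case 1
    have "(profile \<beta> \<longlongrightarrow> profile \<beta> 0) (at 0 within {0..1})"
      using profile_tendsto_0[of \<beta>] by (simp add: at_within_Icc_at_right)
    then show ?thesis using 1 by simp
  next
    case 2
    from DERIV_isCont[OF profile_DERIV(1)[OF 2, of \<beta>]] show ?thesis
      unfolding isCont_def by (rule tendsto_within_subset) simp
  qed
qed

lemma profile_C2: "C2_on {0<..1} (profile \<beta>)"
proof -
  let ?X = "\<lambda>r. \<beta> / k - ln (1 - ln r)"
  have ln1: "ln r < 1" if "0 < r" "r \<le> 1" for r :: real using one_minus_ln_pos[OF that] by linarith
  then have "ln r \<noteq> 1" if "0 < r" "r \<le> 1" for r :: real using that by fastforce
  then have cont: "continuous_on {0<..1} (\<lambda>r. (G (?X r) * (1 - ln r) - exp (k * ?X r + Y (?X r))) / ((1 - ln r) * r)\<^sup>2)"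
    using ln1
    by (intro continuous_intros continuous_on_compose2[OF universal_continuous(1)[of UNIV]]
        continuous_on_compose2[OF universal_continuous(2)[of UNIV]]) auto
  show ?thesis
    unfolding C2_on_def
  proof (rule exI[of _ "\<lambda>r. - G (?X r) / ((1 - ln r) * r)"],
      rule exI[of _ "\<lambda>r. (G (?X r) * (1 - ln r) - exp (k * ?X r + Y (?X r))) / ((1 - ln r) * r)\<^sup>2"],
      intro conjI ballI cont)
    fix r :: real assume "r \<in> {0<..1}"
    then have r: "0 < r" "r \<le> 1" by auto
    show "(profile \<beta> has_real_derivative - G (?X r) / ((1 - ln r) * r)) (at r within {0<..1})"
      "((\<lambda>r. - G (?X r) / ((1 - ln r) * r)) has_real_derivative
        (G (?X r) * (1 - ln r) - exp (k * ?X r + Y (?X r))) / ((1 - ln r) * r)\<^sup>2) (at r within {0<..1})"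
      using profile_DERIV[OF r, of \<beta>] by (auto intro: has_field_derivative_at_within)
  qed
qed

definition lam_of :: "real \<Rightarrow> real" where
  "lam_of \<beta> = exp (\<beta> + Y (\<beta> / k))"

lemma profile_solution:
  assumes u: "\<And>x. u x = (if norm x \<le> 1 then profile \<beta> (norm x) else 0)"
  shows "(lam_of \<beta>, u) \<in> radial_solutions k"
proof -
  let ?X = "\<lambda>r. \<beta> / k - ln (1 - ln r)"
  have "- laplacian u x = lam_of \<beta> * V k (norm x) * exp (u x)" if x: "x \<in> B1 - {0}" for x
  proof -
    define r where "r = norm x"
    define t where "t = 1 - ln r"
    have r: "0 < r" "r < 1" using x by (auto simp: r_def)
    have t: "t > 0" using one_minus_ln_pos[of r] r unfolding t_def by linarith
    have "laplacian u x = (G (?X r) * t - exp (k * ?X r + Y (?X r))) / (t * r)\<^sup>2 + - G (?X r) / (t * r) / r"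
      unfolding r_def t_def
      by (rule laplacian_radial[OF profile_DERIV(1)[of _ \<beta>] profile_DERIV(2)[of _ \<beta>] _ x]) (use u in auto)
    also have "\<dots> = - (exp (k * ?X r + Y (?X r)) / (t * r)\<^sup>2)"
      using r t by (simp add: power2_eq_square field_simps)
    finally have lap: "- laplacian u x = exp (k * ?X r + Y (?X r)) / (t * r)\<^sup>2" by simp
    \<comment> \<open>This turns \<open>exp (k * ?X r)\<close> into
      \<open>exp \<beta> / t powr k\<close>; with the factor \<open>t\<^sup>2\<close> from the
      Laplacian it produces the exponent \<open>2 + k\<close> of \<open>V\<close>.\<close>
    have "k * ?X r = \<beta> - k * ln t" using k by (simp add: t_def field_simps)
    then have "exp (k * ?X r + Y (?X r)) = exp \<beta> * exp (- (k * ln t)) * exp (Y (?X r))"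
      by (simp add: mult_exp_exp)
    also have "exp (- (k * ln t)) = 1 / t powr k" using t by (simp add: powr_def exp_minus field_simps)
    finally have "- laplacian u x = exp \<beta> * exp (Y (?X r)) / (r\<^sup>2 * (t\<^sup>2 * t powr k))"
      unfolding lap by (simp add: power_mult_distrib)
    also have "t\<^sup>2 * t powr k = t powr (2 + k)" using t by (simp add: powr_add)
    also have "exp \<beta> * exp (Y (?X r)) / (r\<^sup>2 * t powr (2 + k)) = exp \<beta> * exp (Y (?X r)) * V k r"
      using r by (simp add: V_eq t_def)
    also have "exp \<beta> * exp (Y (?X r)) = lam_of \<beta> * exp (u x)"
      using x r by (simp add: lam_of_def u profile_def mult_exp_exp r_def[symmetric])
    finally show ?thesis by (simp add: r_def mult_ac)
  qed
  moreover have "u x > 0" if "x \<in> B1" for x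
  proof (cases "x = 0")
    case True
    then show ?thesis using ancient_Y_neg[OF k anc_below, of "\<beta> / k" "\<beta> / k + 1"] by (simp add: u profile_def)
  next
    case False
    then have r: "0 < norm x" "norm x < 1" using that by auto
    have "1 - ln (norm x) > 1" using r by simp
    then have "ln (1 - ln (norm x)) > 0" by simp
    then show ?thesis using universal_decreasing[of "\<beta> / k - ln (1 - ln (norm x))" "\<beta> / k"] r
      by (simp add: u profile_def)
  qed
  moreover have "u x = 0" if "x \<in> sphere 0 1" for x using that by (simp add: u profile_def)
  moreover have "\<exists>v. continuous_on {0..1} v \<and> C2_on {0<..1} v \<and> (\<forall>x\<in>cball 0 1. u x = v (norm x))"
    using profile_continuous profile_C2 u by (intro exI[of _ "profile \<beta>"]) simp
  ultimately show ?thesis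
    unfolding radial_solutions_def using u by (auto simp: lam_of_def)
qed

text \<open>\<open>\<rho>\<close> inverts \<open>T - ln (1 - ln r)\<close>, so \<open>Y1\<close> and
  \<open>G1\<close> rewrite the given profile as a flow on \<open>{..<T}\<close>. Continuity of
  \<open>v\<close> at \<open>0\<close> and \<open>A_tendsto\<close> give the two limits, because
  \<open>exp x * G1 x = exp T * A (\<rho> x)\<close>. Uniqueness identifies the flow with the global
  orbit, and the boundary condition then gives \<open>Y T = - v 0\<close>.\<close>

lemma profile_unique:
  assumes prof: "radial_profile k lam v A"
  defines "\<beta> \<equiv> v 0 + ln lam"
  shows "lam = lam_of \<beta>" "\<And>r. 0 \<le> r \<Longrightarrow> r \<le> 1 \<Longrightarrow> v r = profile \<beta> r"
proof -
  interpret radial_profile k lam v A by fact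
  define T where "T = \<beta> / k"
  define t where "t x = exp (T - x)" for x
  define \<rho> where "\<rho> x = exp (1 - t x)" for x
  define Y1 where "Y1 x = v (\<rho> x) - v 0" for x
  define G1 where "G1 x = A (\<rho> x) * t x" for x
  have t1: "t x > 1" if "x < T" for x using that by (simp add: t_def)
  have \<rho>: "0 < \<rho> x" "\<rho> x < 1" if "x < T" for x using t1[OF that] by (auto simp: \<rho>_def)
  have dt: "(t has_real_derivative - t x) (at x)" for x
    unfolding t_def[abs_def] by (auto intro!: derivative_eq_intros)
  have d\<rho>: "(\<rho> has_real_derivative \<rho> x * t x) (at x)" for x
    unfolding \<rho>_def[abs_def] by (auto intro!: derivative_eq_intros dt)
  have \<rho>0: "filterlim \<rho> (at_right 0) at_bot"
  proof -
    have "filterlim (\<lambda>x. T - x) at_top at_bot"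
      using filterlim_tendsto_add_at_top[OF tendsto_const[of T] filterlim_uminus_at_top_at_bot] by simp
    then have "filterlim t at_top at_bot" unfolding t_def[abs_def] by (rule filterlim_compose[OF exp_at_top])
    from filterlim_tendsto_add_at_top[OF tendsto_const[of "- 1"] this]
    have "filterlim (\<lambda>x. 1 - t x) at_bot at_bot" by (simp add: filterlim_uminus_at_bot)
    from filterlim_compose[OF exp_at_bot this] have "(\<rho> \<longlongrightarrow> 0) at_bot" by (simp add: \<rho>_def[abs_def])
    then show ?thesis by (simp add: filterlim_at \<rho>_def)
  qed
  have "ancient_flow k {..<T} Y1 G1"
    unfolding ancient_flow_def flow_on_def
  proof (intro conjI ballI)
    fix x assume "x \<in> {..<T}"
    then have x: "x < T" by simp
    note r = \<rho>[OF x]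
    have tx: "t x > 0" using t1[OF x] by simp
    show "(Y1 has_real_derivative - G1 x) (at x)"
      unfolding Y1_def[abs_def] using r
      by (auto intro!: derivative_eq_intros DERIV_chain2[OF v_DERIV[OF r] d\<rho>] simp: G1_def)
    have "(G1 has_real_derivative lam * \<rho> x * V k (\<rho> x) * exp (v (\<rho> x)) * (\<rho> x * t x) * t x - A (\<rho> x) * t x) (at x)"
      unfolding G1_def[abs_def]
      by (auto intro!: derivative_eq_intros DERIV_chain2[OF A_DERIV[OF r] d\<rho>] dt)
    moreover have "lam * \<rho> x * V k (\<rho> x) * exp (v (\<rho> x)) * (\<rho> x * t x) * t x = exp (k * x + Y1 x)"
    proof -
      have lnr: "1 - ln (\<rho> x) = t x" by (simp add: \<rho>_def)
      have "V k (\<rho> x) = 1 / ((\<rho> x)\<^sup>2 * ((t x)\<^sup>2 * t x powr k))"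
        unfolding V_eq[OF r(1)] lnr using tx by (simp add: powr_add)
      then have "lam * \<rho> x * V k (\<rho> x) * exp (v (\<rho> x)) * (\<rho> x * t x) * t x = lam * exp (v (\<rho> x)) / t x powr k"
        using r tx by (simp add: power2_eq_square)
      also have "t x powr k = exp (k * T - k * x)" by (simp add: t_def powr_def algebra_simps)
      also have "k * T = v 0 + ln lam" using k by (simp add: T_def \<beta>_def)
      also have "lam * exp (v (\<rho> x)) / exp (v 0 + ln lam - k * x) = exp (k * x + Y1 x)"
        using lam_pos by (simp add: Y1_def exp_add exp_diff)
      finally show ?thesis .
    qed
    ultimately show "(G1 has_real_derivative exp (k * x + Y1 x) - G1 x) (at x)"
      by (simp add: G1_def)
  next
    have "(v \<longlongrightarrow> v 0) (at 0 within {0..1})" using v_cont by (auto simp: continuous_on_def)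
    then have "(v \<longlongrightarrow> v 0) (at_right 0)" by (simp add: at_within_Icc_at_right)
    from filterlim_compose[OF this \<rho>0] have "((\<lambda>x. v (\<rho> x) - v 0) \<longlongrightarrow> v 0 - v 0) at_bot"
      by (intro tendsto_intros)
    then show "(Y1 \<longlongrightarrow> 0) at_bot" by (simp add: Y1_def[abs_def])
    have "((\<lambda>x. exp T * A (\<rho> x)) \<longlongrightarrow> exp T * 0) at_bot"
      by (intro tendsto_intros filterlim_compose[OF A_tendsto \<rho>0])
    moreover have "exp x * G1 x = exp T * A (\<rho> x)" for x
      by (simp add: G1_def t_def exp_diff)
    ultimately show "((\<lambda>x. exp x * G1 x) \<longlongrightarrow> 0) at_bot" by simp
  qed
  from ancient_flow_unique(1)[OF k this anc_below] have Y: "Y1 x = Y x" if "x < T" for x using that .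
  have v_eq: "v r = v 0 + Y (T - ln (1 - ln r))" if r: "0 < r" "r < 1" for r
  proof -
    have "1 - ln r > 1" using r by simp
    then have "T - ln (1 - ln r) < T" "t (T - ln (1 - ln r)) = 1 - ln r" by (simp_all add: t_def)
    moreover from this have "\<rho> (T - ln (1 - ln r)) = r" using r by (simp add: \<rho>_def)
    ultimately show ?thesis using Y[of "T - ln (1 - ln r)"] by (simp add: Y1_def)
  qed
  \<comment> \<open>The radius \<open>1\<close> corresponds to the excluded endpoint
    \<open>x = T\<close> and is reached by continuity from the left.\<close>
  have "v 1 = v 0 + Y T"
  proof (rule tendsto_unique)
    have "(v \<longlongrightarrow> v 1) (at 1 within {0..1})" using v_cont by (auto simp: continuous_on_def)
    then show "(v \<longlongrightarrow> v 1) (at_left 1)" by (simp add: at_within_Icc_at_left)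
    have "isCont (\<lambda>r. v 0 + Y (T - ln (1 - ln r))) 1"
      by (intro continuous_intros isCont_o2[OF _ DERIV_isCont[OF universal_DERIV(1)]]) auto
    then have "((\<lambda>r. v 0 + Y (T - ln (1 - ln r))) \<longlongrightarrow> v 0 + Y (T - ln (1 - ln 1))) (at_left 1)"
      unfolding isCont_def by (rule tendsto_within_subset) simp
    moreover have "\<forall>\<^sub>F r in at_left 1. v 0 + Y (T - ln (1 - ln r)) = v r"
      unfolding eventually_at_left_field by (rule exI[of _ 0]) (use v_eq in auto)
    ultimately show "(v \<longlongrightarrow> v 0 + Y T) (at_left 1)" by (simp add: Lim_transform_eventually)
  qed simp
  then have YT: "Y T = - v 0" using v_1 by simp
  show "lam = lam_of \<beta>" using YT lam_pos by (simp add: lam_of_def T_def \<beta>_def)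
  show "v r = profile \<beta> r" if r: "0 \<le> r" "r \<le> 1" for r
  proof -
    consider "r = 0" | "r = 1" | "0 < r" "r < 1" using r by linarith
    then show ?thesis
      by cases (use YT v_1 v_eq in \<open>simp_all add: profile_def T_def\<close>)
  qed
qed

section \<open>Analyticity, limit, bound and unboundedness of the curve\<close>

lemma lam_of_analytic: "real_analytic_on UNIV (\<lambda>\<beta>. (lam_of \<beta>, - Y (\<beta> / k)))"
  unfolding real_analytic_on_def
proof
  fix \<beta>0 :: real
  have flow: "flow_on k UNIV Y G" using anc by (simp add: ancient_flow_def)
  obtain a c h where h: "h > 0"
    and a: "\<And>x. \<bar>x - \<beta>0 / k\<bar> < h \<Longrightarrow> (\<lambda>n. a n * (x - \<beta>0 / k) ^ n) sums exp (k * x + Y x)"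
    and c: "\<And>x. \<bar>x - \<beta>0 / k\<bar> < h \<Longrightarrow> (\<lambda>n. c n * (x - \<beta>0 / k) ^ n) sums Y x"
    by (rule flow_analytic[OF k flow, of "\<beta>0 / k"]) blast
  have "(\<lambda>n. (\<beta> - \<beta>0) ^ n *\<^sub>R (a n / k ^ n, - (c n / k ^ n))) sums (lam_of \<beta>, - Y (\<beta> / k))"
    if "\<bar>\<beta> - \<beta>0\<bar> < h * k" for \<beta>
  proof -
    have eq: "\<beta> / k - \<beta>0 / k = (\<beta> - \<beta>0) / k" by (simp add: diff_divide_distrib)
    have "\<bar>\<beta> / k - \<beta>0 / k\<bar> < h" using that k by (simp add: eq abs_divide field_simps)
    from a[OF this] sums_minus[OF c[OF this]]
    have "(\<lambda>n. a n / k ^ n * (\<beta> - \<beta>0) ^ n) sums lam_of \<beta>"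
      "(\<lambda>n. - (c n / k ^ n) * (\<beta> - \<beta>0) ^ n) sums (- Y (\<beta> / k))"
      using k by (simp_all add: eq power_divide lam_of_def)
    from tendsto_Pair[OF this[unfolded sums_def]] show ?thesis
      by (simp add: sums_def sum_prod mult.commute)
  qed
  then show "\<exists>a. \<exists>e>0. \<forall>y. \<bar>y - \<beta>0\<bar> < e \<longrightarrow> (\<lambda>n. (y - \<beta>0) ^ n *\<^sub>R a n) sums (lam_of y, - Y (y / k))"
    using h k by (intro exI[of _ "\<lambda>n. (a n / k ^ n, - (c n / k ^ n))"] exI[of _ "h * k"]) auto
qed

lemma lam_of_limit: "((\<lambda>\<beta>. (lam_of \<beta>, - Y (\<beta> / k))) \<longlongrightarrow> (0, 0)) at_bot"
proof -
  have lim: "filterlim (\<lambda>\<beta>. \<beta> / k) at_bot at_bot"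
    using filterlim_tendsto_pos_mult_at_bot[OF tendsto_const[of "1 / k"] _ filterlim_ident] k by simp
  have "((\<lambda>\<beta>. exp (k * (\<beta> / k) + Y (\<beta> / k))) \<longlongrightarrow> 0) at_bot"
    by (rule filterlim_compose[OF ancient_limits(3)[OF k anc_below[of 0]] lim])
  then have "(lam_of \<longlongrightarrow> 0) at_bot" using k by (simp add: lam_of_def[abs_def])
  moreover have "((\<lambda>\<beta>. - Y (\<beta> / k)) \<longlongrightarrow> - 0) at_bot"
    by (intro tendsto_minus filterlim_compose[OF ancient_limits(1)[OF k anc_below[of 0]] lim])
  ultimately show ?thesis by (intro tendsto_Pair) simp_all
qed

lemma lam_of_le: "lam_of \<beta> \<le> k * (1 + k)"
  using ancient_E_le[OF k anc_below, of "\<beta> / k" "\<beta> / k + 1"] k by (simp add: lam_of_def)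

lemma lam_of_unbounded: "\<not> bounded {(lam_of \<beta>, - Y (\<beta> / k)) | \<beta>. True}"
proof
  assume "bounded {(lam_of \<beta>, - Y (\<beta> / k)) | \<beta>. True}"
  then obtain B where B: "norm (lam_of \<beta>, - Y (\<beta> / k)) \<le> B" for \<beta>
    by (auto simp: bounded_iff)
  \<comment> \<open>Chosen so that \<open>exp \<beta> = k * (1 + k) * exp B\<close>; the lower bound
    for \<open>k * (1 + k) * exp (- Y (\<beta> / k))\<close> then exceeds the upper one by
    \<open>k * (1 + k)\<close>.\<close>
  define \<beta> where "\<beta> = ln (k * (1 + k)) + B"
  have K: "k * (1 + k) > 0" using k by simp
  have "- Y (\<beta> / k) \<le> B" using B[of \<beta>] norm_snd_le[of "- Y (\<beta> / k)" "lam_of \<beta>"] by simp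
  then have "k * (1 + k) * exp (- Y (\<beta> / k)) \<le> k * (1 + k) * exp B"
    using K by (intro mult_left_mono) auto
  moreover have "k * (1 + k) + exp (k * (\<beta> / k)) \<le> k * (1 + k) * exp (- Y (\<beta> / k))"
    by (rule ancient_exp_minus_Y[OF k anc_below, of _ "\<beta> / k + 1"]) simp
  moreover have "exp (k * (\<beta> / k)) = k * (1 + k) * exp B" using k K by (simp add: \<beta>_def exp_add)
  ultimately show False using K by linarith
qed

end

text \<open>The maximum \<open>v 0\<close> is attained only at the origin, a null set, so the lower
  bound rests on continuity: a smaller essential supremum would be exceeded on a punctured ball
  around the origin, which is not negligible.\<close>

lemma (in radial_profile) esssup_profile:
  assumes u: "\<And>x. x \<in> B1 \<Longrightarrow> u x = v (norm x)"
  shows "esssup (lebesgue_on B1) (\<lambda>x. ereal \<bar>u x\<bar>) = ereal (v 0)"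
proof -
  let ?M = "lebesgue_on B1"
  have sp: "space ?M = B1" by (simp add: space_restrict_space)
  have "(\<lambda>x. ereal \<bar>v (norm x)\<bar>) \<in> borel_measurable ?M" using measurable_v by measurable
  then have meas: "(\<lambda>x. ereal \<bar>u x\<bar>) \<in> borel_measurable ?M"
    by (rule measurable_cong[THEN iffD1, rotated]) (simp add: sp u)
  have le: "esssup ?M (\<lambda>x. ereal \<bar>u x\<bar>) \<le> ereal (v 0)"
    by (rule esssup_I[OF meas], rule AE_I2) (use v_bounds in \<open>simp add: sp u\<close>)
  show ?thesis
  proof (rule ccontr)
    assume "esssup ?M (\<lambda>x. ereal \<bar>u x\<bar>) \<noteq> ereal (v 0)"
    with le have less: "esssup ?M (\<lambda>x. ereal \<bar>u x\<bar>) < ereal (v 0)" by simp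
    have "(v \<longlongrightarrow> v 0) (at 0 within {0..1})" using v_cont by (auto simp: continuous_on_def)
    then have "((\<lambda>r. ereal (v r)) \<longlongrightarrow> ereal (v 0)) (at_right 0)" by (simp add: at_within_Icc_at_right)
    from order_tendstoD(1)[OF this less]
    obtain b where b: "b > 0" "\<And>r. 0 < r \<Longrightarrow> r < b \<Longrightarrow> esssup ?M (\<lambda>x. ereal \<bar>u x\<bar>) < ereal (v r)"
      unfolding eventually_at_right_field by auto
    define e where "e = min b 1"
    have e: "e > 0" "e \<le> 1" using b by (auto simp: e_def)
    have "AE x in ?M. x \<notin> ball 0 e"
      using esssup_AE[of "\<lambda>x. ereal \<bar>u x\<bar>" ?M] AE_lebesgue_on_neq[OF open_ball, of 0 0 1]
    proof eventually_elim
      case (elim x)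
      show ?case
      proof
        assume "x \<in> ball 0 e"
        then have x: "x \<in> B1" "0 < norm x" "norm x < b" using e elim by (auto simp: e_def)
        then show False using b(2)[of "norm x"] elim v_bounds[of "norm x"] by (simp add: u)
      qed
    qed
    then have "AE x in lebesgue. x \<in> B1 \<longrightarrow> x \<notin> ball (0 :: real^2) e"
      by (subst (asm) AE_restrict_space_iff) auto
    then have "AE x in lborel. x \<notin> ball (0 :: real^2) e"
      unfolding AE_completion_iff by eventually_elim (use e in auto)
    then have "ball (0 :: real^2) e \<in> null_sets lborel"
      by (subst AE_iff_null_sets) simp_all
    then have "negligible (ball (0 :: real^2) e)"
      by (simp only: negligible_iff_null_sets null_sets_completionI)
    then show False using open_not_negligible[of "ball (0 :: real^2) e"] e by auto
  qed
qed

theorem theorem1p1: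
  fixes k :: real
  assumes "k > 0"
  shows "\<exists>(lam :: real \<Rightarrow> real) (\<alpha> :: real \<Rightarrow> real) (u :: real \<Rightarrow> real \<Rightarrow> real).
     (\<forall>\<beta>. \<alpha> \<beta> = \<beta> - ln (lam \<beta>)) \<and>
     radial_solutions k = {(lam \<beta>, \<lambda>x. u (norm x) (\<alpha> \<beta>)) | \<beta>. True} \<and>
     (\<forall>\<beta>. esssup (lebesgue_on B1) (\<lambda>x. ereal \<bar>u (norm x) (\<alpha> \<beta>)\<bar>) = ereal (\<alpha> \<beta>) \<and>
          u 0 (\<alpha> \<beta>) = \<alpha> \<beta>) \<and>
     (\<forall>(l, w) \<in> radial_solutions k. w \<in> H10 B1 \<and> weak_solution k l w) \<and>
     real_analytic_on UNIV (\<lambda>\<beta>. (lam \<beta>, \<alpha> \<beta>)) \<and>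
     ((\<lambda>\<beta>. (lam \<beta>, \<alpha> \<beta>)) \<longlongrightarrow> (0, 0)) at_bot \<and>
     \<not> bounded {(lam \<beta>, \<alpha> \<beta>) | \<beta>. True} \<and>
     (\<exists>lamstar>0. \<forall>\<beta>. lam \<beta> \<le> lamstar)"
proof -
  note k = assms
  obtain Y G where anc: "ancient_flow k UNIV Y G" using ancient_flow_exists[OF k] by blast
  define lam where "lam = lam_of k Y"
  define \<alpha> where "\<alpha> \<beta> = - Y (\<beta> / k)" for \<beta>
  \<comment> \<open>The second argument of \<open>u\<close> is \<open>\<alpha> \<beta>\<close> and
    not \<open>\<beta>\<close> itself, so \<open>u\<close> must recover \<open>\<beta>\<close> from
    the value at the origin.\<close>
  have "inj \<alpha>"
  proof (rule linorder_injI)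
    show "\<alpha> x \<noteq> \<alpha> y" if "x < y" for x y
      using universal_decreasing[OF k anc, of "x / k" "y / k"] that k by (simp add: \<alpha>_def divide_strict_right_mono)
  qed
  define u where "u r a = (if r \<le> 1 then profile k Y (inv \<alpha> a) r else 0)" for r a
  have u: "u r (\<alpha> \<beta>) = (if r \<le> 1 then profile k Y \<beta> r else 0)" for r \<beta>
    using \<open>inj \<alpha>\<close> by (simp add: u_def)
  have sol: "(lam \<beta>, \<lambda>x. u (norm x) (\<alpha> \<beta>)) \<in> radial_solutions k" for \<beta>
    unfolding lam_def by (rule profile_solution[OF k anc]) (simp add: u)
  have unique: "\<exists>\<beta>. l = lam \<beta> \<and> w = (\<lambda>x. u (norm x) (\<alpha> \<beta>))" if "(l, w) \<in> radial_solutions k" for l w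
  proof -
    obtain v A where v: "radial_profile k l v A" "\<And>x. x \<in> cball 0 1 \<Longrightarrow> w x = v (norm x)"
      "\<And>x. x \<notin> cball 0 1 \<Longrightarrow> w x = 0"
      by (rule radial_solution_profile[OF k \<open>(l, w) \<in> radial_solutions k\<close>]) (rule that; assumption)
    define \<beta> where "\<beta> = v 0 + ln l"
    note un = profile_unique[OF k anc v(1), folded \<beta>_def]
    have "w x = u (norm x) (\<alpha> \<beta>)" for x
      using v(2,3)[of x] un(2)[of "norm x"] by (cases "norm x \<le> 1") (simp_all add: u)
    with un(1) show ?thesis by (intro exI[of _ \<beta>]) (auto simp: lam_def)
  qed
  have u0: "u 0 (\<alpha> \<beta>) = \<alpha> \<beta>" for \<beta>
    unfolding u by (simp add: profile_def[OF k anc] \<alpha>_def)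
  show ?thesis
  proof (rule exI[of _ lam], rule exI[of _ \<alpha>], rule exI[of _ u], intro conjI allI)
    show "\<alpha> \<beta> = \<beta> - ln (lam \<beta>)" for \<beta> by (simp add: \<alpha>_def lam_def lam_of_def[OF k anc])
    show "radial_solutions k = {(lam \<beta>, \<lambda>x. u (norm x) (\<alpha> \<beta>)) | \<beta>. True}"
      using sol unique by fastforce
    show "esssup (lebesgue_on B1) (\<lambda>x. ereal \<bar>u (norm x) (\<alpha> \<beta>)\<bar>) = ereal (\<alpha> \<beta>)" for \<beta>
    proof -
      define w where "w x = u (norm x) (\<alpha> \<beta>)" for x :: "real ^ 2"
      have w: "(lam \<beta>, w) \<in> radial_solutions k" using sol[of \<beta>] by (simp add: w_def[abs_def])
      obtain v A where v: "radial_profile k (lam \<beta>) v A" "\<And>x. x \<in> cball 0 1 \<Longrightarrow> w x = v (norm x)"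
        by (rule radial_solution_profile[OF k w]) (rule that; assumption)
      have "v 0 = \<alpha> \<beta>" using v(2)[of 0] u0 by (simp add: w_def)
      then show ?thesis using radial_profile.esssup_profile[OF v(1), of w] v(2) by (simp add: w_def)
    qed
    show "u 0 (\<alpha> \<beta>) = \<alpha> \<beta>" for \<beta> by (rule u0)
    have "w \<in> H10 B1 \<and> weak_solution k l w" if lw: "(l, w) \<in> radial_solutions k" for l w
    proof -
      obtain v A where v: "radial_profile k l v A" "\<And>x. x \<in> cball 0 1 \<Longrightarrow> w x = v (norm x)"
        by (rule radial_solution_profile[OF k lw]) (rule that; assumption)
      have w: "w x = v (norm x)" if "x \<in> B1" for x using v(2)[of x] that by simp
      show ?thesis using radial_profile.weak_solution_profile[OF v(1) w] by (auto simp: H10_def)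
    qed
    then show "\<forall>(l, w) \<in> radial_solutions k. w \<in> H10 B1 \<and> weak_solution k l w" by blast
    show "real_analytic_on UNIV (\<lambda>\<beta>. (lam \<beta>, \<alpha> \<beta>))"
      using lam_of_analytic[OF k anc] by (simp add: lam_def \<alpha>_def)
    show "((\<lambda>\<beta>. (lam \<beta>, \<alpha> \<beta>)) \<longlongrightarrow> (0, 0)) at_bot"
      using lam_of_limit[OF k anc] by (simp add: lam_def \<alpha>_def)
    show "\<not> bounded {(lam \<beta>, \<alpha> \<beta>) | \<beta>. True}"
      using lam_of_unbounded[OF k anc] by (simp add: lam_def \<alpha>_def)
    show "\<exists>lamstar>0. \<forall>\<beta>. lam \<beta> \<le> lamstar"
      using lam_of_le[OF k anc] k by (intro exI[of _ "k * (1 + k)"]) (simp add: lam_def)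
  qed
qed

end
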